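(* Let $\Omega\subset\mathbb{R}^2$ be a bounded domain with smooth boundary and let $T>0$. Let $\{\theta_n\}$ be a sequence of weak solutions of the inviscid SQG equation on $[0,T]$ which converges weakly in $L^2(0,T;L^2(\Omega))$ to some $\theta$. Then $\theta$ is a weak solution of the inviscid SQG equation on $[0,T]$.
   Context: All functions are real-valued. $-\Delta$ is the Dirichlet Laplacian on $\Omega$ with domain $H^2(\Omega)\cap H^1_0(\Omega)$; $\{w_j\}_{j\ge1}$ is an orthonormal basis of $L^2(\Omega)$ of eigenfunctions, $-\Delta w_j=\lambda_jw_j$, $0<\lambda_1<\lambda_2\le\dots\to\infty$. $\Lambda=\sqrt{-\Delta}$, and $\Lambda^{-1}f=\sum_j\lambda_j^{-1/2}f_jw_j$ for $f=\sum_jf_jw_j\in L^2(\Omega)$, $f_j=\int_\Omega fw_j\,dx$. $\nabla^\perp=(-\partial_2,\partial_1)$. The inviscid SQG equation is $\partial_t\theta+u\cdot\nabla\theta=0$, $u=\nabla^\perp\Lambda^{-1}\theta$. A weak solution of it on $[0,T]$ is a function $\theta\in L^2(0,T;L^2(\Omega))$ such that, with $u=\nabla^\perp\Lambda^{-1}\theta$, $$\int_0^T\!\int_\Omega\theta\,\partial_t\varphi\,dx\,dt+\int_0^T\!\int_\Omega u\theta\cdot\nabla\varphi\,dx\,dt=0\qquad\text{for all }\varphi\in C_c^\infty(\Omega\times(0,T)).$$ *)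

theory Defs
  imports "HOL-Analysis.Analysis"
begin

section \<open>Smooth functions, test functions, smooth domains\<close>

definition dir_deriv :: "('a::real_normed_vector \<Rightarrow> real) \<Rightarrow> 'a \<Rightarrow> 'a \<Rightarrow> real" where
  "dir_deriv f v = (\<lambda>x. frechet_derivative f (at x) v)"

text \<open>Only used for open sets: the derivatives are those of the ambient space.\<close>

primrec Ck_on :: "nat \<Rightarrow> 'a::euclidean_space set \<Rightarrow> ('a \<Rightarrow> real) \<Rightarrow> bool" where
  "Ck_on 0 S f \<longleftrightarrow> continuous_on S f"
| "Ck_on (Suc k) S f \<longleftrightarrow>
     (\<forall>x\<in>S. f differentiable (at x)) \<and> (\<forall>b\<in>Basis. Ck_on k S (dir_deriv f b))"

definition smooth_on :: "'a::euclidean_space set \<Rightarrow> ('a \<Rightarrow> real) \<Rightarrow> bool" where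
  "smooth_on S f \<longleftrightarrow> (\<forall>k. Ck_on k S f)"

text \<open>The space $C_c^\infty(S)$; its elements are extended by zero to the whole space.\<close>

definition test_functions :: "'a::euclidean_space set \<Rightarrow> ('a \<Rightarrow> real) set" where
  "test_functions S =
     {\<phi>. smooth_on UNIV \<phi> \<and> compact (closure {x. \<phi> x \<noteq> 0}) \<and> closure {x. \<phi> x \<noteq> 0} \<subseteq> S}"

text \<open>
  Smoothness of the boundary is expressed by local defining functions: near each boundary
  point the domain is the sublevel set of a smooth function with nonvanishing gradient.
  In particular the domain lies locally on one side of its boundary.
\<close>

definition smooth_boundary :: "'a::euclidean_space set \<Rightarrow> bool" where
  "smooth_boundary \<Omega> \<longleftrightarrow>
     (\<forall>p\<in>frontier \<Omega>. \<exists>U \<rho>. open U \<and> p \<in> U \<and> smooth_on U \<rho> \<and>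
        (\<forall>x\<in>U. \<exists>b\<in>Basis. dir_deriv \<rho> b x \<noteq> 0) \<and>
        \<Omega> \<inter> U = {x\<in>U. \<rho> x < 0})"

definition bounded_smooth_domain :: "'a::euclidean_space set \<Rightarrow> bool" where
  "bounded_smooth_domain \<Omega> \<longleftrightarrow>
     open \<Omega> \<and> connected \<Omega> \<and> \<Omega> \<noteq> {} \<and> bounded \<Omega> \<and> smooth_boundary \<Omega>"


section \<open>Square integrable functions\<close>

text \<open>
  Functions are representatives of their classes: equality in $L^2$ is equality almost
  everywhere, and values off the underlying set are irrelevant.
\<close>

definition L2 :: "'a measure \<Rightarrow> ('a \<Rightarrow> real) set" where
  "L2 M = {f \<in> borel_measurable M. integrable M (\<lambda>x. (f x)\<^sup>2)}"

definition L2_inner :: "'a measure \<Rightarrow> ('a \<Rightarrow> real) \<Rightarrow> ('a \<Rightarrow> real) \<Rightarrow> real" where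
  "L2_inner M f g = (LINT x|M. f x * g x)"

definition L2_converges :: "'a measure \<Rightarrow> (nat \<Rightarrow> 'a \<Rightarrow> real) \<Rightarrow> ('a \<Rightarrow> real) \<Rightarrow> bool" where
  "L2_converges M fs f \<longleftrightarrow>
     (\<forall>n. fs n \<in> L2 M) \<and> f \<in> L2 M \<and> (\<lambda>n. sqrt (LINT x|M. (fs n x - f x)\<^sup>2)) \<longlonglongrightarrow> 0"

definition L2_converges_weakly ::
    "'a measure \<Rightarrow> (nat \<Rightarrow> 'a \<Rightarrow> real) \<Rightarrow> ('a \<Rightarrow> real) \<Rightarrow> bool" where
  "L2_converges_weakly M fs f \<longleftrightarrow>
     (\<forall>n. fs n \<in> L2 M) \<and> f \<in> L2 M \<and>
     (\<forall>g\<in>L2 M. (\<lambda>n. L2_inner M (fs n) g) \<longlonglongrightarrow> L2_inner M f g)"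

definition orthonormal_basis_L2 :: "'a measure \<Rightarrow> (nat \<Rightarrow> 'a \<Rightarrow> real) \<Rightarrow> bool" where
  "orthonormal_basis_L2 M w \<longleftrightarrow>
     (\<forall>j. w j \<in> L2 M) \<and>
     (\<forall>i j. L2_inner M (w i) (w j) = (if i = j then 1 else 0)) \<and>
     (\<forall>f\<in>L2 M. L2_converges M (\<lambda>n x. \<Sum>j<n. L2_inner M f (w j) * w j x) f)"


section \<open>Sobolev spaces and the Dirichlet Laplacian on planar domains\<close>

definition has_weak_partial ::
    "(real^2) set \<Rightarrow> 2 \<Rightarrow> (real^2 \<Rightarrow> real) \<Rightarrow> (real^2 \<Rightarrow> real) \<Rightarrow> bool" where
  "has_weak_partial \<Omega> i f g \<longleftrightarrow>
     f \<in> L2 (lebesgue_on \<Omega>) \<and> g \<in> L2 (lebesgue_on \<Omega>) \<and>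
     (\<forall>\<phi>\<in>test_functions \<Omega>.
        (LINT x|lebesgue_on \<Omega>. f x * dir_deriv \<phi> (axis i 1) x)
          = - (LINT x|lebesgue_on \<Omega>. g x * \<phi> x))"

definition weak_partial :: "(real^2) set \<Rightarrow> 2 \<Rightarrow> (real^2 \<Rightarrow> real) \<Rightarrow> real^2 \<Rightarrow> real" where
  "weak_partial \<Omega> i f = (SOME g. has_weak_partial \<Omega> i f g)"

text \<open>The space $H^k(\Omega)$.\<close>

primrec Sobolev :: "nat \<Rightarrow> (real^2) set \<Rightarrow> (real^2 \<Rightarrow> real) set" where
  "Sobolev 0 \<Omega> = L2 (lebesgue_on \<Omega>)"
| "Sobolev (Suc k) \<Omega> =
     {f \<in> L2 (lebesgue_on \<Omega>). \<forall>i. \<exists>g\<in>Sobolev k \<Omega>. has_weak_partial \<Omega> i f g}"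

text \<open>The space $H^1_0(\Omega)$: the closure of $C_c^\infty(\Omega)$ in $H^1(\Omega)$.\<close>

definition Sobolev1_0 :: "(real^2) set \<Rightarrow> (real^2 \<Rightarrow> real) set" where
  "Sobolev1_0 \<Omega> =
     {f \<in> Sobolev 1 \<Omega>. \<exists>\<phi>. (\<forall>n::nat. \<phi> n \<in> test_functions \<Omega>) \<and>
        L2_converges (lebesgue_on \<Omega>) \<phi> f \<and>
        (\<forall>i. L2_converges (lebesgue_on \<Omega>) (\<lambda>n. dir_deriv (\<phi> n) (axis i 1)) (weak_partial \<Omega> i f))}"

definition weak_laplacian :: "(real^2) set \<Rightarrow> (real^2 \<Rightarrow> real) \<Rightarrow> real^2 \<Rightarrow> real" where
  "weak_laplacian \<Omega> f = (\<lambda>x. \<Sum>i\<in>UNIV. weak_partial \<Omega> i (weak_partial \<Omega> i f) x)"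

text \<open>The eigenvalues $\lambda_1 \le \lambda_2 \le \dots$ are written \<open>\<mu> 0, \<mu> 1, \<dots>\<close>.\<close>

definition dirichlet_eigenbasis ::
    "(real^2) set \<Rightarrow> (nat \<Rightarrow> real^2 \<Rightarrow> real) \<Rightarrow> (nat \<Rightarrow> real) \<Rightarrow> bool" where
  "dirichlet_eigenbasis \<Omega> w \<mu> \<longleftrightarrow>
     orthonormal_basis_L2 (lebesgue_on \<Omega>) w \<and>
     (\<forall>j. w j \<in> Sobolev 2 \<Omega> \<inter> Sobolev1_0 \<Omega> \<and>
          (AE x in lebesgue_on \<Omega>. - weak_laplacian \<Omega> (w j) x = \<mu> j * w j x)) \<and>
     0 < \<mu> 0 \<and> mono \<mu> \<and> filterlim \<mu> at_top sequentially"


section \<open>The inviscid SQG equation\<close>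

text \<open>The operator $\Lambda^{-1}$, $\Lambda = \sqrt{-\Delta}$, given by its eigenfunction expansion.\<close>

definition Lambda_inv ::
    "(real^2) set \<Rightarrow> (nat \<Rightarrow> real^2 \<Rightarrow> real) \<Rightarrow> (nat \<Rightarrow> real) \<Rightarrow> (real^2 \<Rightarrow> real) \<Rightarrow> real^2 \<Rightarrow> real" where
  "Lambda_inv \<Omega> w \<mu> f =
     (SOME g. L2_converges (lebesgue_on \<Omega>)
        (\<lambda>n x. \<Sum>j<n. \<mu> j powr (-1/2) * L2_inner (lebesgue_on \<Omega>) f (w j) * w j x) g)"

definition perp_grad :: "(real^2) set \<Rightarrow> (real^2 \<Rightarrow> real) \<Rightarrow> real^2 \<Rightarrow> real^2" where
  "perp_grad \<Omega> f = (\<lambda>x. vector [- weak_partial \<Omega> 2 f x, weak_partial \<Omega> 1 f x])"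

definition sqg_velocity ::
    "(real^2) set \<Rightarrow> (nat \<Rightarrow> real^2 \<Rightarrow> real) \<Rightarrow> (nat \<Rightarrow> real) \<Rightarrow> (real^2 \<Rightarrow> real) \<Rightarrow> real^2 \<Rightarrow> real^2" where
  "sqg_velocity \<Omega> w \<mu> f = perp_grad \<Omega> (Lambda_inv \<Omega> w \<mu> f)"

text \<open>
  $L^2(0,T;L^2(\Omega))$ is identified, as usual, with $L^2$ of the space-time cylinder.
  Space-time points are written \<open>(t, x)\<close>, time first.
\<close>

definition cylinder :: "real \<Rightarrow> (real^2) set \<Rightarrow> (real \<times> (real^2)) measure" where
  "cylinder T \<Omega> = lebesgue_on ({0<..<T} \<times> \<Omega>)"

definition space_grad :: "(real \<times> (real^2) \<Rightarrow> real) \<Rightarrow> real \<times> (real^2) \<Rightarrow> real^2" where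
  "space_grad \<phi> z = (\<chi> i. dir_deriv \<phi> (0, axis i 1) z)"

text \<open>
  The velocity is determined at almost every time, and then only up to a null set in space.
  Iterated integrals do not see this choice.
\<close>

definition sqg_weak_solution ::
    "(real^2) set \<Rightarrow> (nat \<Rightarrow> real^2 \<Rightarrow> real) \<Rightarrow> (nat \<Rightarrow> real) \<Rightarrow> real \<Rightarrow> (real \<Rightarrow> real^2 \<Rightarrow> real) \<Rightarrow> bool" where
  "sqg_weak_solution \<Omega> w \<mu> T \<theta> \<longleftrightarrow>
     (\<lambda>(t, x). \<theta> t x) \<in> L2 (cylinder T \<Omega>) \<and>
     (\<forall>\<phi>\<in>test_functions ({0<..<T} \<times> \<Omega>).
        (LINT t|lebesgue_on {0<..<T}. LINT x|lebesgue_on \<Omega>.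
            \<theta> t x * dir_deriv \<phi> (1, 0) (t, x))
        + (LINT t|lebesgue_on {0<..<T}. LINT x|lebesgue_on \<Omega>.
            (\<theta> t x *\<^sub>R sqg_velocity \<Omega> w \<mu> (\<theta> t) x) \<bullet> space_grad \<phi> (t, x)) = 0)"

end

theory Submission
  imports Defs "HOL-Computational_Algebra.Polynomial"
begin

text \<open>
  Fix a test function \<open>\<phi>\<close> at one time and put \<open>D = \<nabla>\<phi> \<cdot> \<nabla>\<^sup>\<bottom>\<close>. Since \<open>D\<close> is antisymmetric, only the
  commutator of \<open>D\<close> with \<open>\<Lambda>\<^sup>-\<^sup>1\<close> contributes to \<open>Q(\<theta>) = \<integral> \<theta> D(\<Lambda>\<^sup>-\<^sup>1\<theta>) dx\<close>. Its entries in the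
  eigenbasis are those of the commutator of \<open>-\<Delta>\<close> with \<open>D\<close>, divided by
  \<open>\<lambda>\<^sub>j \<lambda>\<^sub>k (\<lambda>\<^sub>j + \<lambda>\<^sub>k)\<close>, where \<open>\<lambda>\<^sub>j\<close> is the square root of the \<open>j\<close>-th eigenvalue. The commutator of
  \<open>-\<Delta>\<close> with \<open>D\<close> is a form on gradients, bounded by the second derivatives of \<open>\<phi>\<close>, and the
  factor \<open>1 / (\<lambda>\<^sub>j + \<lambda>\<^sub>k)\<close> results from integrating along the semigroup \<open>e\<^sup>-\<^sup>s\<^sup>\<Lambda>\<close>. Hence \<open>Q(\<theta>)\<close> differs
  from its value on the first \<open>N\<close> modes of \<open>\<theta>\<close> by at most a constant times
  \<open>\<parallel>\<theta>\<parallel>\<^sup>2 / \<lambda>\<^sub>N\<close>, which is uniformly small along a weakly convergent, hence bounded, sequence.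
  On finitely many modes the quadratic terms converge because \<open>\<integral> \<theta>\<^sub>n \<eta> dx\<close> converges strongly in
  \<open>L\<^sup>2(0,T)\<close> for every test function \<open>\<eta>\<close>: by the equation, its time derivative is bounded in
  \<open>L\<^sup>1(0,T)\<close>, and the eigenfunctions are limits of test functions in \<open>L\<^sup>2\<close>.
\<close>

section \<open>Smooth functions and test functions\<close>

text \<open>The velocity is a transform of \<theta> of order zero, so the nonlinear term is a
  product of two merely weakly convergent factors with no evident smoothing. The smoothing is hidden
  in a symmetry: a quadratic form sees only the symmetric part of its matrix, here D_jk
  (1/\<lambda>_k - 1/\<lambda>_j) / 2, which is the commutator entry (\<lambda>_j^2 - \<lambda>_k^2)
  D_jk divided by 2 \<lambda>_j \<lambda>_k (\<lambda>_j + \<lambda>_k). The weights 1/\<lambda>_j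
  and 1/\<lambda>_k turn gradient norms back into L^2 norms; the weight 1/(\<lambda>_j +
  \<lambda>_k) is the gain. Its effect on a bound for forms is not visible entry by entry, but
  exp(-s \<lambda>_j) exp(-s \<lambda>_k) merely rescales the two arguments of the form, and its
  integral over s > 0 is that weight. On modes from N on one factor decays like exp(-s \<lambda>_N),
  whence the factor 1/\<lambda>_N. The boundary is dealt with twice: the compact support of \<phi>
  removes boundary terms from the product rule, and membership of the eigenfunctions in H^1_0
  removes them from Green's formula.\<close>

lemma dir_deriv_eq: "(f has_derivative f') (at x) \<Longrightarrow> dir_deriv f v x = f' v"
  unfolding dir_deriv_def using frechet_derivative_at by fastforce

lemma has_derivative_dir_deriv:
  "f differentiable (at x) \<Longrightarrow> (f has_derivative (\<lambda>v. dir_deriv f v x)) (at x)"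
  unfolding dir_deriv_def by (simp add: frechet_derivative_works[symmetric])

lemma dir_deriv_Basis_sum:
  fixes f :: "'a::euclidean_space \<Rightarrow> real"
  assumes "f differentiable (at x)"
  shows "dir_deriv f v x = (\<Sum>b\<in>Basis. (v \<bullet> b) * dir_deriv f b x)"
proof -
  interpret bounded_linear "\<lambda>v. dir_deriv f v x"
    using has_derivative_dir_deriv[OF assms] has_derivative_bounded_linear by blast
  have "dir_deriv f v x = dir_deriv f (\<Sum>b\<in>Basis. (v \<bullet> b) *\<^sub>R b) x"
    by (simp add: euclidean_representation)
  also have "\<dots> = (\<Sum>b\<in>Basis. (v \<bullet> b) * dir_deriv f b x)"
    by (simp add: sum scaleR)
  finally show ?thesis .
qed

lemma Ck_on_SucD: "Ck_on (Suc k) UNIV f \<Longrightarrow> Ck_on k UNIV f"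
proof (induction k arbitrary: f)
  case 0
  then show ?case
    by (simp add: continuous_on_eq_continuous_at differentiable_imp_continuous_within)
next
  case (Suc k)
  then show ?case by (metis Ck_on.simps(2))
qed

lemma Ck_on_const: "Ck_on k UNIV (\<lambda>x. c)"
proof (induction k arbitrary: c)
  case (Suc k)
  have "dir_deriv (\<lambda>x. c) b = (\<lambda>x. 0)" for b :: 'a
    by (rule ext, rule dir_deriv_eq) simp
  then show ?case using Suc by simp
qed simp

lemma Ck_on_add:
  assumes "Ck_on k UNIV f" "Ck_on k UNIV g"
  shows "Ck_on k UNIV (\<lambda>x. f x + g x)"
  using assms
proof (induction k arbitrary: f g)
  case 0
  then show ?case by (simp add: continuous_on_add)
next
  case (Suc k)
  have "dir_deriv (\<lambda>x. f x + g x) b = (\<lambda>x. dir_deriv f b x + dir_deriv g b x)" for b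
    using Suc.prems
    by (intro ext dir_deriv_eq has_derivative_add has_derivative_dir_deriv) auto
  then show ?case using Suc by auto
qed

lemma Ck_on_sum:
  assumes "finite A" "\<And>i. i \<in> A \<Longrightarrow> Ck_on k UNIV (f i)"
  shows "Ck_on k UNIV (\<lambda>x. \<Sum>i\<in>A. f i x)"
  using assms by (induction A) (auto intro: Ck_on_const Ck_on_add)

lemma dir_deriv_mult:
  assumes "f differentiable (at x)" "g differentiable (at x)"
  shows "dir_deriv (\<lambda>x. f x * g x) b x = f x * dir_deriv g b x + dir_deriv f b x * g x"
  using has_derivative_mult[OF has_derivative_dir_deriv[OF assms(1)] has_derivative_dir_deriv[OF assms(2)]]
  by (rule dir_deriv_eq)

lemma Ck_on_mult:
  assumes "Ck_on k UNIV f" "Ck_on k UNIV g"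
  shows "Ck_on k UNIV (\<lambda>x. f x * g x)"
  using assms
proof (induction k arbitrary: f g)
  case 0
  then show ?case by (simp add: continuous_on_mult)
next
  case (Suc k)
  have eq: "dir_deriv (\<lambda>x. f x * g x) b = (\<lambda>x. f x * dir_deriv g b x + dir_deriv f b x * g x)" for b
    using Suc.prems by (intro ext dir_deriv_mult) auto
  show ?case
    using Suc.prems Suc.IH Ck_on_SucD[OF Suc.prems(1)] Ck_on_SucD[OF Suc.prems(2)]
    by (auto simp: eq intro!: Ck_on_add)
qed

lemma has_derivative_affine_comp:
  assumes "bounded_linear L" "f differentiable (at (c + L x))"
  shows "((\<lambda>x. f (c + L x)) has_derivative (\<lambda>v. dir_deriv f (L v) (c + L x))) (at x)"
proof -
  have "((\<lambda>x. c + L x) has_derivative L) (at x)"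
    using bounded_linear.has_derivative[OF assms(1) has_derivative_ident]
    by (auto intro!: derivative_eq_intros)
  from has_derivative_compose[OF this has_derivative_dir_deriv[OF assms(2)]]
  show ?thesis .
qed

lemma dir_deriv_affine_comp:
  assumes "bounded_linear L" "f differentiable (at (c + L x))"
  shows "dir_deriv (\<lambda>x. f (c + L x)) v x = dir_deriv f (L v) (c + L x)"
  using has_derivative_affine_comp[OF assms] by (rule dir_deriv_eq)

lemma Ck_on_affine_comp:
  fixes L :: "'a::euclidean_space \<Rightarrow> 'b::euclidean_space"
  assumes L: "bounded_linear L" and f: "Ck_on k UNIV f"
  shows "Ck_on k UNIV (\<lambda>x. f (c + L x))"
  using f
proof (induction k arbitrary: f)
  case 0
  have "continuous_on UNIV (\<lambda>x. c + L x)"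
    by (intro continuous_intros linear_continuous_on L)
  then show ?case using 0 continuous_on_compose2[of UNIV f UNIV] by auto
next
  case (Suc k)
  have eq: "dir_deriv (\<lambda>x. f (c + L x)) v
      = (\<lambda>x. \<Sum>b\<in>Basis. (L v \<bullet> b) * dir_deriv f b (c + L x))" for v
    using Suc.prems L by (auto simp: dir_deriv_affine_comp dir_deriv_Basis_sum[of f _ "L v"])
  have "(\<lambda>x. f (c + L x)) differentiable (at x)" for x
    using has_derivative_affine_comp[OF L, of f c x] Suc.prems by (auto simp: differentiable_def)
  moreover have "Ck_on k UNIV (dir_deriv (\<lambda>x. f (c + L x)) v)" for v
    unfolding eq using Suc by (intro Ck_on_sum Ck_on_mult Ck_on_const) auto
  ultimately show ?case by simp
qed

section \<open>Calculus of smooth functions\<close>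

abbreviation smooth :: "('a::euclidean_space \<Rightarrow> real) \<Rightarrow> bool" where
  "smooth \<equiv> smooth_on UNIV"

lemma smooth_unfold:
  "smooth f \<longleftrightarrow> (\<forall>x. f differentiable (at x)) \<and> (\<forall>b\<in>Basis. smooth (dir_deriv f b))"
proof
  assume f: "smooth f"
  then have "Ck_on (Suc k) UNIV f" for k unfolding smooth_on_def by blast
  then show "(\<forall>x. f differentiable (at x)) \<and> (\<forall>b\<in>Basis. smooth (dir_deriv f b))"
    unfolding smooth_on_def by auto
next
  assume f: "(\<forall>x. f differentiable (at x)) \<and> (\<forall>b\<in>Basis. smooth (dir_deriv f b))"
  then have "Ck_on (Suc k) UNIV f" for k unfolding smooth_on_def by auto
  then show "smooth f" unfolding smooth_on_def using Ck_on_SucD by blast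
qed

text \<open>Each level \<open>Ck_on k\<close> follows by induction from the closure of
  \<open>P\<close> under partial derivatives, so higher derivatives need no explicit formula.
  Intended for the flat exponentials, all of whose derivatives have one common shape.\<close>

lemma smooth_coinduct:
  assumes "P f" and "\<And>f. P f \<Longrightarrow> (\<forall>x. f differentiable (at x)) \<and> (\<forall>b\<in>Basis. P (dir_deriv f b))"
  shows "smooth f"
proof -
  have "P f \<Longrightarrow> Ck_on k UNIV f" for k f
  proof (induction k arbitrary: f)
    case 0
    then show ?case using assms(2)
      by (simp add: continuous_on_eq_continuous_at differentiable_imp_continuous_within)
  next
    case (Suc k)
    then show ?case using assms(2) by auto
  qed
  then show ?thesis using assms(1) unfolding smooth_on_def by blast
qed

lemma smooth_differentiable: "smooth f \<Longrightarrow> f differentiable (at x)"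
  using smooth_unfold by blast

lemma smooth_has_derivative: "smooth f \<Longrightarrow> (f has_derivative (\<lambda>v. dir_deriv f v x)) (at x)"
  by (simp add: has_derivative_dir_deriv smooth_differentiable)

lemma smooth_continuous_on: "smooth f \<Longrightarrow> continuous_on S f"
  using Ck_on.simps(1) continuous_on_subset smooth_on_def subset_UNIV by metis

lemma smooth_borel_measurable: "smooth f \<Longrightarrow> f \<in> borel_measurable borel"
  by (intro borel_measurable_continuous_onI smooth_continuous_on)

lemma smooth_dir_deriv: "smooth f \<Longrightarrow> b \<in> Basis \<Longrightarrow> smooth (dir_deriv f b)"
  using smooth_unfold by blast

lemma smooth_const: "smooth (\<lambda>x. c)"
  by (simp add: smooth_on_def Ck_on_const)

lemma smooth_add: "smooth f \<Longrightarrow> smooth g \<Longrightarrow> smooth (\<lambda>x. f x + g x)"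
  by (simp add: smooth_on_def Ck_on_add)

lemma smooth_mult: "smooth f \<Longrightarrow> smooth g \<Longrightarrow> smooth (\<lambda>x. f x * g x)"
  by (simp add: smooth_on_def Ck_on_mult)

lemma smooth_minus: "smooth f \<Longrightarrow> smooth (\<lambda>x. - f x)"
  using smooth_mult[of "\<lambda>_. -1" f] by (simp add: smooth_const)

lemma smooth_diff: "smooth f \<Longrightarrow> smooth g \<Longrightarrow> smooth (\<lambda>x. f x - g x)"
  using smooth_add[of f "\<lambda>x. - g x"] by (simp add: smooth_minus)

lemma smooth_affine_comp:
  fixes L :: "'a::euclidean_space \<Rightarrow> 'b::euclidean_space"
  shows "bounded_linear L \<Longrightarrow> smooth f \<Longrightarrow> smooth (\<lambda>x. f (c + L x))"
  by (simp add: smooth_on_def Ck_on_affine_comp)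


lemma smooth_has_line_derivative:
  fixes f :: "'a::euclidean_space \<Rightarrow> real"
  assumes "smooth f"
  shows "((\<lambda>s. f (c + s *\<^sub>R v)) has_real_derivative dir_deriv f v (c + s *\<^sub>R v)) (at s)"
proof -
  have L: "bounded_linear (\<lambda>s::real. s *\<^sub>R v)" by (rule bounded_linear_scaleR_left)
  have "((\<lambda>s. f (c + s *\<^sub>R v)) has_derivative (\<lambda>r. dir_deriv f (r *\<^sub>R v) (c + s *\<^sub>R v))) (at s)"
    by (rule has_derivative_affine_comp[OF L smooth_differentiable[OF assms]])
  moreover have "dir_deriv f (r *\<^sub>R v) y = r * dir_deriv f v y" for r y
    using linear_scale[OF has_derivative_linear[OF smooth_has_derivative[OF assms]]] by simp
  ultimately show ?thesis by (simp add: has_field_derivative_def mult.commute[of _ "dir_deriv _ _ _"])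
qed

text \<open>The mean value theorem is applied twice: to \<open>G\<close>, the increment of f in
  direction j viewed as a function along i, and then along j to the partial derivative in direction
  i.\<close>

lemma smooth_second_difference:
  fixes f :: "'a::euclidean_space \<Rightarrow> real"
  assumes f: "smooth f" and i: "i \<in> Basis" and j: "j \<in> Basis" and h: "h > 0"
  shows "\<exists>s t. 0 < s \<and> s < h \<and> 0 < t \<and> t < h \<and>
    f (x + h *\<^sub>R i + h *\<^sub>R j) - f (x + h *\<^sub>R i) - f (x + h *\<^sub>R j) + f x
      = h * h * dir_deriv (dir_deriv f i) j (x + s *\<^sub>R i + t *\<^sub>R j)"
proof -
  note d = smooth_has_line_derivative
  define G where "G s = f ((x + h *\<^sub>R j) + s *\<^sub>R i) - f (x + s *\<^sub>R i)" for s
  have "(G has_real_derivative (dir_deriv f i ((x + h *\<^sub>R j) + s *\<^sub>R i) - dir_deriv f i (x + s *\<^sub>R i))) (at s)" for s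
    unfolding G_def by (intro DERIV_diff d f)
  from MVT2[OF h this] obtain s where s: "0 < s" "s < h"
    "G h - G 0 = h * (dir_deriv f i ((x + h *\<^sub>R j) + s *\<^sub>R i) - dir_deriv f i (x + s *\<^sub>R i))" by auto
  from MVT2[OF h d[OF smooth_dir_deriv[OF f i], of "x + s *\<^sub>R i" j]]
  obtain t where t: "0 < t" "t < h"
    "dir_deriv f i (x + s *\<^sub>R i + h *\<^sub>R j) - dir_deriv f i (x + s *\<^sub>R i)
      = h * dir_deriv (dir_deriv f i) j (x + s *\<^sub>R i + t *\<^sub>R j)"
    by auto
  show ?thesis
    using s t by (intro exI[of _ s] exI[of _ t]) (auto simp: G_def algebra_simps)
qed

text \<open>The second difference quotient is symmetric in i and j, while by continuity of the mixed
  derivatives its limit is the mixed derivative in either order.\<close>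

lemma smooth_dir_deriv_commute:
  fixes f :: "'a::euclidean_space \<Rightarrow> real"
  assumes f: "smooth f" and i: "i \<in> Basis" and j: "j \<in> Basis"
  shows "dir_deriv (dir_deriv f i) j x = dir_deriv (dir_deriv f j) i x"
proof -
  have lim: "((\<lambda>h. (f (x + h *\<^sub>R i + h *\<^sub>R j) - f (x + h *\<^sub>R i) - f (x + h *\<^sub>R j) + f x) / (h * h))
      \<longlongrightarrow> dir_deriv (dir_deriv f i) j x) (at_right 0)"
    if i: "i \<in> Basis" and j: "j \<in> Basis" for i j
  proof (rule tendstoI)
    let ?g = "dir_deriv (dir_deriv f i) j"
    fix e :: real assume "e > 0"
    have "isCont ?g x"
      using smooth_continuous_on[OF smooth_dir_deriv[OF smooth_dir_deriv[OF f i] j], of UNIV]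
      by (simp add: continuous_on_eq_continuous_at)
    then obtain d where d: "d > 0" "\<And>y. dist y x < d \<Longrightarrow> dist (?g y) (?g x) < e"
      using \<open>e > 0\<close> unfolding continuous_at_eps_delta by blast
    \<comment> \<open>Halving d leaves room for both displacements: the intermediate point lies
      within s + t < 2h < d of x.\<close>
    have "dist ((f (x + h *\<^sub>R i + h *\<^sub>R j) - f (x + h *\<^sub>R i) - f (x + h *\<^sub>R j) + f x) / (h * h)) (?g x) < e"
      if h: "0 < h" "h < d / 2" for h
    proof -
      obtain s t where st: "0 < s" "s < h" "0 < t" "t < h"
        "f (x + h *\<^sub>R i + h *\<^sub>R j) - f (x + h *\<^sub>R i) - f (x + h *\<^sub>R j) + f x
          = h * h * ?g (x + s *\<^sub>R i + t *\<^sub>R j)"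
        using smooth_second_difference[OF f i j h(1), of x] by blast
      have "norm (s *\<^sub>R i + t *\<^sub>R j) \<le> s + t"
        using norm_triangle_ineq[of "s *\<^sub>R i" "t *\<^sub>R j"] st i j by simp
      then have "dist (x + s *\<^sub>R i + t *\<^sub>R j) x < d"
        using st h by (simp add: dist_norm add.assoc)
      then show ?thesis using d(2) h st(5) by simp
    qed
    then show "\<forall>\<^sub>F h in at_right 0. dist ((f (x + h *\<^sub>R i + h *\<^sub>R j) - f (x + h *\<^sub>R i) - f (x + h *\<^sub>R j) + f x) / (h * h)) (?g x) < e"
      unfolding eventually_at_right_field using d(1) by (intro exI[of _ "d / 2"]) auto
  qed
  have "f (x + h *\<^sub>R j + h *\<^sub>R i) - f (x + h *\<^sub>R j) - f (x + h *\<^sub>R i) + f x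
      = f (x + h *\<^sub>R i + h *\<^sub>R j) - f (x + h *\<^sub>R i) - f (x + h *\<^sub>R j) + f x" for h
    by (simp add: algebra_simps)
  then show ?thesis
    using tendsto_unique[OF trivial_limit_at_right_real lim[OF i j]] lim[OF j i]
    by (simp add: algebra_simps)
qed

section \<open>Compactly supported test functions\<close>

lemma test_functionsI:
  assumes "smooth f" "compact K" "K \<subseteq> S" "\<And>x. x \<notin> K \<Longrightarrow> f x = 0"
  shows "f \<in> test_functions S"
proof -
  have "closure {x. f x \<noteq> 0} \<subseteq> K"
    using assms(2,4) by (intro closure_minimal) (auto intro: compact_imp_closed)
  then show ?thesis
    using assms unfolding test_functions_def
    by (auto intro: bounded_subset simp: compact_eq_bounded_closed)
qed

lemma test_functionsE:
  assumes "f \<in> test_functions S"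
  obtains K where "compact K" "K \<subseteq> S" "\<And>x. x \<notin> K \<Longrightarrow> f x = 0"
    "\<And>x v. x \<notin> K \<Longrightarrow> dir_deriv f v x = 0"
proof -
  define K where "K = closure {x. f x \<noteq> 0}"
  have K: "compact K" "K \<subseteq> S" using assms by (auto simp: test_functions_def K_def)
  have 1: "f x = 0" if "x \<notin> K" for x
    using that closure_subset[of "{x. f x \<noteq> 0}"] unfolding K_def by auto
  have "dir_deriv f v x = 0" if "x \<notin> K" for x v
  proof -
    have "((\<lambda>x. 0) has_derivative (\<lambda>v. 0)) (at x)" by simp
    moreover have "open (- K)" using K by (simp add: compact_imp_closed open_Compl)
    ultimately have "(f has_derivative (\<lambda>v. 0)) (at x)"
      by (rule has_derivative_transform_within_open) (use that 1 in auto)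
    then show ?thesis by (rule dir_deriv_eq)
  qed
  then show thesis using that K 1 by blast
qed

lemma test_functions_smooth: "f \<in> test_functions S \<Longrightarrow> smooth f"
  by (simp add: test_functions_def)

lemma test_functions_outside: "f \<in> test_functions S \<Longrightarrow> x \<notin> S \<Longrightarrow> f x = 0"
  by (metis subset_iff test_functionsE)

lemma test_functions_mono: "S \<subseteq> S' \<Longrightarrow> f \<in> test_functions S \<Longrightarrow> f \<in> test_functions S'"
  by (auto simp: test_functions_def)

lemma test_functions_dir_deriv:
  assumes "f \<in> test_functions S" "b \<in> Basis"
  shows "dir_deriv f b \<in> test_functions S"
  using test_functionsE[OF assms(1)] test_functionsI smooth_dir_deriv test_functions_smooth assms
  by metis

lemma test_functions_mult:
  assumes "f \<in> test_functions S" "smooth g"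
  shows "(\<lambda>x. f x * g x) \<in> test_functions S"
proof -
  obtain K where "compact K" "K \<subseteq> S" "\<And>x. x \<notin> K \<Longrightarrow> f x = 0"
    using test_functionsE[OF assms(1)] by metis
  then show ?thesis
    using assms by (intro test_functionsI[of _ K]) (auto intro: smooth_mult test_functions_smooth)
qed


lemma test_functions_add:
  assumes "f \<in> test_functions S" "g \<in> test_functions S"
  shows "(\<lambda>x. f x + g x) \<in> test_functions S"
proof -
  obtain K L where "compact K" "K \<subseteq> S" "\<And>x. x \<notin> K \<Longrightarrow> f x = 0"
    "compact L" "L \<subseteq> S" "\<And>x. x \<notin> L \<Longrightarrow> g x = 0"
    using test_functionsE[OF assms(1)] test_functionsE[OF assms(2)] by metis
  then show ?thesis
    using assms by (intro test_functionsI[of _ "K \<union> L"]) (auto intro: smooth_add test_functions_smooth)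
qed

lemma test_functions_zero: "(\<lambda>x. 0) \<in> test_functions S"
  by (rule test_functionsI[of _ "{}"]) (auto intro: smooth_const)


lemma test_functions_bounded:
  assumes "f \<in> test_functions S"
  obtains C where "C > 0" "\<And>x. \<bar>f x\<bar> \<le> C"
proof -
  obtain K where K: "compact K" "\<And>x. x \<notin> K \<Longrightarrow> f x = 0"
    using test_functionsE[OF assms] by metis
  have "bounded (f ` K)"
    using K assms by (intro compact_imp_bounded compact_continuous_image smooth_continuous_on test_functions_smooth)
  then obtain C where "C > 0" "\<And>x. x \<in> K \<Longrightarrow> \<bar>f x\<bar> \<le> C"
    unfolding bounded_pos by auto
  then show ?thesis using that[of C] K by (metis abs_zero less_imp_le)
qed

lemma test_functions_shift:
  assumes "f \<in> test_functions S"
  shows "(\<lambda>x. f (x + v)) \<in> test_functions ((\<lambda>x. x - v) ` S)"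
proof -
  obtain K where K: "compact K" "K \<subseteq> S" "\<And>x. x \<notin> K \<Longrightarrow> f x = 0"
    using test_functionsE[OF assms] by metis
  have "x + v \<notin> K" if "x \<notin> (\<lambda>x. x - v) ` K" for x
    using that by force
  moreover have "smooth (\<lambda>x. f (v + x))"
    by (rule smooth_affine_comp[OF bounded_linear_ident test_functions_smooth[OF assms]])
  ultimately show ?thesis
    using K by (intro test_functionsI[of _ "(\<lambda>x. x - v) ` K"])
      (auto simp: add.commute compact_translation_subtract)
qed

lemma dir_deriv_shift:
  assumes "smooth f" shows "dir_deriv (\<lambda>x. f (x + v)) b x = dir_deriv f b (x + v)"
  using dir_deriv_affine_comp[OF bounded_linear_ident smooth_differentiable[OF assms], where c=v and v=b]
  by (simp add: add.commute)

section \<open>Square integrable functions\<close>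

definition L2_norm :: "'a measure \<Rightarrow> ('a \<Rightarrow> real) \<Rightarrow> real" where
  "L2_norm M f = sqrt (LINT x|M. (f x)\<^sup>2)"

lemma L2_norm_nonneg [simp]: "L2_norm M f \<ge> 0"
  by (simp add: L2_norm_def)

lemma L2_norm_sq: "(L2_norm M f)\<^sup>2 = L2_inner M f f"
  by (simp add: L2_norm_def L2_inner_def power2_eq_square)

lemma L2_measurable: "f \<in> L2 M \<Longrightarrow> f \<in> borel_measurable M"
  by (simp add: L2_def)

lemma L2_integrable_sq: "f \<in> L2 M \<Longrightarrow> integrable M (\<lambda>x. (f x)\<^sup>2)"
  by (simp add: L2_def)

lemma L2_mult_integrable:
  assumes "f \<in> L2 M" "g \<in> L2 M"
  shows "integrable M (\<lambda>x. f x * g x)"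
proof (rule Bochner_Integration.integrable_bound)
  show "integrable M (\<lambda>x. (f x)\<^sup>2 + (g x)\<^sup>2)"
    using assms by (simp add: L2_integrable_sq)
  show "(\<lambda>x. f x * g x) \<in> borel_measurable M"
    using assms by (intro borel_measurable_times L2_measurable)
  have "\<bar>a * b\<bar> \<le> a\<^sup>2 + b\<^sup>2" for a b :: real
    using sum_squares_bound[of "\<bar>a\<bar>" "\<bar>b\<bar>"] mult_nonneg_nonneg[of "\<bar>a\<bar>" "\<bar>b\<bar>"]
    unfolding abs_mult power2_abs by linarith
  then show "AE x in M. norm (f x * g x) \<le> norm ((f x)\<^sup>2 + (g x)\<^sup>2)"
    by simp
qed

lemma L2_bounded_mult:
  assumes "f \<in> L2 M" "g \<in> borel_measurable M" "\<And>x. x \<in> space M \<Longrightarrow> \<bar>g x\<bar> \<le> C"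
  shows "(\<lambda>x. g x * f x) \<in> L2 M"
  unfolding L2_def
proof safe
  show "(\<lambda>x. g x * f x) \<in> borel_measurable M"
    by (intro borel_measurable_times assms(2) L2_measurable[OF assms(1)])
  show "integrable M (\<lambda>x. (g x * f x)\<^sup>2)"
  proof (rule Bochner_Integration.integrable_bound)
    show "integrable M (\<lambda>x. C\<^sup>2 * (f x)\<^sup>2)"
      using assms by (simp add: L2_integrable_sq)
    show "(\<lambda>x. (g x * f x)\<^sup>2) \<in> borel_measurable M"
      by (intro borel_measurable_power borel_measurable_times assms(2) L2_measurable[OF assms(1)])
    have "(g x)\<^sup>2 \<le> C\<^sup>2" if "x \<in> space M" for x
      using assms(3)[OF that] abs_le_square_iff[of "g x" C] by simp
    then show "AE x in M. norm ((g x * f x)\<^sup>2) \<le> norm (C\<^sup>2 * (f x)\<^sup>2)"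
      by (auto simp: power_mult_distrib abs_mult intro!: mult_right_mono)
  qed
qed

lemma L2_cmult: "f \<in> L2 M \<Longrightarrow> (\<lambda>x. c * f x) \<in> L2 M"
  by (rule L2_bounded_mult[where C="\<bar>c\<bar>"]) auto

lemma L2_add:
  assumes "f \<in> L2 M" "g \<in> L2 M" shows "(\<lambda>x. f x + g x) \<in> L2 M"
proof -
  have "integrable M (\<lambda>x. (f x)\<^sup>2 + (g x)\<^sup>2 + 2 * (f x * g x))"
    using assms by (intro Bochner_Integration.integrable_add integrable_mult_right L2_integrable_sq L2_mult_integrable)
  moreover have "(f x)\<^sup>2 + (g x)\<^sup>2 + 2 * (f x * g x) = (f x + g x)\<^sup>2" for x
    by (simp add: power2_sum)
  ultimately show ?thesis using assms unfolding L2_def by auto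
qed

lemma L2_uminus: "f \<in> L2 M \<Longrightarrow> (\<lambda>x. - f x) \<in> L2 M"
  using L2_cmult[of f M "-1"] by simp

lemma L2_diff: "f \<in> L2 M \<Longrightarrow> g \<in> L2 M \<Longrightarrow> (\<lambda>x. f x - g x) \<in> L2 M"
  using L2_add[of f M "\<lambda>x. - g x"] by (simp add: L2_uminus)

lemma L2_zero: "(\<lambda>x. 0) \<in> L2 M"
  by (simp add: L2_def)

lemma L2_sum:
  "(\<And>i. i \<in> A \<Longrightarrow> f i \<in> L2 M) \<Longrightarrow> (\<lambda>x. \<Sum>i\<in>A. f i x) \<in> L2 M"
  by (induction A rule: infinite_finite_induct) (auto intro: L2_add L2_zero)

lemma L2_AE_cong:
  assumes "f \<in> L2 M" "g \<in> borel_measurable M" "AE x in M. f x = g x"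
  shows "g \<in> L2 M"
proof -
  have "integrable M (\<lambda>x. (g x)\<^sup>2) \<longleftrightarrow> integrable M (\<lambda>x. (f x)\<^sup>2)"
    using assms by (intro integrable_cong_AE) (auto simp: L2_def)
  then show ?thesis using assms by (simp add: L2_def)
qed

lemma L2_inner_AE_cong:
  assumes "f \<in> borel_measurable M" "f' \<in> borel_measurable M" "g \<in> borel_measurable M"
    "AE x in M. f x = f' x"
  shows "L2_inner M f g = L2_inner M f' g"
  unfolding L2_inner_def using assms by (intro integral_cong_AE) auto

lemma L2_inner_commute: "L2_inner M f g = L2_inner M g f"
  by (simp add: L2_inner_def mult.commute)

lemma L2_inner_add_left:
  assumes "f \<in> L2 M" "f' \<in> L2 M" "g \<in> L2 M"
  shows "L2_inner M (\<lambda>x. f x + f' x) g = L2_inner M f g + L2_inner M f' g"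
  unfolding L2_inner_def using assms
  by (simp add: distrib_right L2_mult_integrable)

lemma L2_inner_cmult_left: "L2_inner M (\<lambda>x. c * f x) g = c * L2_inner M f g"
  unfolding L2_inner_def by (simp add: mult.assoc)

lemma L2_inner_cmult_right: "L2_inner M f (\<lambda>x. c * g x) = c * L2_inner M f g"
  using L2_inner_cmult_left L2_inner_commute by metis

lemma L2_inner_uminus_left: "L2_inner M (\<lambda>x. - f x) g = - L2_inner M f g"
  using L2_inner_cmult_left[of M "-1"] by simp

lemma L2_inner_diff_left:
  assumes "f \<in> L2 M" "f' \<in> L2 M" "g \<in> L2 M"
  shows "L2_inner M (\<lambda>x. f x - f' x) g = L2_inner M f g - L2_inner M f' g"
  unfolding L2_inner_def using assms
  by (simp add: left_diff_distrib L2_mult_integrable)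

lemma L2_inner_add_right:
  assumes "f \<in> L2 M" "g \<in> L2 M" "g' \<in> L2 M"
  shows "L2_inner M f (\<lambda>x. g x + g' x) = L2_inner M f g + L2_inner M f g'"
  using L2_inner_add_left[OF assms(2,3,1)] by (simp add: L2_inner_commute)

lemma L2_inner_diff_right:
  assumes "f \<in> L2 M" "g \<in> L2 M" "g' \<in> L2 M"
  shows "L2_inner M f (\<lambda>x. g x - g' x) = L2_inner M f g - L2_inner M f g'"
  using L2_inner_diff_left[OF assms(2,3,1)] by (simp add: L2_inner_commute)

lemma L2_inner_zero_left: "L2_inner M (\<lambda>x. 0) g = 0"
  by (simp add: L2_inner_def)

lemma L2_inner_sum_left:
  assumes "\<And>i. i \<in> A \<Longrightarrow> f i \<in> L2 M" "g \<in> L2 M"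
  shows "L2_inner M (\<lambda>x. \<Sum>i\<in>A. f i x) g = (\<Sum>i\<in>A. L2_inner M (f i) g)"
  using assms
  by (induction A rule: infinite_finite_induct)
    (auto simp: L2_inner_zero_left L2_inner_add_left L2_sum)

lemma L2_inner_sum_right:
  assumes "\<And>i. i \<in> A \<Longrightarrow> f i \<in> L2 M" "g \<in> L2 M"
  shows "L2_inner M g (\<lambda>x. \<Sum>i\<in>A. f i x) = (\<Sum>i\<in>A. L2_inner M g (f i))"
  using L2_inner_sum_left[OF assms] by (simp add: L2_inner_commute)

lemma L2_inner_self_eq_0:
  assumes "f \<in> L2 M" "L2_inner M f f = 0"
  shows "AE x in M. f x = 0"
proof -
  have "integrable M (\<lambda>x. f x * f x)" using assms by (simp add: L2_mult_integrable)
  then have "AE x in M. f x * f x = 0"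
    using assms(2) unfolding L2_inner_def
    by (subst integral_nonneg_eq_0_iff_AE[symmetric]) auto
  then show ?thesis by simp
qed

lemma L2_Cauchy_Schwarz:
  assumes f: "f \<in> L2 M" and g: "g \<in> L2 M"
  shows "\<bar>L2_inner M f g\<bar> \<le> L2_norm M f * L2_norm M g"
proof (cases "L2_inner M g g = 0")
  case True
  then have "AE x in M. f x * g x = 0"
    using L2_inner_self_eq_0[OF g] by auto
  then have "L2_inner M f g = 0"
    unfolding L2_inner_def by (simp add: integral_eq_zero_AE)
  then show ?thesis by simp
next
  case False
  have gg: "L2_inner M g g > 0"
    using False L2_norm_sq[of M g] by (metis zero_le_power2 order_le_less)
  define c where "c = L2_inner M f g / L2_inner M g g"
  have cg: "(\<lambda>x. c * g x) \<in> L2 M" by (rule L2_cmult[OF g])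
  have "0 \<le> L2_inner M (\<lambda>x. f x - c * g x) (\<lambda>x. f x - c * g x)"
    by (simp add: L2_inner_def)
  also have "\<dots> = L2_inner M f f - 2 * c * L2_inner M f g + c\<^sup>2 * L2_inner M g g"
    using f g cg
    by (simp add: L2_inner_diff_left L2_inner_diff_right L2_diff L2_inner_cmult_left
      L2_inner_cmult_right L2_inner_commute[of M g f] power2_eq_square algebra_simps)
  also have "\<dots> = L2_inner M f f - (L2_inner M f g)\<^sup>2 / L2_inner M g g"
    using gg by (simp add: c_def field_simps power2_eq_square)
  finally have "(L2_inner M f g)\<^sup>2 \<le> (L2_norm M f * L2_norm M g)\<^sup>2"
    using gg by (simp add: L2_norm_sq power_mult_distrib pos_divide_le_eq)
  then show ?thesis
    by (metis L2_norm_nonneg abs_le_square_iff abs_of_nonneg mult_nonneg_nonneg)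
qed

lemma L2_norm_triangle:
  assumes f: "f \<in> L2 M" and g: "g \<in> L2 M"
  shows "L2_norm M (\<lambda>x. f x + g x) \<le> L2_norm M f + L2_norm M g"
proof (rule power2_le_imp_le)
  have "(L2_norm M (\<lambda>x. f x + g x))\<^sup>2 = (L2_norm M f)\<^sup>2 + 2 * L2_inner M f g + (L2_norm M g)\<^sup>2"
    using f g by (simp add: L2_norm_sq L2_inner_add_left L2_inner_add_right L2_add L2_inner_commute[of M g f])
  also have "\<dots> \<le> (L2_norm M f + L2_norm M g)\<^sup>2"
    using L2_Cauchy_Schwarz[OF f g] by (simp add: power2_sum)
  finally show "(L2_norm M (\<lambda>x. f x + g x))\<^sup>2 \<le> (L2_norm M f + L2_norm M g)\<^sup>2" .
qed simp

lemma L2_norm_cmult: "L2_norm M (\<lambda>x. c * f x) = \<bar>c\<bar> * L2_norm M f"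
  by (simp add: L2_norm_def power_mult_distrib real_sqrt_mult)

lemma L2_norm_uminus: "L2_norm M (\<lambda>x. - f x) = L2_norm M f"
  by (simp add: L2_norm_def)

lemma L2_norm_minus_commute: "L2_norm M (\<lambda>x. f x - g x) = L2_norm M (\<lambda>x. g x - f x)"
  by (simp add: L2_norm_def power2_commute)

lemma L2_norm_triangle_sub:
  assumes "f \<in> L2 M" "g \<in> L2 M" "h \<in> L2 M"
  shows "L2_norm M (\<lambda>x. f x - h x) \<le> L2_norm M (\<lambda>x. f x - g x) + L2_norm M (\<lambda>x. g x - h x)"
  using L2_norm_triangle[of "\<lambda>x. f x - g x" M "\<lambda>x. g x - h x"] assms by (simp add: L2_diff)

lemma L2_norm_le_diff:
  assumes "f \<in> L2 M" "g \<in> L2 M"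
  shows "L2_norm M f \<le> L2_norm M g + L2_norm M (\<lambda>x. f x - g x)"
  using L2_norm_triangle[of "\<lambda>x. f x - g x" M g] assms by (simp add: L2_diff)

lemma L2_norm_bounded_mult:
  assumes "f \<in> L2 M" "g \<in> borel_measurable M" "\<And>x. x \<in> space M \<Longrightarrow> \<bar>g x\<bar> \<le> C" "0 \<le> C"
  shows "L2_norm M (\<lambda>x. g x * f x) \<le> C * L2_norm M f"
proof -
  have le: "(g x)\<^sup>2 \<le> C\<^sup>2" if "x \<in> space M" for x
    using assms(3)[OF that] abs_le_square_iff[of "g x" C] by simp
  have "(LINT x|M. (g x * f x)\<^sup>2) \<le> (LINT x|M. C\<^sup>2 * (f x)\<^sup>2)"
    using assms L2_integrable_sq[OF L2_bounded_mult[OF assms(1-3)]]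
    by (intro integral_mono) (auto simp: L2_integrable_sq power_mult_distrib intro!: mult_right_mono le)
  then have "L2_norm M (\<lambda>x. g x * f x) \<le> sqrt (C\<^sup>2 * (LINT x|M. (f x)\<^sup>2))"
    unfolding L2_norm_def by simp
  then show ?thesis using assms(4) by (simp add: L2_norm_def real_sqrt_mult)
qed

section \<open>Strong convergence in L^2\<close>

lemma L2_converges_iff:
  "L2_converges M fs f \<longleftrightarrow> (\<forall>n. fs n \<in> L2 M) \<and> f \<in> L2 M \<and> (\<lambda>n. L2_norm M (\<lambda>x. fs n x - f x)) \<longlonglongrightarrow> 0"
  by (simp add: L2_converges_def L2_norm_def)

lemma L2_converges_norm:
  assumes "L2_converges M fs f"
  shows "(\<lambda>n. L2_norm M (fs n)) \<longlonglongrightarrow> L2_norm M f"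
proof -
  have "\<bar>L2_norm M (fs n) - L2_norm M f\<bar> \<le> L2_norm M (\<lambda>x. fs n x - f x)" for n
    using L2_norm_le_diff[of "fs n" M f] L2_norm_le_diff[of f M "fs n"] assms
    by (simp add: L2_converges_iff L2_norm_minus_commute abs_le_iff)
  then have "\<forall>n. norm (L2_norm M (fs n) - L2_norm M f) \<le> L2_norm M (\<lambda>x. fs n x - f x)"
    by simp
  from Lim_null_comparison[OF always_eventually[OF this]] show ?thesis
    using assms unfolding L2_converges_iff by (rule_tac LIM_zero_cancel) blast
qed

lemma L2_converges_inner:
  assumes f: "L2_converges M fs f" and g: "L2_converges M gs g"
  shows "(\<lambda>n. L2_inner M (fs n) (gs n)) \<longlonglongrightarrow> L2_inner M f g"
proof -
  have [simp]: "fs n \<in> L2 M" "gs n \<in> L2 M" "f \<in> L2 M" "g \<in> L2 M" for n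
    using f g by (auto simp: L2_converges_iff)
  have "L2_inner M (fs n) (gs n) - L2_inner M f g
    = L2_inner M (\<lambda>x. fs n x - f x) (gs n) + L2_inner M f (\<lambda>x. gs n x - g x)" for n
    by (simp add: L2_inner_diff_left L2_inner_diff_right)
  moreover have "\<bar>L2_inner M (\<lambda>x. fs n x - f x) (gs n)\<bar> \<le> L2_norm M (\<lambda>x. fs n x - f x) * L2_norm M (gs n)"
    "\<bar>L2_inner M f (\<lambda>x. gs n x - g x)\<bar> \<le> L2_norm M f * L2_norm M (\<lambda>x. gs n x - g x)" for n
    by (intro L2_Cauchy_Schwarz; simp add: L2_diff)+
  ultimately have le: "\<bar>L2_inner M (fs n) (gs n) - L2_inner M f g\<bar>
     \<le> L2_norm M (\<lambda>x. fs n x - f x) * L2_norm M (gs n) + L2_norm M f * L2_norm M (\<lambda>x. gs n x - g x)" for n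
    by (simp only:) (rule order_trans[OF abs_triangle_ineq add_mono])
  have "(\<lambda>n. L2_norm M (\<lambda>x. fs n x - f x) * L2_norm M (gs n) + L2_norm M f * L2_norm M (\<lambda>x. gs n x - g x))
     \<longlonglongrightarrow> 0 * L2_norm M g + L2_norm M f * 0"
    using f g L2_converges_norm[OF g] by (intro tendsto_intros) (auto simp: L2_converges_iff)
  then have lim: "(\<lambda>n. L2_norm M (\<lambda>x. fs n x - f x) * L2_norm M (gs n) + L2_norm M f * L2_norm M (\<lambda>x. gs n x - g x)) \<longlonglongrightarrow> 0"
    by simp
  have "\<forall>n. norm (L2_inner M (fs n) (gs n) - L2_inner M f g)
     \<le> L2_norm M (\<lambda>x. fs n x - f x) * L2_norm M (gs n) + L2_norm M f * L2_norm M (\<lambda>x. gs n x - g x)"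
    using le by simp
  from Lim_null_comparison[OF always_eventually[OF this] lim] show ?thesis
    by (rule LIM_zero_cancel)
qed

lemma L2_converges_const: "f \<in> L2 M \<Longrightarrow> L2_converges M (\<lambda>n. f) f"
  by (simp add: L2_converges_def)

lemma L2_converges_bounded_mult:
  assumes f: "L2_converges M fs f" and g: "g \<in> borel_measurable M" "\<And>x. x \<in> space M \<Longrightarrow> \<bar>g x\<bar> \<le> C"
  shows "L2_converges M (\<lambda>n x. g x * fs n x) (\<lambda>x. g x * f x)"
proof -
  have fL: "fs n \<in> L2 M" "f \<in> L2 M" for n
    using f by (auto simp: L2_converges_iff)
  have g': "\<And>x. x \<in> space M \<Longrightarrow> \<bar>g x\<bar> \<le> max C 0" using g(2) by fastforce
  have "L2_norm M (\<lambda>x. g x * fs n x - g x * f x) \<le> max C 0 * L2_norm M (\<lambda>x. fs n x - f x)" for n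
    using L2_norm_bounded_mult[OF L2_diff[OF fL] g(1) g'] by (simp add: right_diff_distrib)
  moreover have "(\<lambda>n. max C 0 * L2_norm M (\<lambda>x. fs n x - f x)) \<longlonglongrightarrow> 0"
    using f by (intro tendsto_mult_right_zero) (simp add: L2_converges_iff)
  ultimately have "(\<lambda>n. L2_norm M (\<lambda>x. g x * fs n x - g x * f x)) \<longlonglongrightarrow> 0"
    by (rule_tac Lim_null_comparison[OF always_eventually,
      where g="\<lambda>n. max C 0 * L2_norm M (\<lambda>x. fs n x - f x)"]) simp_all
  then show ?thesis
    using fL L2_bounded_mult[OF _ g] by (simp add: L2_converges_iff)
qed

lemma L2_converges_add:
  assumes f: "L2_converges M fs f" and g: "L2_converges M gs g"
  shows "L2_converges M (\<lambda>n x. fs n x + gs n x) (\<lambda>x. f x + g x)"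
proof -
  have L: "fs n \<in> L2 M" "gs n \<in> L2 M" "f \<in> L2 M" "g \<in> L2 M" for n
    using f g by (auto simp: L2_converges_iff)
  have "L2_norm M (\<lambda>x. (fs n x + gs n x) - (f x + g x))
      \<le> L2_norm M (\<lambda>x. fs n x - f x) + L2_norm M (\<lambda>x. gs n x - g x)" for n
    using L2_norm_triangle[OF L2_diff[OF L(1,3)] L2_diff[OF L(2,4)], of n n]
    by (simp add: algebra_simps)
  moreover have "(\<lambda>n. L2_norm M (\<lambda>x. fs n x - f x) + L2_norm M (\<lambda>x. gs n x - g x)) \<longlonglongrightarrow> 0 + 0"
    using f g by (intro tendsto_add) (auto simp: L2_converges_iff)
  ultimately have "(\<lambda>n. L2_norm M (\<lambda>x. (fs n x + gs n x) - (f x + g x))) \<longlonglongrightarrow> 0"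
    by (rule_tac Lim_null_comparison[OF always_eventually,
      where g="\<lambda>n. L2_norm M (\<lambda>x. fs n x - f x) + L2_norm M (\<lambda>x. gs n x - g x)"]) simp_all
  then show ?thesis using L by (simp add: L2_converges_iff L2_add)
qed


section \<open>Completeness of L^2 and consequences of weak convergence\<close>

lemma nn_integral_L2:
  assumes "f \<in> L2 M"
  shows "(\<integral>\<^sup>+x. ennreal ((f x)\<^sup>2) \<partial>M) = ennreal ((L2_norm M f)\<^sup>2)"
  using assms by (subst nn_integral_eq_integral) (auto simp: L2_integrable_sq L2_norm_def)

lemma L2_memI:
  assumes "f \<in> borel_measurable M" "(\<integral>\<^sup>+x. ennreal ((f x)\<^sup>2) \<partial>M) < \<infinity>"
  shows "f \<in> L2 M"
  using assms unfolding L2_def by (auto intro!: integrableI_nonneg)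

text \<open>On a space of infinite measure the L^1 norms of the increments are not controlled by
  their L^2 norms, so the squares are summed with weight 4^k: the integrals are at most 4^k / 16^k =
  4^-k. Almost everywhere the weighted squares then tend to 0, the increments are eventually below
  2^-k, and the telescoping series converges absolutely.\<close>

lemma L2_AE_convergent_fast:
  assumes f: "\<And>n. f n \<in> L2 M" and d: "\<And>k. L2_norm M (\<lambda>x. f (Suc k) x - f k x) \<le> 1 / 4 ^ k"
  shows "AE x in M. convergent (\<lambda>k. f k x)"
proof -
  let ?d = "\<lambda>k x. f (Suc k) x - f k x"
  have dL: "?d k \<in> L2 M" for k by (intro L2_diff f)
  have [measurable]: "f k \<in> borel_measurable M" for k by (rule L2_measurable[OF f])
  have "(\<integral>\<^sup>+x. (\<Sum>k. ennreal (4 ^ k * (?d k x)\<^sup>2)) \<partial>M) = (\<Sum>k. \<integral>\<^sup>+x. ennreal (4 ^ k * (?d k x)\<^sup>2) \<partial>M)"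
    by (intro nn_integral_suminf) measurable
  also have "\<dots> \<le> (\<Sum>k. ennreal ((1 / 4) ^ k))"
  proof (intro suminf_le)
    fix k
    have "(\<integral>\<^sup>+x. ennreal (4 ^ k * (?d k x)\<^sup>2) \<partial>M) = ennreal (4 ^ k) * (\<integral>\<^sup>+x. ennreal ((?d k x)\<^sup>2) \<partial>M)"
      by (simp add: ennreal_mult nn_integral_cmult)
    also have "\<dots> = ennreal (4 ^ k * (L2_norm M (?d k))\<^sup>2)"
      by (simp add: nn_integral_L2[OF dL] ennreal_mult)
    also have "\<dots> \<le> ennreal (4 ^ k * (1 / 4 ^ k)\<^sup>2)"
      using d[of k] by (intro ennreal_leI mult_left_mono power_mono) auto
    also have "(4::real) ^ k * (1 / 4 ^ k)\<^sup>2 = (1 / 4) ^ k"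
      by (simp add: power2_eq_square power_divide)
    finally show "(\<integral>\<^sup>+x. ennreal (4 ^ k * (?d k x)\<^sup>2) \<partial>M) \<le> ennreal ((1 / 4) ^ k)" .
  qed auto
  also have "\<dots> = ennreal (\<Sum>k. (1 / 4) ^ k)"
    by (intro suminf_ennreal2 summable_geometric) auto
  also have "\<dots> < \<infinity>" by simp
  finally have "AE x in M. (\<Sum>k. ennreal (4 ^ k * (?d k x)\<^sup>2)) \<noteq> \<infinity>"
    by (intro nn_integral_noteq_infinite) simp_all
  then show ?thesis
  proof eventually_elim
    case (elim x)
    have "summable (\<lambda>k. 4 ^ k * (?d k x)\<^sup>2)"
      using elim by (intro summable_suminf_not_top) auto
    then have "(\<lambda>k. 4 ^ k * (?d k x)\<^sup>2) \<longlonglongrightarrow> 0" by (rule summable_LIMSEQ_zero)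
    then have "eventually (\<lambda>k. 4 ^ k * (?d k x)\<^sup>2 < 1) sequentially"
      by (rule order_tendstoD) simp
    then have "eventually (\<lambda>k. norm (?d k x) \<le> (1 / 2) ^ k) sequentially"
    proof eventually_elim
      case (elim k)
      have "((2::real) ^ k)\<^sup>2 = 4 ^ k"
        by (simp add: power2_eq_square flip: power_mult_distrib)
      then have "(2 ^ k * \<bar>?d k x\<bar>)\<^sup>2 = 4 ^ k * (?d k x)\<^sup>2"
        by (simp add: power_mult_distrib)
      then have "(2 ^ k * \<bar>?d k x\<bar>)\<^sup>2 \<le> 1\<^sup>2"
        using elim by simp
      then have "2 ^ k * \<bar>?d k x\<bar> \<le> 1"
        by (rule power2_le_imp_le) simp
      then show ?case by (simp add: power_divide field_simps)
    qed
    then have "summable (\<lambda>k. ?d k x)"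
      by (rule summable_comparison_test_ev) (simp add: summable_geometric)
    then have "convergent (\<lambda>n. \<Sum>k<n. ?d k x)" by (simp add: summable_iff_convergent)
    then have "convergent (\<lambda>n. f n x - f 0 x)"
      by (simp add: sum_lessThan_telescope[of "\<lambda>n. f n x"])
    then show ?case
      using convergent_add[of "\<lambda>n. f n x - f 0 x" "\<lambda>n. f 0 x"] by (simp add: convergent_const)
  qed
qed

text \<open>Each \<open>r k\<close> is itself a threshold in the Cauchy condition for
  \<open>e k\<close>, so every later index, in particular \<open>r (Suc k)\<close>, is close to
  it.\<close>

lemma fast_Cauchy_subseq:
  fixes d :: "nat \<Rightarrow> nat \<Rightarrow> real" and e :: "nat \<Rightarrow> real"
  assumes "\<And>e. e > 0 \<Longrightarrow> \<exists>N. \<forall>m\<ge>N. \<forall>n\<ge>N. d m n < e" and "\<And>k. e k > 0"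
  obtains r where "strict_mono r" "\<And>k. d (r (Suc k)) (r k) < e k"
proof -
  have "\<exists>r. \<forall>k. ((\<forall>m\<ge>r k. \<forall>n\<ge>r k. d m n < e k) \<and> r k < r (Suc k))"
  proof (rule dependent_nat_choice)
    show "\<exists>x. \<forall>m\<ge>x. \<forall>n\<ge>x. d m n < e 0"
      using assms by blast
    show "\<exists>y. (\<forall>m\<ge>y. \<forall>n\<ge>y. d m n < e (Suc k)) \<and> x < y" for x k
    proof -
      obtain N where "\<forall>m\<ge>N. \<forall>n\<ge>N. d m n < e (Suc k)" using assms by blast
      then show ?thesis by (intro exI[of _ "max N (Suc x)"]) auto
    qed
  qed
  then obtain r where r: "\<And>k. \<forall>m\<ge>r k. \<forall>n\<ge>r k. d m n < e k" "\<And>k. r k < r (Suc k)"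
    by blast
  then have "strict_mono r" by (simp add: strict_mono_Suc_iff)
  moreover have "d (r (Suc k)) (r k) < e k" for k
    using r(1)[of k] r(2)[of k] by (simp add: less_imp_le)
  ultimately show thesis by (rule that)
qed

text \<open>Riesz-Fischer: the pointwise limit exists almost everywhere along a rapidly Cauchy
  subsequence, and Fatou's lemma transfers the Cauchy estimate of the whole sequence to that
  limit.\<close>

lemma L2_complete:
  assumes f: "\<And>n. f n \<in> L2 M"
    and C: "\<And>e. e > 0 \<Longrightarrow> \<exists>N. \<forall>m\<ge>N. \<forall>n\<ge>N. L2_norm M (\<lambda>x. f m x - f n x) < e"
  obtains g where "L2_converges M f g"
proof -
  obtain r where r: "strict_mono r" "\<And>k. L2_norm M (\<lambda>x. f (r (Suc k)) x - f (r k) x) < 1 / 4 ^ k"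
    using fast_Cauchy_subseq[of "\<lambda>m n. L2_norm M (\<lambda>x. f m x - f n x)" "\<lambda>k. 1 / 4 ^ k"] C by auto
  have fm[measurable]: "f k \<in> borel_measurable M" for k by (rule L2_measurable[OF f])
  have conv: "AE x in M. convergent (\<lambda>k. f (r k) x)"
    by (rule L2_AE_convergent_fast) (use f r(2) in \<open>auto intro: less_imp_le\<close>)
  \<comment> \<open>At points of divergence \<open>lim\<close> is a default value; g is measurable
    all the same, and these points form a null set.\<close>
  define g where "g x = lim (\<lambda>k. f (r k) x)" for x
  have gm[measurable]: "g \<in> borel_measurable M"
    unfolding g_def by measurable
  have bound: "(\<integral>\<^sup>+x. ennreal ((f n x - g x)\<^sup>2) \<partial>M) \<le> ennreal (e\<^sup>2)"
    if N: "\<forall>m\<ge>N. \<forall>n\<ge>N. L2_norm M (\<lambda>x. f m x - f n x) < e" and n: "n \<ge> N" and e: "e > 0" for N n e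
  proof -
    have "(\<integral>\<^sup>+x. ennreal ((f n x - g x)\<^sup>2) \<partial>M) = (\<integral>\<^sup>+x. liminf (\<lambda>k. ennreal ((f n x - f (r k) x)\<^sup>2)) \<partial>M)"
    proof (rule nn_integral_cong_AE)
      show "AE x in M. ennreal ((f n x - g x)\<^sup>2) = liminf (\<lambda>k. ennreal ((f n x - f (r k) x)\<^sup>2))"
        using conv
      proof eventually_elim
        case (elim x)
        then have "(\<lambda>k. f (r k) x) \<longlonglongrightarrow> g x" by (simp add: g_def convergent_LIMSEQ_iff)
        then have "(\<lambda>k. ennreal ((f n x - f (r k) x)\<^sup>2)) \<longlonglongrightarrow> ennreal ((f n x - g x)\<^sup>2)"
          by (intro tendsto_ennrealI tendsto_intros)
        then show ?case by (rule lim_imp_Liminf[OF sequentially_bot, symmetric])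
      qed
    qed
    also have "\<dots> \<le> liminf (\<lambda>k. \<integral>\<^sup>+x. ennreal ((f n x - f (r k) x)\<^sup>2) \<partial>M)"
      by (intro nn_integral_liminf) measurable
    also have "\<dots> \<le> ennreal (e\<^sup>2)"
    proof (rule Liminf_le)
      show "eventually (\<lambda>k. (\<integral>\<^sup>+x. ennreal ((f n x - f (r k) x)\<^sup>2) \<partial>M) \<le> ennreal (e\<^sup>2)) sequentially"
        using eventually_ge_at_top[of N]
      proof eventually_elim
        case (elim k)
        then have "r k \<ge> N" using seq_suble[OF r(1), of k] by linarith
        then have "L2_norm M (\<lambda>x. f n x - f (r k) x) \<le> e" using N n by (simp add: less_imp_le)
        then show ?case
          by (subst nn_integral_L2[OF L2_diff[OF f f]]) (auto intro!: ennreal_leI power_mono)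
      qed
    qed simp
    finally show ?thesis .
  qed
  have diffL: "(\<lambda>x. f n x - g x) \<in> L2 M \<and> L2_norm M (\<lambda>x. f n x - g x) \<le> e"
    if N: "\<forall>m\<ge>N. \<forall>n\<ge>N. L2_norm M (\<lambda>x. f m x - f n x) < e" and n: "n \<ge> N" and e: "e > 0" for N n e
  proof -
    have L: "(\<lambda>x. f n x - g x) \<in> L2 M"
      using bound[OF that] by (intro L2_memI) (auto simp: le_less_trans)
    moreover have "(L2_norm M (\<lambda>x. f n x - g x))\<^sup>2 \<le> e\<^sup>2"
      using bound[OF that] nn_integral_L2[OF L] by simp
    then have "L2_norm M (\<lambda>x. f n x - g x) \<le> e"
      by (rule power2_le_imp_le) (use e in simp)
    ultimately show ?thesis by blast
  qed
  \<comment> \<open>Membership of the limit in L^2 comes only now: it is the difference of one term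
    of the sequence and a function already known to be square integrable.\<close>
  obtain N where "\<forall>m\<ge>N. \<forall>n\<ge>N. L2_norm M (\<lambda>x. f m x - f n x) < 1" using C[of 1] by auto
  from diffL[OF this order_refl] have "(\<lambda>x. f N x - g x) \<in> L2 M" by simp
  from L2_diff[OF f[of N] this] have g: "g \<in> L2 M" by simp
  have "(\<lambda>n. L2_norm M (\<lambda>x. f n x - g x)) \<longlonglongrightarrow> 0"
  proof (rule LIMSEQ_I)
    fix e :: real assume "e > 0"
    then obtain N where N: "\<forall>m\<ge>N. \<forall>n\<ge>N. L2_norm M (\<lambda>x. f m x - f n x) < e / 2" using C[of "e / 2"] by auto
    have "norm (L2_norm M (\<lambda>x. f n x - g x) - 0) < e" if "n \<ge> N" for n
      using diffL[OF N that] \<open>e > 0\<close> by simp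
    then show "\<exists>N. \<forall>n\<ge>N. norm (L2_norm M (\<lambda>x. f n x - g x) - 0) < e"
      by (intro exI[of _ N] allI impI)
  qed
  then show thesis using f g by (intro that[of g]) (simp add: L2_converges_iff)
qed

text \<open>
  Sokal's proof of the uniform boundedness principle: \<open>g\<close> is built by moving, at step \<open>k\<close>, by
  \<open>3\<^sup>-\<^sup>k\<close> along the direction of a function of norm at least \<open>12\<^sup>k\<close>, with the sign that
  makes the inner product large.
\<close>

lemma L2_weakly_converges_bounded:
  assumes w: "L2_converges_weakly M fs f"
  obtains B where "\<And>n. L2_norm M (fs n) \<le> B"
proof (rule ccontr)
  assume neg: "\<not> thesis"
  have fL: "fs n \<in> L2 M" for n using w by (simp add: L2_converges_weakly_def)
  have "\<exists>n. L2_norm M (fs n) > B" for B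
    using neg that by (meson not_le)
  then obtain \<sigma> where \<sigma>: "\<And>B. L2_norm M (fs (\<sigma> B)) > B" by metis
  define u where "u k = fs (\<sigma> (12 ^ k))" for k :: nat
  have uL: "u k \<in> L2 M" for k by (simp add: u_def fL)
  have un: "L2_norm M (u k) > 12 ^ k" for k by (simp add: u_def \<sigma>)
  have un0: "L2_norm M (u k) > 0" for k using un[of k] by (meson less_trans zero_less_numeral zero_less_power)
  define c where "c k = (1 / 3) ^ k / L2_norm M (u k)" for k
  define step where "step k g = (if L2_inner M (u k) g \<ge> 0 then (\<lambda>x. g x + c k * u k x)
    else (\<lambda>x. g x - c k * u k x))" for k g
  define g where "g = rec_nat (\<lambda>x. 0) step"
  have g0: "g 0 = (\<lambda>x. 0)" and gS: "g (Suc k) = step k (g k)" for k by (simp_all add: g_def)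
  have cu: "(\<lambda>x. c k * u k x) \<in> L2 M" for k by (rule L2_cmult[OF uL])
  have gL: "g k \<in> L2 M" for k
    by (induction k) (auto simp: g0 gS step_def L2_zero L2_add L2_diff cu)
  have inner: "\<bar>L2_inner M (u k) (g (Suc k))\<bar> \<ge> (1 / 3) ^ k * L2_norm M (u k)" for k
  proof -
    have "L2_inner M (u k) (\<lambda>x. c k * u k x) = (1 / 3) ^ k * L2_norm M (u k)"
      unfolding L2_inner_cmult_right L2_norm_sq[symmetric]
      using un0[of k] by (simp add: c_def power2_eq_square)
    then show ?thesis
      using un0[of k] mult_pos_pos[of "(1 / 3) ^ k" "L2_norm M (u k)"]
      by (cases "L2_inner M (u k) (g k) \<ge> 0")
        (simp_all add: gS step_def L2_inner_add_right L2_inner_diff_right uL gL cu del: mult_pos_pos)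
  qed
  have stepn: "L2_norm M (\<lambda>x. g (Suc k) x - g k x) = (1 / 3) ^ k" for k
  proof -
    have "L2_norm M (\<lambda>x. g (Suc k) x - g k x) = L2_norm M (\<lambda>x. c k * u k x)"
      using L2_norm_uminus[of M "\<lambda>x. c k * u k x"] by (simp add: gS step_def)
    also have "\<dots> = (1 / 3) ^ k"
      unfolding L2_norm_cmult using un0[of k] by (simp add: c_def)
    finally show ?thesis .
  qed
  \<comment> \<open>Partial sums of the geometric series of step lengths; keeping the factor 1 -
    3^-d makes the induction close exactly.\<close>
  have tail: "L2_norm M (\<lambda>x. g (m + d) x - g m x) \<le> (3 / 2) * (1 / 3) ^ m * (1 - (1 / 3) ^ d)" for m d
  proof (induction d)
    case 0
    then show ?case by (simp add: L2_norm_def)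
  next
    case (Suc d)
    have "L2_norm M (\<lambda>x. g (m + Suc d) x - g m x)
      \<le> L2_norm M (\<lambda>x. g (Suc (m + d)) x - g (m + d) x) + L2_norm M (\<lambda>x. g (m + d) x - g m x)"
      using L2_norm_triangle_sub[OF gL gL gL] by simp
    also have "\<dots> \<le> (1 / 3) ^ (m + d) + (3 / 2) * (1 / 3) ^ m * (1 - (1 / 3) ^ d)"
      using Suc stepn[of "m + d"] by simp
    also have "\<dots> = (3 / 2) * (1 / 3) ^ m * (1 - (1 / 3) ^ Suc d)"
      by (simp add: power_add field_simps)
    finally show ?case .
  qed
  have tail': "L2_norm M (\<lambda>x. g n x - g m x) \<le> (3 / 2) * (1 / 3) ^ m" if "m \<le> n" for m n
  proof -
    have "(3 / 2) * (1 / 3) ^ m * (1 - (1 / 3) ^ (n - m)) \<le> (3 / 2) * (1 / 3) ^ m * (1::real)"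
      by (intro mult_left_mono) auto
    with order_trans[OF tail[of m "n - m"] this] show ?thesis using that by simp
  qed
  have "\<exists>N. \<forall>m\<ge>N. \<forall>n\<ge>N. L2_norm M (\<lambda>x. g m x - g n x) < e" if e: "e > 0" for e
  proof -
    obtain N where N: "(1 / 3::real) ^ N < e / 3"
      using real_arch_pow_inv[of "e / 3" "1 / 3"] e by auto
    have "L2_norm M (\<lambda>x. g m x - g n x) < e" if mn: "m \<ge> N" "n \<ge> N" for m n
    proof -
      have "L2_norm M (\<lambda>x. g m x - g n x) \<le> L2_norm M (\<lambda>x. g m x - g N x) + L2_norm M (\<lambda>x. g n x - g N x)"
        using L2_norm_triangle_sub[of "g m" M "g N" "g n"] L2_norm_minus_commute[of M "g n" "g N"] gL by simp
      then show ?thesis using tail'[OF mn(1)] tail'[OF mn(2)] N by simp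
    qed
    then show ?thesis by blast
  qed
  then obtain G where G: "L2_converges M g G" using L2_complete[of g M] gL by blast
  then have GL: "G \<in> L2 M" by (simp add: L2_converges_iff)
  have Gtail: "L2_norm M (\<lambda>x. G x - g m x) \<le> (3 / 2) * (1 / 3) ^ m" for m
  proof (rule LIMSEQ_le_const2)
    show "(\<lambda>n. L2_norm M (\<lambda>x. g n x - g m x)) \<longlonglongrightarrow> L2_norm M (\<lambda>x. G x - g m x)"
      using L2_converges_norm[OF L2_converges_add[OF G L2_converges_const[OF L2_uminus[OF gL[of m]]]]] by simp
  qed (use tail' in blast)
  \<comment> \<open>The steps after k move g by at most (3/2) 3^-(k+1), half of the step 3^-k, so
    half of the inner product gained at step k survives in the limit; then 12^k / 3^k = 4^k.\<close>
  have low: "\<bar>L2_inner M (u k) G\<bar> \<ge> (1 / 2) * 4 ^ k" for k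
  proof -
    have "\<bar>L2_inner M (u k) (\<lambda>x. G x - g (Suc k) x)\<bar> \<le> L2_norm M (u k) * ((3 / 2) * (1 / 3) ^ Suc k)"
      using L2_Cauchy_Schwarz[OF uL L2_diff[OF GL gL]] Gtail[of "Suc k"]
      by (meson L2_norm_nonneg mult_left_mono order_trans)
    moreover have "L2_inner M (u k) (\<lambda>x. G x - g (Suc k) x) = L2_inner M (u k) G - L2_inner M (u k) (g (Suc k))"
      by (simp add: L2_inner_diff_right uL GL gL)
    ultimately have "\<bar>L2_inner M (u k) G\<bar> \<ge> (1 / 2) * ((1 / 3) ^ k * L2_norm M (u k))"
      using inner[of k] abs_triangle_ineq2_sym[of "L2_inner M (u k) (g (Suc k))" "L2_inner M (u k) G"]
      by (simp add: mult.commute)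
    moreover have "(1 / 3) ^ k * L2_norm M (u k) \<ge> (1 / 3) ^ k * 12 ^ k"
      using un[of k] by (intro mult_left_mono) auto
    moreover have "(1 / 3 :: real) ^ k * 12 ^ k = 4 ^ k"
      by (simp flip: power_mult_distrib)
    ultimately show ?thesis by linarith
  qed
  have "convergent (\<lambda>n. L2_inner M (fs n) G)"
    using w GL unfolding L2_converges_weakly_def convergent_def by blast
  then obtain B where B: "\<And>n. \<bar>L2_inner M (fs n) G\<bar> \<le> B"
    using convergent_imp_Bseq[THEN BseqE] by (metis real_norm_def)
  obtain k where "2 * B < 4 ^ k" using real_arch_pow[of 4 "2 * B"] by auto
  then show False using low[of k] B[of "\<sigma> (12 ^ k)"] by (simp add: u_def)
qed

text \<open>Pairing the sequence with its limit f bounds the square of the norm of f by B times that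
  norm; norm zero is split off because the norm is then cancelled.\<close>

lemma L2_weak_limit_norm_le:
  assumes w: "L2_converges_weakly M fs f" and B: "\<And>n. L2_norm M (fs n) \<le> B"
  shows "L2_norm M f \<le> B"
proof (cases "L2_norm M f = 0")
  case True
  then show ?thesis using B[of 0] L2_norm_nonneg[of M "fs 0"] by linarith
next
  case False
  have L: "fs n \<in> L2 M" "f \<in> L2 M" for n using w by (auto simp: L2_converges_weakly_def)
  have "L2_inner M f f \<le> B * L2_norm M f"
  proof (rule LIMSEQ_le_const2)
    show "(\<lambda>n. L2_inner M (fs n) f) \<longlonglongrightarrow> L2_inner M f f"
      using w L by (simp add: L2_converges_weakly_def)
    show "\<exists>N. \<forall>n\<ge>N. L2_inner M (fs n) f \<le> B * L2_norm M f"
      using L2_Cauchy_Schwarz[OF L(1,2)] B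
      by (meson L2_norm_nonneg abs_le_D1 mult_right_mono order_trans)
  qed
  then have "L2_norm M f * L2_norm M f \<le> B * L2_norm M f"
    by (simp add: L2_norm_sq[symmetric] power2_eq_square)
  then show ?thesis using False by (simp add: mult_le_cancel_right order_less_le)
qed

section \<open>Borel representatives\<close>

lemma borel_measurable_lebesgue_onI:
  "f \<in> borel_measurable borel \<Longrightarrow> f \<in> borel_measurable (lebesgue_on S)"
  by (simp add: measurable_restrict_space1 measurable_completion)

lemma
  fixes F :: "'a::euclidean_space \<Rightarrow> real"
  assumes S: "S \<in> sets borel" and F: "F \<in> borel_measurable borel" and 0: "\<And>x. x \<notin> S \<Longrightarrow> F x = 0"
  shows integral_lebesgue_on_borel: "integral\<^sup>L (lebesgue_on S) F = integral\<^sup>L lborel F"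
    and integrable_lebesgue_on_borel: "integrable (lebesgue_on S) F \<longleftrightarrow> integrable lborel F"
proof -
  have eq: "(\<lambda>x. indicator S x *\<^sub>R F x) = F" by (rule ext) (use 0 in \<open>auto simp: indicator_def\<close>)
  show "integral\<^sup>L (lebesgue_on S) F = integral\<^sup>L lborel F"
    using S F integral_completion[of F lborel] by (subst integral_restrict_space) (auto simp: eq simp del: real_scaleR_def)
  show "integrable (lebesgue_on S) F \<longleftrightarrow> integrable lborel F"
    using S F integrable_completion[of F lborel] by (subst integrable_restrict_space) (auto simp: eq simp del: real_scaleR_def)
qed

lemma L2_lebesgue_on_borel:
  fixes f :: "'a::euclidean_space \<Rightarrow> real"
  assumes S: "S \<in> sets borel" and f: "f \<in> borel_measurable borel" and 0: "\<And>x. x \<notin> S \<Longrightarrow> f x = 0"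
  shows "f \<in> L2 (lebesgue_on S) \<longleftrightarrow> f \<in> L2 lborel"
  using integrable_lebesgue_on_borel[OF S, of "\<lambda>x. (f x)\<^sup>2"] f 0
  by (simp add: L2_def borel_measurable_lebesgue_onI)

lemma L2_inner_lebesgue_on_borel:
  fixes f :: "'a::euclidean_space \<Rightarrow> real"
  assumes S: "S \<in> sets borel" and f: "f \<in> borel_measurable borel" and g: "g \<in> borel_measurable borel"
    and 0: "\<And>x. x \<notin> S \<Longrightarrow> f x = 0"
  shows "L2_inner (lebesgue_on S) f g = L2_inner lborel f g"
  unfolding L2_inner_def using integral_lebesgue_on_borel[OF S, of "\<lambda>x. f x * g x"] f g 0 by simp

lemma L2_norm_lebesgue_on_borel:
  fixes f :: "'a::euclidean_space \<Rightarrow> real"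
  assumes S: "S \<in> sets borel" and f: "f \<in> borel_measurable borel" and 0: "\<And>x. x \<notin> S \<Longrightarrow> f x = 0"
  shows "L2_norm (lebesgue_on S) f = L2_norm lborel f"
  unfolding L2_norm_def using integral_lebesgue_on_borel[OF S, of "\<lambda>x. (f x)\<^sup>2"] f 0 by simp

text \<open>The definitions use the completed measure on a subset, whereas translation and Fubini
  are applied with \<open>lborel\<close>. A Borel representative extended by zero lives in both
  settings with the same integrals.\<close>

lemma borel_representative:
  fixes f :: "'a::euclidean_space \<Rightarrow> real"
  assumes S: "S \<in> sets borel" and f: "f \<in> borel_measurable (lebesgue_on S)"
  obtains g where "g \<in> borel_measurable borel" "\<And>x. x \<notin> S \<Longrightarrow> g x = 0"
    "AE x in lebesgue_on S. f x = g x"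
proof -
  have "(\<lambda>x. if x \<in> S then f x else 0) \<in> borel_measurable lebesgue"
    using S f by (intro borel_measurable_if_I) auto
  then obtain g where g: "g \<in> borel_measurable lborel" "AE x in lborel. (if x \<in> S then f x else 0) = g x"
    using completion_ex_borel_measurable_real by blast
  have "AE x in lebesgue. (if x \<in> S then f x else 0) = g x"
    using g(2) by (rule AE_completion)
  then have "AE x in lebesgue_on S. f x = indicator S x * g x"
    using S by (subst AE_restrict_space_iff) (auto elim: eventually_mono simp: indicator_def)
  moreover have "(\<lambda>x. indicator S x * g x) \<in> borel_measurable borel"
    using S g(1) by simp
  ultimately show thesis by (intro that[of "\<lambda>x. indicator S x * g x"]) (auto simp: indicator_def)
qed

lemma L2_norm_AE_cong:
  assumes "f \<in> borel_measurable M" "g \<in> borel_measurable M" "AE x in M. f x = g x"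
  shows "L2_norm M f = L2_norm M g"
proof -
  have "(LINT x|M. (f x)\<^sup>2) = (LINT x|M. (g x)\<^sup>2)"
    using assms by (intro integral_cong_AE) auto
  then show ?thesis by (simp add: L2_norm_def)
qed

lemma L2_converges_AE_cong:
  assumes c: "L2_converges M fs f" and g: "g \<in> borel_measurable M" "AE x in M. f x = g x"
  shows "L2_converges M fs g"
proof -
  have L: "fs n \<in> L2 M" "f \<in> L2 M" for n using c by (auto simp: L2_converges_iff)
  have gL: "g \<in> L2 M" by (rule L2_AE_cong[OF L(2) g])
  have "L2_norm M (\<lambda>x. fs n x - g x) = L2_norm M (\<lambda>x. fs n x - f x)" for n
    using g(2) L2_measurable[OF L2_diff[OF L(1) gL]] L2_measurable[OF L2_diff[OF L]]
    by (intro L2_norm_AE_cong) (auto elim: eventually_mono)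
  then show ?thesis using c gL by (simp add: L2_converges_iff)
qed

lemma L2_bounded:
  assumes "finite_measure M" "f \<in> borel_measurable M" "\<And>x. x \<in> space M \<Longrightarrow> \<bar>f x\<bar> \<le> C"
  shows "f \<in> L2 M"
proof -
  interpret finite_measure M by fact
  have "(\<lambda>x. 1) \<in> L2 M" by (simp add: L2_def)
  from L2_bounded_mult[OF this assms(2,3)] show ?thesis by simp
qed

lemma L2_integrable:
  assumes "finite_measure M" "f \<in> L2 M" shows "integrable M f"
  using L2_mult_integrable[OF assms(2) L2_bounded[OF assms(1), of "\<lambda>x. 1" 1]] by simp

section \<open>Translation of functions on the whole space\<close>

lemma
  fixes F :: "'a::euclidean_space \<Rightarrow> real"
  assumes F: "F \<in> borel_measurable borel"
  shows integral_shift: "(LINT x|lborel. F (x + v)) = (LINT x|lborel. F x)"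
    and integrable_shift: "integrable lborel (\<lambda>x. F (x + v)) \<longleftrightarrow> integrable lborel F"
  using F integral_distr[of "(+) v" lborel borel F] integrable_distr_eq[of "(+) v" lborel borel F]
  by (simp_all add: lborel_distr_plus add.commute)

lemma
  fixes f :: "'a::euclidean_space \<Rightarrow> real"
  assumes f: "f \<in> L2 lborel"
  shows L2_shift: "(\<lambda>x. f (x + v)) \<in> L2 lborel"
    and L2_norm_shift: "L2_norm lborel (\<lambda>x. f (x + v)) = L2_norm lborel f"
proof -
  have m: "f \<in> borel_measurable borel" using L2_measurable[OF f] by simp
  then have "(\<lambda>x. f (x + v)) \<in> borel_measurable borel" by measurable
  then show "(\<lambda>x. f (x + v)) \<in> L2 lborel"
    using f m integrable_shift[of "\<lambda>x. (f x)\<^sup>2" v] by (simp add: L2_def)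
  show "L2_norm lborel (\<lambda>x. f (x + v)) = L2_norm lborel f"
    using m integral_shift[of "\<lambda>x. (f x)\<^sup>2" v] by (simp add: L2_norm_def)
qed

section \<open>The weak product rule\<close>

lemma has_real_derivative_sequence:
  fixes G :: "real \<Rightarrow> real"
  assumes S: "convex S" "open S" "s \<in> S"
    and F: "\<And>n s. s \<in> S \<Longrightarrow> (F n has_real_derivative F' n s) (at s)"
    and lim: "\<And>s. s \<in> S \<Longrightarrow> (\<lambda>n. F n s) \<longlonglongrightarrow> G s"
    and e: "\<And>n s. s \<in> S \<Longrightarrow> \<bar>F' n s - G' s\<bar> \<le> e n" "e \<longlonglongrightarrow> 0"
  shows "(G has_real_derivative G' s) (at s)"
proof -
  have "\<exists>g. \<forall>x\<in>S. (\<lambda>n. F n x) \<longlonglongrightarrow> g x \<and> (g has_derivative (times (G' x))) (at x within S)"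
  proof (rule has_derivative_sequence[where f=F and f'="\<lambda>n x. times (F' n x)" and ?x0.0=s and l="G s"])
    show "convex S" "s \<in> S" "(\<lambda>n. F n s) \<longlonglongrightarrow> G s" using S lim by auto
    show "(F n has_derivative times (F' n x)) (at x within S)" if "x \<in> S" for n x
      using F[OF that] by (simp add: has_field_derivative_def has_derivative_at_withinI)
    show "\<forall>\<^sub>F n in sequentially. \<forall>x\<in>S. \<forall>h. norm (F' n x * h - G' x * h) \<le> r * norm h" if "r > 0" for r
      using order_tendstoD(2)[OF e(2) that]
    proof eventually_elim
      case (elim n)
      have "norm (F' n x * h - G' x * h) \<le> r * norm h" if "x \<in> S" for x h
        using e(1)[OF that, of n] elim
        by (simp add: left_diff_distrib[symmetric] abs_mult mult_right_mono)
      then show ?case by blast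
    qed
  qed
  then obtain g where g: "\<And>x. x \<in> S \<Longrightarrow> (\<lambda>n. F n x) \<longlonglongrightarrow> g x"
    "(g has_derivative (times (G' s))) (at s within S)"
    using S(3) by blast
  have "g x = G x" if "x \<in> S" for x
    using LIMSEQ_unique[OF g(1) lim] that by blast
  with g(2) S(2,3) have "(G has_derivative (times (G' s))) (at s)"
    using at_within_open has_derivative_transform_within_open by (metis (no_types, lifting))
  then show ?thesis by (simp add: has_field_derivative_def)
qed

text \<open>Differentiation under the integral with the derivative falling on the smooth factor: the
  difference quotients of \<eta> are bounded by a bound C of its derivative, so C |h|
  dominates.\<close>

lemma has_derivative_integral_shift:
  fixes h :: "'a::euclidean_space \<Rightarrow> real"
  assumes h: "integrable lborel h" and \<eta>: "\<eta> \<in> test_functions S" and b: "b \<in> Basis"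
  shows "((\<lambda>s. LINT x|lborel. h x * \<eta> (x + s *\<^sub>R b)) has_real_derivative
    (LINT x|lborel. h x * dir_deriv \<eta> b (x + s *\<^sub>R b))) (at s)"
proof -
  have sm: "smooth \<eta>" by (rule test_functions_smooth[OF \<eta>])
  obtain C where C: "C > 0" "\<And>x. \<bar>dir_deriv \<eta> b x\<bar> \<le> C"
    using test_functions_bounded[OF test_functions_dir_deriv[OF \<eta> b]] by metis
  obtain C' where C': "C' > 0" "\<And>x. \<bar>\<eta> x\<bar> \<le> C'"
    using test_functions_bounded[OF \<eta>] by metis
  have hm[measurable]: "h \<in> borel_measurable borel" using h by (auto dest: borel_measurable_integrable)
  have cm[measurable]: "\<eta> \<in> borel_measurable borel" by (rule smooth_borel_measurable[OF sm])
  have dm[measurable]: "dir_deriv \<eta> b \<in> borel_measurable borel"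
    by (intro smooth_borel_measurable smooth_dir_deriv sm b)
  have Lip: "\<bar>\<eta> (x + r *\<^sub>R b) - \<eta> (x + s *\<^sub>R b)\<bar> \<le> C * \<bar>r - s\<bar>" for x r s
    using field_differentiable_bound[of UNIV "\<lambda>r. \<eta> (x + r *\<^sub>R b)" "\<lambda>r. dir_deriv \<eta> b (x + r *\<^sub>R b)" C r s]
      smooth_has_line_derivative[OF sm] C by auto
  have int: "integrable lborel (\<lambda>x. h x * \<eta> (x + r *\<^sub>R b))" for r
  proof (rule Bochner_Integration.integrable_bound)
    show "integrable lborel (\<lambda>x. C' * h x)" using h by simp
    show "AE x in lborel. norm (h x * \<eta> (x + r *\<^sub>R b)) \<le> norm (C' * h x)"
      using C' by (auto simp: abs_mult mult.commute[of C'] intro!: mult_left_mono)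
  qed measurable
  let ?F = "\<lambda>s. LINT x|lborel. h x * \<eta> (x + s *\<^sub>R b)"
  have "(\<lambda>n. (?F (X n) - ?F s) / (X n - s)) \<longlonglongrightarrow> (LINT x|lborel. h x * dir_deriv \<eta> b (x + s *\<^sub>R b))"
    if X: "\<And>n. X n \<noteq> s" "X \<longlonglongrightarrow> s" for X
  proof -
    have "(\<lambda>n. LINT x|lborel. h x * ((\<eta> (x + X n *\<^sub>R b) - \<eta> (x + s *\<^sub>R b)) / (X n - s)))
      \<longlonglongrightarrow> (LINT x|lborel. h x * dir_deriv \<eta> b (x + s *\<^sub>R b))"
    proof (rule integral_dominated_convergence)
      show "integrable lborel (\<lambda>x. C * \<bar>h x\<bar>)" using h by simp
      show "AE x in lborel. (\<lambda>n. h x * ((\<eta> (x + X n *\<^sub>R b) - \<eta> (x + s *\<^sub>R b)) / (X n - s)))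
          \<longlonglongrightarrow> h x * dir_deriv \<eta> b (x + s *\<^sub>R b)"
      proof (intro AE_I2 tendsto_mult_left)
        fix x
        have "((\<lambda>r. (\<eta> (x + r *\<^sub>R b) - \<eta> (x + s *\<^sub>R b)) / (r - s)) \<longlongrightarrow> dir_deriv \<eta> b (x + s *\<^sub>R b)) (at s)"
          using smooth_has_line_derivative[OF sm, of x b s] by (simp add: has_field_derivative_iff)
        then show "(\<lambda>n. (\<eta> (x + X n *\<^sub>R b) - \<eta> (x + s *\<^sub>R b)) / (X n - s)) \<longlonglongrightarrow> dir_deriv \<eta> b (x + s *\<^sub>R b)"
          using X unfolding tendsto_at_iff_sequentially comp_def by auto
      qed
      show "AE x in lborel. norm (h x * ((\<eta> (x + X n *\<^sub>R b) - \<eta> (x + s *\<^sub>R b)) / (X n - s))) \<le> C * \<bar>h x\<bar>" for n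
      proof (rule AE_I2)
        fix x
        have "\<bar>(\<eta> (x + X n *\<^sub>R b) - \<eta> (x + s *\<^sub>R b)) / (X n - s)\<bar> \<le> C"
          using Lip[of x "X n" s] X(1)[of n] by (simp add: abs_divide pos_divide_le_eq)
        then show "norm (h x * ((\<eta> (x + X n *\<^sub>R b) - \<eta> (x + s *\<^sub>R b)) / (X n - s))) \<le> C * \<bar>h x\<bar>"
          unfolding real_norm_def abs_mult mult.commute[of C] by (rule mult_left_mono) simp
      qed
    qed measurable
    moreover have "(LINT x|lborel. h x * ((\<eta> (x + X n *\<^sub>R b) - \<eta> (x + s *\<^sub>R b)) / (X n - s)))
      = (?F (X n) - ?F s) / (X n - s)" for n
      by (simp add: right_diff_distrib diff_divide_distrib int)
    ultimately show ?thesis by (simp only:)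
  qed
  then show ?thesis
    unfolding has_field_derivative_iff tendsto_at_iff_sequentially comp_def by auto
qed

text \<open>The bound is the same for every shift y, because translation preserves the L^2 norm;
  this makes the approximation of v uniform along a whole line of translates.\<close>

lemma L2_converges_inner_shift:
  fixes v :: "'a::euclidean_space \<Rightarrow> real"
  assumes g: "g \<in> L2 lborel" and c: "L2_converges lborel \<eta> v"
  shows "\<bar>(LINT x|lborel. g x * \<eta> n (x + y)) - (LINT x|lborel. g x * v (x + y))\<bar>
      \<le> L2_norm lborel g * L2_norm lborel (\<lambda>x. \<eta> n x - v x)"
proof -
  have L: "\<eta> n \<in> L2 lborel" "v \<in> L2 lborel" for n
    using c by (auto simp: L2_converges_iff)
  have "(LINT x|lborel. g x * \<eta> n (x + y)) - (LINT x|lborel. g x * v (x + y))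
      = L2_inner lborel g (\<lambda>x. \<eta> n (x + y) - v (x + y))"
    using L2_inner_diff_right[OF g L2_shift[OF L(1)] L2_shift[OF L(2)]] by (simp add: L2_inner_def)
  then show ?thesis
    using L2_Cauchy_Schwarz[OF g L2_diff[OF L2_shift[OF L(1)] L2_shift[OF L(2)]], of n y y]
      L2_norm_shift[OF L2_diff[OF L(1) L(2)], of n y] by simp
qed

text \<open>
  The function \<open>s \<mapsto> \<integral> h(x) v(x + s b) dx\<close> can be differentiated by moving the derivative to \<open>h\<close>
  or to \<open>v\<close>. Comparing the two values at \<open>s = 0\<close> gives integration by parts for two functions
  that have only weak derivatives, without mollification.
\<close>

lemma weak_derivative_translate:
  fixes h :: "'a::euclidean_space \<Rightarrow> real"
  assumes h: "h \<in> L2 lborel" "integrable lborel h" and g: "g \<in> L2 lborel" and b: "b \<in> Basis"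
    and weak: "\<And>\<eta>. \<eta> \<in> test_functions UNIV \<Longrightarrow>
       (LINT x|lborel. h x * dir_deriv \<eta> b x) = - (LINT x|lborel. g x * \<eta> x)"
    and \<eta>: "\<And>n. \<eta> n \<in> test_functions UNIV" "L2_converges lborel \<eta> v"
  shows "((\<lambda>s. LINT x|lborel. h x * v (x + s *\<^sub>R b)) has_real_derivative
    - (LINT x|lborel. g x * v (x + s *\<^sub>R b))) (at s)"
proof (rule has_real_derivative_sequence[where S=UNIV])
  let ?e = "\<lambda>n. L2_norm lborel g * L2_norm lborel (\<lambda>x. \<eta> n x - v x)"
  have e0: "(\<lambda>n. c * L2_norm lborel (\<lambda>x. \<eta> n x - v x)) \<longlonglongrightarrow> 0" for c
    using \<eta>(2) by (intro tendsto_mult_right_zero) (simp add: L2_converges_iff)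
  show "((\<lambda>s. LINT x|lborel. h x * \<eta> n (x + s *\<^sub>R b)) has_real_derivative
    - (LINT x|lborel. g x * \<eta> n (x + s *\<^sub>R b))) (at s)" for n s
  proof -
    have "(\<lambda>x. \<eta> n (x + s *\<^sub>R b)) \<in> test_functions UNIV"
      using test_functions_shift[OF \<eta>(1)[of n]] test_functions_mono[OF subset_UNIV] by blast
    then have "(LINT x|lborel. h x * dir_deriv (\<eta> n) b (x + s *\<^sub>R b)) = - (LINT x|lborel. g x * \<eta> n (x + s *\<^sub>R b))"
      using weak[of "\<lambda>x. \<eta> n (x + s *\<^sub>R b)"] dir_deriv_shift[OF test_functions_smooth[OF \<eta>(1)[of n]]] by simp
    then show ?thesis
      using has_derivative_integral_shift[OF h(2) \<eta>(1)[of n] b, of s] by simp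
  qed
  show "(\<lambda>n. LINT x|lborel. h x * \<eta> n (x + s *\<^sub>R b)) \<longlonglongrightarrow> (LINT x|lborel. h x * v (x + s *\<^sub>R b))" for s
  proof -
    have "\<forall>n. norm ((LINT x|lborel. h x * \<eta> n (x + s *\<^sub>R b)) - (LINT x|lborel. h x * v (x + s *\<^sub>R b)))
        \<le> L2_norm lborel h * L2_norm lborel (\<lambda>x. \<eta> n x - v x)"
      using L2_converges_inner_shift[OF h(1) \<eta>(2)] by simp
    from Lim_null_comparison[OF always_eventually[OF this] e0] show ?thesis by (rule LIM_zero_cancel)
  qed
  show "\<bar>- (LINT x|lborel. g x * \<eta> n (x + s *\<^sub>R b)) - - (LINT x|lborel. g x * v (x + s *\<^sub>R b))\<bar> \<le> ?e n" for n s
    using L2_converges_inner_shift[OF g \<eta>(2), of n "s *\<^sub>R b"] by (simp add: abs_minus_commute)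
  show "?e \<longlonglongrightarrow> 0" by (rule e0)
qed auto

text \<open>Counterpart of the previous rule with the derivative on v, whose weak derivative is
  tested only inside S. Translates of test functions supported in K stay in S for shifts shorter
  than d, so the approximants are differentiated for |s| < d and the result is evaluated at
  0.\<close>

lemma weak_derivative_translate_compact:
  fixes v :: "'a::euclidean_space \<Rightarrow> real"
  assumes v: "v \<in> L2 lborel" "integrable lborel v" and v': "v' \<in> L2 lborel" and b: "b \<in> Basis"
    and weak: "\<And>\<eta>. \<eta> \<in> test_functions S \<Longrightarrow>
       (LINT x|lborel. v x * dir_deriv \<eta> b x) = - (LINT x|lborel. v' x * \<eta> x)"
    and S: "open S" "compact K" "K \<subseteq> S"
    and \<eta>: "\<And>n. \<eta> n \<in> test_functions S" "\<And>n x. x \<notin> K \<Longrightarrow> \<eta> n x = 0" "L2_converges lborel \<eta> h"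
  shows "((\<lambda>s. LINT x|lborel. h x * v (x + s *\<^sub>R b)) has_real_derivative
    (LINT x|lborel. h x * v' x)) (at 0)"
proof -
  obtain d where d: "d > 0" "(\<Union>x\<in>K. ball x d) \<subseteq> S"
    using compact_subset_open_imp_ball_epsilon_subset[OF S(2,1,3)] by metis
  have L: "\<eta> n \<in> L2 lborel" "h \<in> L2 lborel" for n
    using \<eta>(3) by (auto simp: L2_converges_iff)
  \<comment> \<open>Translation invariance moves the shift from v to the other factor with opposite
    sign; the chain rule factor -1 that arises later cancels the sign in the definition of the weak
    derivative.\<close>
  have sh: "(LINT x|lborel. f x * v (x + s *\<^sub>R b)) = (LINT x|lborel. v x * f (x + (- s) *\<^sub>R b))"
    if "f \<in> L2 lborel" for f s
  proof -
    have "f \<in> borel_measurable borel" "v \<in> borel_measurable borel"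
      using L2_measurable[OF that] L2_measurable[OF v(1)] by simp_all
    then show ?thesis
      using integral_shift[of "\<lambda>x. v x * f (x + (- s) *\<^sub>R b)" "s *\<^sub>R b"] by (simp add: mult.commute)
  qed
  let ?e = "\<lambda>n. L2_norm lborel v' * L2_norm lborel (\<lambda>x. \<eta> n x - h x)"
  have e0: "(\<lambda>n. c * L2_norm lborel (\<lambda>x. \<eta> n x - h x)) \<longlonglongrightarrow> 0" for c
    using \<eta>(3) by (intro tendsto_mult_right_zero) (simp add: L2_converges_iff)
  have "((\<lambda>s. LINT x|lborel. v x * h (x + (- s) *\<^sub>R b)) has_real_derivative
      (\<lambda>s. LINT x|lborel. v' x * h (x + (- s) *\<^sub>R b)) 0) (at 0)"
  proof (rule has_real_derivative_sequence[where S="{-d<..<d}" and F="\<lambda>n s. LINT x|lborel. v x * \<eta> n (x + (- s) *\<^sub>R b)"])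
    show "((\<lambda>s. LINT x|lborel. v x * \<eta> n (x + (- s) *\<^sub>R b)) has_real_derivative
      (LINT x|lborel. v' x * \<eta> n (x + (- s) *\<^sub>R b))) (at s)" if s: "s \<in> {-d<..<d}" for n s
    proof -
      have "(\<lambda>x. \<eta> n (x + (- s) *\<^sub>R b)) \<in> test_functions S"
      proof (rule test_functionsI)
        show "smooth (\<lambda>x. \<eta> n (x + (- s) *\<^sub>R b))"
          using test_functions_smooth[OF test_functions_shift[OF \<eta>(1)[of n]]] by blast
        show "compact ((+) (s *\<^sub>R b) ` K)" by (rule compact_translation[OF S(2)])
        have "s *\<^sub>R b + x \<in> ball x d" for x
          using s b by (auto simp: dist_norm)
        then show "(+) (s *\<^sub>R b) ` K \<subseteq> S" using d(2) by blast
        show "\<eta> n (x + (- s) *\<^sub>R b) = 0" if "x \<notin> (+) (s *\<^sub>R b) ` K" for x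
        proof (rule \<eta>(2))
          show "x + (- s) *\<^sub>R b \<notin> K"
            using that by (force simp: image_iff)
        qed
      qed
      then have "(LINT x|lborel. v x * dir_deriv (\<eta> n) b (x + (- s) *\<^sub>R b)) = - (LINT x|lborel. v' x * \<eta> n (x + (- s) *\<^sub>R b))"
        using weak[of "\<lambda>x. \<eta> n (x + (- s) *\<^sub>R b)"] dir_deriv_shift[OF test_functions_smooth[OF \<eta>(1)[of n]], of "(- s) *\<^sub>R b"] by simp
      moreover have "((\<lambda>s. LINT x|lborel. v x * \<eta> n (x + (- s) *\<^sub>R b)) has_real_derivative
         (LINT x|lborel. v x * dir_deriv (\<eta> n) b (x + (- s) *\<^sub>R b)) * (- 1)) (at s)"
        by (rule DERIV_chain2[OF has_derivative_integral_shift[OF v(2) \<eta>(1)[of n] b]])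
          (auto intro!: derivative_eq_intros)
      ultimately show ?thesis by simp
    qed
    show "(\<lambda>n. LINT x|lborel. v x * \<eta> n (x + (- s) *\<^sub>R b)) \<longlonglongrightarrow> (LINT x|lborel. v x * h (x + (- s) *\<^sub>R b))" for s
    proof -
      have "\<forall>n. norm ((LINT x|lborel. v x * \<eta> n (x + (- s) *\<^sub>R b)) - (LINT x|lborel. v x * h (x + (- s) *\<^sub>R b)))
          \<le> L2_norm lborel v * L2_norm lborel (\<lambda>x. \<eta> n x - h x)"
        using L2_converges_inner_shift[OF v(1) \<eta>(3), where y="(- s) *\<^sub>R b"] by simp
      from Lim_null_comparison[OF always_eventually[OF this] e0] show ?thesis by (rule LIM_zero_cancel)
    qed
    show "\<bar>(LINT x|lborel. v' x * \<eta> n (x + (- s) *\<^sub>R b)) - (LINT x|lborel. v' x * h (x + (- s) *\<^sub>R b))\<bar> \<le> ?e n" for n s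
      by (rule L2_converges_inner_shift[OF v' \<eta>(3)])
    show "?e \<longlonglongrightarrow> 0" by (rule e0)
  qed (use d in auto)
  then show ?thesis by (simp add: sh[OF L(2)] mult.commute)
qed

text \<open>Density of test functions is an assumption at this stage; it is discharged once a
  Dirichlet eigenbasis is present.\<close>

locale planar_domain =
  fixes \<Omega> :: "(real^2) set"
  assumes open_domain: "open \<Omega>" and bounded_domain: "bounded \<Omega>"
    and test_functions_dense: "f \<in> L2 (lebesgue_on \<Omega>) \<Longrightarrow>
      \<exists>\<eta>. (\<forall>n. \<eta> n \<in> test_functions \<Omega>) \<and> L2_converges (lebesgue_on \<Omega>) \<eta> f"
begin

abbreviation "M \<equiv> lebesgue_on \<Omega>"

lemma domain_borel [simp, measurable]: "\<Omega> \<in> sets borel"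
  using open_domain by simp

lemma finite_measure_domain: "finite_measure M"
proof
  have "\<Omega> \<in> lmeasurable"
    using bounded_domain by (intro bounded_set_imp_lmeasurable) auto
  then show "emeasure M (space M) \<noteq> \<infinity>"
    by (simp add: emeasure_restrict_space fmeasurable_def)
qed


lemma L2_test_function: "\<eta> \<in> test_functions S \<Longrightarrow> \<eta> \<in> L2 M"
  by (metis L2_bounded[OF finite_measure_domain] test_functions_bounded borel_measurable_lebesgue_onI
    smooth_borel_measurable test_functions_smooth)

lemma test_function_measurable: "\<eta> \<in> test_functions S \<Longrightarrow> \<eta> \<in> borel_measurable M"
  by (intro borel_measurable_lebesgue_onI smooth_borel_measurable test_functions_smooth)

lemma L2_test_mult: "\<eta> \<in> test_functions S \<Longrightarrow> f \<in> L2 M \<Longrightarrow> (\<lambda>x. \<eta> x * f x) \<in> L2 M"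
  by (metis L2_bounded_mult test_functions_bounded test_function_measurable)

text \<open>Orthogonality to test functions extends to all of L^2 by density, and f is then
  orthogonal to itself. This identifies weak derivatives up to null sets.\<close>

lemma L2_zero_from_test:
  assumes f: "f \<in> L2 M" and 0: "\<And>\<eta>. \<eta> \<in> test_functions \<Omega> \<Longrightarrow> L2_inner M f \<eta> = 0"
  shows "g \<in> L2 M \<Longrightarrow> L2_inner M f g = 0" and "AE x in M. f x = 0"
proof -
  show *: "L2_inner M f g = 0" if g: "g \<in> L2 M" for g
  proof -
    obtain \<eta> where "\<And>n. \<eta> n \<in> test_functions \<Omega>" "L2_converges M \<eta> g"
      using test_functions_dense[OF g] by blast
    then have "(\<lambda>n. L2_inner M f (\<eta> n)) \<longlonglongrightarrow> L2_inner M f g" and "\<And>n. L2_inner M f (\<eta> n) = 0"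
      by (auto intro: L2_converges_inner[OF L2_converges_const[OF f]] 0)
    then show ?thesis by (simp add: LIMSEQ_const_iff)
  qed
  show "AE x in M. f x = 0"
    using L2_inner_self_eq_0[OF f *[OF f]] .
qed

lemma has_weak_partialD:
  assumes "has_weak_partial \<Omega> i f g"
  shows "f \<in> L2 M" "g \<in> L2 M"
    "\<eta> \<in> test_functions \<Omega> \<Longrightarrow> L2_inner M f (dir_deriv \<eta> (axis i 1)) = - L2_inner M g \<eta>"
  using assms by (auto simp: has_weak_partial_def L2_inner_def)

lemma has_weak_partialI:
  assumes "f \<in> L2 M" "g \<in> L2 M"
    "\<And>\<eta>. \<eta> \<in> test_functions \<Omega> \<Longrightarrow> L2_inner M f (dir_deriv \<eta> (axis i 1)) = - L2_inner M g \<eta>"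
  shows "has_weak_partial \<Omega> i f g"
  using assms by (auto simp: has_weak_partial_def L2_inner_def)

lemma axis_Basis [simp]: "axis (i::2) (1::real) \<in> Basis"
  by (simp add: axis_in_Basis_iff)

text \<open>The cutoff a is what allows the comparison of the two derivatives: a u, extended by
  zero, is weakly differentiable on the whole plane with derivative g, and its approximants a
  \<zeta>_n are all supported in one compact subset of \<Omega>.\<close>

lemma weak_product_rule:
  assumes u: "has_weak_partial \<Omega> i u u'" and v: "has_weak_partial \<Omega> i v v'"
    and a: "a \<in> test_functions \<Omega>"
  shows "L2_inner M (\<lambda>x. a x * u x) v' = - L2_inner M (\<lambda>x. a x * u' x + dir_deriv a (axis i 1) x * u x) v"
proof -
  let ?e = "axis i 1 :: real^2"
  note fin = finite_measure_domain
  have rep: "\<exists>f0. f0 \<in> borel_measurable borel \<and> (\<forall>x. x \<notin> \<Omega> \<longrightarrow> f0 x = 0) \<and> (AE x in M. f x = f0 x) \<and>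
     f0 \<in> L2 M \<and> f0 \<in> L2 lborel \<and> integrable lborel f0" if f: "f \<in> L2 M" for f
  proof -
    obtain f0 where f0: "f0 \<in> borel_measurable borel" "\<And>x. x \<notin> \<Omega> \<Longrightarrow> f0 x = 0" "AE x in M. f x = f0 x"
      using borel_representative[OF domain_borel L2_measurable[OF f]] by blast
    have M: "f0 \<in> L2 M"
      by (rule L2_AE_cong[OF f borel_measurable_lebesgue_onI[OF f0(1)] f0(3)])
    then have "f0 \<in> L2 lborel" using L2_lebesgue_on_borel[OF domain_borel f0(1,2)] by simp
    moreover have "integrable lborel f0"
      using integrable_lebesgue_on_borel[OF domain_borel f0(1,2)] L2_integrable[OF fin M] by simp
    ultimately show ?thesis using f0 M by blast
  qed
  obtain u0 where u0: "u0 \<in> borel_measurable borel" "\<And>x. x \<notin> \<Omega> \<Longrightarrow> u0 x = 0" "AE x in M. u x = u0 x"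
    "u0 \<in> L2 M" "u0 \<in> L2 lborel" "integrable lborel u0" using rep[OF has_weak_partialD(1)[OF u]] by blast
  obtain u1 where u1: "u1 \<in> borel_measurable borel" "\<And>x. x \<notin> \<Omega> \<Longrightarrow> u1 x = 0" "AE x in M. u' x = u1 x"
    "u1 \<in> L2 M" "u1 \<in> L2 lborel" "integrable lborel u1" using rep[OF has_weak_partialD(2)[OF u]] by blast
  obtain v0 where v0: "v0 \<in> borel_measurable borel" "\<And>x. x \<notin> \<Omega> \<Longrightarrow> v0 x = 0" "AE x in M. v x = v0 x"
    "v0 \<in> L2 M" "v0 \<in> L2 lborel" "integrable lborel v0" using rep[OF has_weak_partialD(1)[OF v]] by blast
  obtain v1 where v1: "v1 \<in> borel_measurable borel" "\<And>x. x \<notin> \<Omega> \<Longrightarrow> v1 x = 0" "AE x in M. v' x = v1 x"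
    "v1 \<in> L2 M" "v1 \<in> L2 lborel" "integrable lborel v1" using rep[OF has_weak_partialD(2)[OF v]] by blast
  have as: "smooth a" and a'm: "dir_deriv a ?e \<in> test_functions \<Omega>"
    using a by (auto intro: test_functions_smooth test_functions_dir_deriv)
  note ab = smooth_borel_measurable[OF as] and a'b = smooth_borel_measurable[OF test_functions_smooth[OF a'm]]
  obtain C where C: "\<And>x. \<bar>a x\<bar> \<le> C" using test_functions_bounded[OF a] by metis
  obtain C' where C': "\<And>x. \<bar>dir_deriv a ?e x\<bar> \<le> C'" using test_functions_bounded[OF a'm] by metis
  obtain K where K: "compact K" "K \<subseteq> \<Omega>" "\<And>x. x \<notin> K \<Longrightarrow> a x = 0"
    using test_functionsE[OF a] by metis
  define h where "h x = a x * u0 x" for x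
  define g where "g x = a x * u1 x + dir_deriv a ?e x * u0 x" for x
  have hL: "h \<in> L2 lborel" unfolding h_def by (rule L2_bounded_mult[OF u0(5) _ C]) (simp add: ab)
  have gL: "g \<in> L2 lborel" unfolding g_def
    by (intro L2_add L2_bounded_mult[OF u1(5) _ C] L2_bounded_mult[OF u0(5) _ C']) (simp_all add: ab a'b)
  have hb: "h \<in> borel_measurable borel" "\<And>x. x \<notin> \<Omega> \<Longrightarrow> h x = 0"
    and gb: "g \<in> borel_measurable borel" "\<And>x. x \<notin> \<Omega> \<Longrightarrow> g x = 0"
    using L2_measurable[OF hL] L2_measurable[OF gL] u0(2) u1(2) by (auto simp: h_def g_def)
  have hi: "integrable lborel h"
  proof (rule Bochner_Integration.integrable_bound[of _ "\<lambda>x. C * u0 x"])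
    show "AE x in lborel. norm (h x) \<le> norm (C * u0 x)"
      using order_trans[OF C abs_ge_self[of C]] by (auto simp: h_def abs_mult intro!: AE_I2 mult_right_mono)
  qed (use u0(6) L2_measurable[OF hL] in auto)
  have lb: "(LINT x|lborel. p x * q x) = L2_inner M p q"
    if "p \<in> borel_measurable borel" "\<And>x. x \<notin> \<Omega> \<Longrightarrow> p x = 0" "q \<in> borel_measurable borel" for p q
    using L2_inner_lebesgue_on_borel[OF domain_borel that(1,3,2)] by (simp add: L2_inner_def)
  have cong: "L2_inner M p q = L2_inner M p0 q"
    if "AE x in M. p x = p0 x" "p \<in> L2 M" "p0 \<in> L2 M" "q \<in> L2 M" for p p0 q
    using that by (intro L2_inner_AE_cong L2_measurable)
  \<comment> \<open>For \<eta> on the whole plane the product a \<eta> is admissible in \<Omega>, so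
    the weak derivative of u applies to it; the term with the derivative of a moves into g.\<close>
  have wh: "(LINT x|lborel. h x * dir_deriv \<eta> ?e x) = - (LINT x|lborel. g x * \<eta> x)"
    if \<eta>: "\<eta> \<in> test_functions UNIV" for \<eta>
  proof -
    have \<eta>s: "smooth \<eta>" by (rule test_functions_smooth[OF \<eta>])
    have a\<eta>: "(\<lambda>x. a x * \<eta> x) \<in> test_functions \<Omega>" by (rule test_functions_mult[OF a \<eta>s])
    have dm: "dir_deriv \<eta> ?e \<in> borel_measurable borel"
      using smooth_borel_measurable[OF smooth_dir_deriv[OF \<eta>s]] by simp
    note \<eta>b = smooth_borel_measurable[OF \<eta>s]
    have aL: "(\<lambda>x. a x * \<eta> x) \<in> L2 M" "(\<lambda>x. a x * dir_deriv \<eta> ?e x) \<in> L2 M" "(\<lambda>x. dir_deriv a ?e x * \<eta> x) \<in> L2 M"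
      by (intro L2_test_mult[OF a] L2_test_mult[OF a'm] L2_test_function[OF \<eta>]
        L2_test_function[OF test_functions_dir_deriv[OF \<eta>]]; simp)+
    have "dir_deriv (\<lambda>x. a x * \<eta> x) ?e = (\<lambda>x. a x * dir_deriv \<eta> ?e x + dir_deriv a ?e x * \<eta> x)"
      by (intro ext dir_deriv_mult smooth_differentiable as \<eta>s)
    then have "L2_inner M u (\<lambda>x. a x * dir_deriv \<eta> ?e x + dir_deriv a ?e x * \<eta> x) = - L2_inner M u' (\<lambda>x. a x * \<eta> x)"
      using has_weak_partialD(3)[OF u a\<eta>] by simp
    then have "L2_inner M u0 (\<lambda>x. a x * dir_deriv \<eta> ?e x) + L2_inner M u0 (\<lambda>x. dir_deriv a ?e x * \<eta> x) = - L2_inner M u1 (\<lambda>x. a x * \<eta> x)"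
      using cong[OF u0(3) has_weak_partialD(1)[OF u] u0(4)] cong[OF u1(3) has_weak_partialD(2)[OF u] u1(4)] aL
      by (simp add: L2_inner_add_right u0(4) L2_add)
    moreover have "L2_inner M h (dir_deriv \<eta> ?e) = L2_inner M u0 (\<lambda>x. a x * dir_deriv \<eta> ?e x)"
      by (simp add: L2_inner_def h_def ac_simps)
    moreover have "L2_inner M g \<eta> = L2_inner M u1 (\<lambda>x. a x * \<eta> x) + L2_inner M u0 (\<lambda>x. dir_deriv a ?e x * \<eta> x)"
    proof -
      have "L2_inner M g \<eta> = L2_inner M (\<lambda>x. a x * u1 x) \<eta> + L2_inner M (\<lambda>x. dir_deriv a ?e x * u0 x) \<eta>"
        unfolding g_def
        by (intro L2_inner_add_left L2_test_mult[OF a] L2_test_mult[OF a'm] u0 u1 L2_test_function[OF \<eta>])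
      then show ?thesis by (simp add: L2_inner_def ac_simps)
    qed
    ultimately have "L2_inner M h (dir_deriv \<eta> ?e) = - L2_inner M g \<eta>" by simp
    then show ?thesis
      using dm \<eta>b by (simp add: lb hb gb)
  qed
  have lc: "L2_converges lborel \<eta> f" if "\<And>n. \<eta> n \<in> test_functions \<Omega>" "L2_converges M \<eta> f"
    "f \<in> borel_measurable borel" "\<And>x. x \<notin> \<Omega> \<Longrightarrow> f x = 0" for \<eta> f
  proof -
    have m: "\<eta> n \<in> borel_measurable borel" and z: "x \<notin> \<Omega> \<Longrightarrow> \<eta> n x = 0" for n x
      using that(1) by (auto intro: smooth_borel_measurable test_functions_smooth test_functions_outside)
    have "L2_norm M (\<lambda>x. \<eta> n x - f x) = L2_norm lborel (\<lambda>x. \<eta> n x - f x)" for n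
      by (rule L2_norm_lebesgue_on_borel) (use m z that(3,4) in auto)
    moreover have "\<eta> n \<in> L2 lborel" for n
      using L2_lebesgue_on_borel[OF domain_borel m z] L2_test_function[OF that(1)] by blast
    moreover have "f \<in> L2 lborel"
      using L2_lebesgue_on_borel[OF domain_borel that(3,4)] that(2) by (simp add: L2_converges_iff)
    ultimately show ?thesis using that(2) by (simp add: L2_converges_iff)
  qed
  obtain \<eta> where \<eta>: "\<And>n. \<eta> n \<in> test_functions \<Omega>" "L2_converges M \<eta> v0"
    using test_functions_dense[OF v0(4)] by blast
  have \<eta>': "\<eta> n \<in> test_functions UNIV" for n using \<eta>(1) test_functions_mono by blast
  have A: "((\<lambda>s. LINT x|lborel. h x * v0 (x + s *\<^sub>R ?e)) has_real_derivative
    - (LINT x|lborel. g x * v0 (x + 0 *\<^sub>R ?e))) (at 0)"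
    by (rule weak_derivative_translate[OF hL hi gL axis_Basis wh \<eta>' lc[OF \<eta> v0(1,2)]])
  obtain \<zeta> where \<zeta>: "\<And>n. \<zeta> n \<in> test_functions \<Omega>" "L2_converges M \<zeta> u0"
    using test_functions_dense[OF u0(4)] by blast
  \<comment> \<open>In the first computation v was approximated by test functions and the derivative
    fell on h; now h is approximated, and the derivative falls on v.\<close>
  have B: "((\<lambda>s. LINT x|lborel. h x * v0 (x + s *\<^sub>R ?e)) has_real_derivative
    (LINT x|lborel. h x * v1 x)) (at 0)"
  proof (rule weak_derivative_translate_compact[OF v0(5,6) v1(5) axis_Basis _ open_domain K(1,2)])
    show "(LINT x|lborel. v0 x * dir_deriv \<eta> ?e x) = - (LINT x|lborel. v1 x * \<eta> x)"
      if \<eta>: "\<eta> \<in> test_functions \<Omega>" for \<eta>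
    proof -
      have "L2_inner M v0 (dir_deriv \<eta> ?e) = - L2_inner M v1 \<eta>"
        using has_weak_partialD(3)[OF v \<eta>] L2_test_function[OF \<eta>] L2_test_function[OF test_functions_dir_deriv[OF \<eta>]]
          cong[OF v0(3) has_weak_partialD(1)[OF v] v0(4)] cong[OF v1(3) has_weak_partialD(2)[OF v] v1(4)] by simp
      then show ?thesis
        using v0 v1 smooth_borel_measurable[OF test_functions_smooth[OF \<eta>]]
          smooth_borel_measurable[OF test_functions_smooth[OF test_functions_dir_deriv[OF \<eta> axis_Basis]]]
        by (simp add: lb)
    qed
    show "(\<lambda>x. a x * \<zeta> n x) \<in> test_functions \<Omega>" for n
      by (intro test_functions_mult a test_functions_smooth[OF \<zeta>(1)])
    show "a x * \<zeta> n x = 0" if "x \<notin> K" for n x using K(3)[OF that] by simp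
    show "L2_converges lborel (\<lambda>n x. a x * \<zeta> n x) h"
      unfolding h_def by (rule L2_converges_bounded_mult[OF lc[OF \<zeta> u0(1,2)] _ C]) (use ab in auto)
  qed
  have eq: "L2_inner M h v1 = - L2_inner M g v0"
    using DERIV_unique[OF A B] v0(1) v1(1) by (simp add: lb hb gb)
  have L: "(\<lambda>x. a x * u x) \<in> L2 M" "(\<lambda>x. a x * u' x + dir_deriv a ?e x * u x) \<in> L2 M"
    "h \<in> L2 M" "g \<in> L2 M"
    unfolding h_def[abs_def] g_def[abs_def]
    by (intro L2_add L2_test_mult[OF a] L2_test_mult[OF a'm] has_weak_partialD(1,2)[OF u] u0(4) u1(4))+
  have "L2_inner M (\<lambda>x. a x * u x) v' = L2_inner M h v'"
    using u0(3) by (intro cong L has_weak_partialD(2)[OF v]) (auto simp: h_def elim: eventually_mono)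
  also have "\<dots> = L2_inner M h v1"
    using cong[OF v1(3) has_weak_partialD(2)[OF v] v1(4) L(3)] by (simp add: L2_inner_commute)
  also have "\<dots> = - L2_inner M g v"
    using eq cong[OF v0(3) has_weak_partialD(1)[OF v] v0(4) L(4)] by (simp add: L2_inner_commute)
  also have "L2_inner M g v = L2_inner M (\<lambda>x. a x * u' x + dir_deriv a ?e x * u x) v"
    using u0(3) u1(3) by (intro cong[symmetric] L has_weak_partialD(1)[OF v])
      (auto simp: g_def elim: eventually_elim2)
  finally show ?thesis .
qed

end

section \<open>The Dirichlet eigenbasis\<close>

text \<open>The epsilon form of being an L^2 limit of test functions passes through sums and limits
  without diagonal sequences; \<open>approximable_test_sequence\<close> returns to sequences at the
  end.\<close>

definition approximable :: "(real^2) set \<Rightarrow> (real^2 \<Rightarrow> real) \<Rightarrow> bool" where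
  "approximable \<Omega> f \<longleftrightarrow> f \<in> L2 (lebesgue_on \<Omega>) \<and>
     (\<forall>e>0. \<exists>\<eta>\<in>test_functions \<Omega>. \<eta> \<in> L2 (lebesgue_on \<Omega>) \<and> L2_norm (lebesgue_on \<Omega>) (\<lambda>x. \<eta> x - f x) < e)"

lemma approximable_add:
  assumes f: "approximable \<Omega> f" and g: "approximable \<Omega> g"
  shows "approximable \<Omega> (\<lambda>x. f x + g x)"
  unfolding approximable_def
proof (intro conjI allI impI)
  let ?M = "lebesgue_on \<Omega>"
  have fL: "f \<in> L2 ?M" and gL: "g \<in> L2 ?M" using f g by (auto simp: approximable_def)
  then show "(\<lambda>x. f x + g x) \<in> L2 ?M" by (rule L2_add)
  fix e :: real assume e: "e > 0"
  obtain \<eta> where \<eta>: "\<eta> \<in> test_functions \<Omega>" "\<eta> \<in> L2 ?M" "L2_norm ?M (\<lambda>x. \<eta> x - f x) < e / 2"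
    using f e unfolding approximable_def by (meson half_gt_zero)
  obtain \<zeta> where \<zeta>: "\<zeta> \<in> test_functions \<Omega>" "\<zeta> \<in> L2 ?M" "L2_norm ?M (\<lambda>x. \<zeta> x - g x) < e / 2"
    using g e unfolding approximable_def by (meson half_gt_zero)
  have "L2_norm ?M (\<lambda>x. (\<eta> x + \<zeta> x) - (f x + g x)) < e"
    using L2_norm_triangle[OF L2_diff[OF \<eta>(2) fL] L2_diff[OF \<zeta>(2) gL]] \<eta>(3) \<zeta>(3)
    by (simp add: algebra_simps)
  then show "\<exists>\<eta>\<in>test_functions \<Omega>. \<eta> \<in> L2 ?M \<and> L2_norm ?M (\<lambda>x. \<eta> x - (f x + g x)) < e"
    using \<eta> \<zeta> by (intro bexI[of _ "\<lambda>x. \<eta> x + \<zeta> x"]) (auto intro: L2_add test_functions_add)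
qed

lemma approximable_cmult:
  assumes f: "approximable \<Omega> f"
  shows "approximable \<Omega> (\<lambda>x. c * f x)"
  unfolding approximable_def
proof (intro conjI allI impI)
  let ?M = "lebesgue_on \<Omega>"
  have fL: "f \<in> L2 ?M" using f by (auto simp: approximable_def)
  then show "(\<lambda>x. c * f x) \<in> L2 ?M" by (rule L2_cmult)
  fix e :: real assume e: "e > 0"
  have "e / (\<bar>c\<bar> + 1) > 0" using e by simp
  then obtain \<eta> where \<eta>: "\<eta> \<in> test_functions \<Omega>" "\<eta> \<in> L2 ?M" "L2_norm ?M (\<lambda>x. \<eta> x - f x) < e / (\<bar>c\<bar> + 1)"
    using f unfolding approximable_def by blast
  have "\<bar>c\<bar> * L2_norm ?M (\<lambda>x. \<eta> x - f x) \<le> (\<bar>c\<bar> + 1) * L2_norm ?M (\<lambda>x. \<eta> x - f x)"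
    by (intro mult_right_mono) auto
  also have "\<dots> < e" using \<eta>(3) by (simp add: pos_less_divide_eq mult.commute)
  finally have "L2_norm ?M (\<lambda>x. c * \<eta> x - c * f x) < e"
    using L2_norm_cmult[of ?M c "\<lambda>x. \<eta> x - f x"] by (simp add: right_diff_distrib)
  then show "\<exists>\<eta>\<in>test_functions \<Omega>. \<eta> \<in> L2 ?M \<and> L2_norm ?M (\<lambda>x. \<eta> x - c * f x) < e"
    using \<eta> test_functions_mult[OF \<eta>(1) smooth_const[of c]]
    by (intro bexI[of _ "\<lambda>x. c * \<eta> x"]) (auto intro: L2_cmult simp: mult.commute)
qed

lemma approximable_limit:
  assumes f: "\<And>n. approximable \<Omega> (f n)" and c: "L2_converges (lebesgue_on \<Omega>) f g"
  shows "approximable \<Omega> g"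
  unfolding approximable_def
proof (intro conjI allI impI)
  let ?M = "lebesgue_on \<Omega>"
  have fL: "f n \<in> L2 ?M" for n using f by (auto simp: approximable_def)
  show gL: "g \<in> L2 ?M" using c by (simp add: L2_converges_iff)
  fix e :: real assume e: "e > 0"
  have "eventually (\<lambda>n. L2_norm ?M (\<lambda>x. f n x - g x) < e / 2) sequentially"
    using c e unfolding L2_converges_iff by (intro order_tendstoD) auto
  then obtain n where n: "L2_norm ?M (\<lambda>x. f n x - g x) < e / 2"
    by (auto simp: eventually_sequentially)
  obtain \<eta> where \<eta>: "\<eta> \<in> test_functions \<Omega>" "\<eta> \<in> L2 ?M" "L2_norm ?M (\<lambda>x. \<eta> x - f n x) < e / 2"
    using f[of n] e unfolding approximable_def by (meson half_gt_zero)
  then show "\<exists>\<eta>\<in>test_functions \<Omega>. \<eta> \<in> L2 ?M \<and> L2_norm ?M (\<lambda>x. \<eta> x - g x) < e"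
    using n L2_norm_triangle_sub[OF \<eta>(2) fL gL, of n] by (intro bexI[of _ \<eta>]) auto
qed

lemma approximable_test_sequence:
  assumes "approximable \<Omega> f"
  shows "\<exists>\<eta>. (\<forall>n. \<eta> n \<in> test_functions \<Omega>) \<and> L2_converges (lebesgue_on \<Omega>) \<eta> f"
proof -
  let ?M = "lebesgue_on \<Omega>"
  have "\<forall>n. \<exists>\<eta>. \<eta> \<in> test_functions \<Omega> \<and> \<eta> \<in> L2 ?M \<and> L2_norm ?M (\<lambda>x. \<eta> x - f x) < 1 / real (Suc n)"
    using assms unfolding approximable_def by (auto simp: Bex_def)
  then obtain \<eta> where \<eta>: "\<And>n. \<eta> n \<in> test_functions \<Omega>" "\<And>n. \<eta> n \<in> L2 ?M"
    "\<And>n. L2_norm ?M (\<lambda>x. \<eta> n x - f x) < 1 / real (Suc n)" by metis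
  have "\<forall>n. norm (L2_norm ?M (\<lambda>x. \<eta> n x - f x)) \<le> 1 / real (Suc n)"
    using \<eta>(3) by (auto intro: less_imp_le)
  from Lim_null_comparison[OF always_eventually[OF this] LIMSEQ_Suc[OF lim_1_over_n]]
  show ?thesis using \<eta> assms by (auto simp: L2_converges_iff approximable_def)
qed

locale dirichlet_domain =
  fixes \<Omega> :: "(real^2) set" and w :: "nat \<Rightarrow> real^2 \<Rightarrow> real" and \<mu> :: "nat \<Rightarrow> real"
  assumes open_dom: "open \<Omega>" and bounded_dom: "bounded \<Omega>"
    and eigenbasis: "dirichlet_eigenbasis \<Omega> w \<mu>"
begin

lemma eigenfunction_L2: "w j \<in> L2 (lebesgue_on \<Omega>)"
  and orthonormal: "L2_inner (lebesgue_on \<Omega>) (w i) (w j) = (if i = j then 1 else 0)"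
  and basis_expansion: "f \<in> L2 (lebesgue_on \<Omega>) \<Longrightarrow>
    L2_converges (lebesgue_on \<Omega>) (\<lambda>n x. \<Sum>j<n. L2_inner (lebesgue_on \<Omega>) f (w j) * w j x) f"
  and eigenfunction_Sobolev: "w j \<in> Sobolev 2 \<Omega>" "w j \<in> Sobolev1_0 \<Omega>"
  and eigenfunction_eq: "AE x in lebesgue_on \<Omega>. - weak_laplacian \<Omega> (w j) x = \<mu> j * w j x"
  and eigenvalue_mono: "mono \<mu>" and eigenvalue_limit: "filterlim \<mu> at_top sequentially"
  using eigenbasis unfolding dirichlet_eigenbasis_def orthonormal_basis_L2_def by blast+

lemma eigenvalue_pos: "\<mu> j > 0"
  using eigenbasis monoD[OF eigenvalue_mono, of 0 j] unfolding dirichlet_eigenbasis_def by auto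

lemma eigenfunction_approx:
  obtains \<eta> where "\<And>n::nat. \<eta> n \<in> test_functions \<Omega>" "L2_converges (lebesgue_on \<Omega>) \<eta> (w j)"
    "\<And>i. L2_converges (lebesgue_on \<Omega>) (\<lambda>n. dir_deriv (\<eta> n) (axis i 1)) (weak_partial \<Omega> i (w j))"
  using eigenfunction_Sobolev(2)[of j] unfolding Sobolev1_0_def by blast

lemma approximable_eigenfunction: "approximable \<Omega> (w j)"
proof -
  obtain \<eta> where \<eta>: "\<And>n::nat. \<eta> n \<in> test_functions \<Omega>" "L2_converges (lebesgue_on \<Omega>) \<eta> (w j)"
    using eigenfunction_approx by blast
  have "approximable \<Omega> (\<eta> n)" for n
    using \<eta> unfolding approximable_def L2_converges_iff
    by (auto intro!: bexI[of _ "\<eta> n"] simp: L2_norm_def)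
  then show ?thesis using approximable_limit \<eta>(2) by blast
qed

text \<open>Each eigenfunction lies in H^1_0, so every partial sum of an eigenfunction expansion is
  a limit of test functions; the expansion of f converges to f, which gives the density.\<close>

sublocale planar_domain
proof
  show "\<exists>\<eta>. (\<forall>n. \<eta> n \<in> test_functions \<Omega>) \<and> L2_converges (lebesgue_on \<Omega>) \<eta> f"
    if f: "f \<in> L2 (lebesgue_on \<Omega>)" for f
  proof -
    have "approximable \<Omega> (\<lambda>x. \<Sum>j<n. L2_inner (lebesgue_on \<Omega>) f (w j) * w j x)" for n
    proof (induction n)
      case 0
      then show ?case
        by (auto simp: approximable_def L2_zero L2_norm_def intro!: bexI[of _ "\<lambda>x. 0"] test_functions_zero)
    next
      case (Suc n)
      then show ?case by (simp add: approximable_add approximable_cmult approximable_eigenfunction)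
    qed
    from approximable_limit[OF this basis_expansion[OF f]] show ?thesis
      by (rule approximable_test_sequence)
  qed
qed (use open_dom bounded_dom in auto)

section \<open>Weak gradients and second derivatives of the eigenfunctions\<close>

definition G :: "2 \<Rightarrow> nat \<Rightarrow> real^2 \<Rightarrow> real" where
  "G i j = weak_partial \<Omega> i (w j)"

lemma weak_partial_works: "has_weak_partial \<Omega> i f g \<Longrightarrow> has_weak_partial \<Omega> i f (weak_partial \<Omega> i f)"
  unfolding weak_partial_def by (rule someI[of "has_weak_partial \<Omega> i f"])

lemma has_weak_partial_G: "has_weak_partial \<Omega> i (w j) (G i j)"
proof -
  have "w j \<in> Sobolev (Suc (Suc 0)) \<Omega>"
    using eigenfunction_Sobolev(1) by (simp add: numeral_2_eq_2)
  then obtain g where "has_weak_partial \<Omega> i (w j) g" by auto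
  then show ?thesis unfolding G_def by (rule weak_partial_works)
qed

lemma G_L2: "G i j \<in> L2 M"
  using has_weak_partialD(2)[OF has_weak_partial_G] .

text \<open>Membership in H^2 provides some weak partial g that is itself weakly differentiable, not
  necessarily the one chosen in \<open>G\<close>. Both have the same pairings with derivatives of
  test functions, hence a weak derivative of g is also one of \<open>G i j\<close>.\<close>

lemma has_weak_partial_G2: "has_weak_partial \<Omega> k (G i j) (weak_partial \<Omega> k (G i j))"
proof -
  have "w j \<in> Sobolev (Suc (Suc 0)) \<Omega>"
    using eigenfunction_Sobolev(1) by (simp add: numeral_2_eq_2)
  then obtain g where g: "g \<in> Sobolev (Suc 0) \<Omega>" "has_weak_partial \<Omega> i (w j) g"
    by (subst (asm) Sobolev.simps) blast
  from g(1) obtain g' where g': "has_weak_partial \<Omega> k g g'"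
    by (subst (asm) Sobolev.simps) blast
  note g = g(2)
  have "has_weak_partial \<Omega> k (G i j) g'"
  proof (rule has_weak_partialI[OF G_L2 has_weak_partialD(2)[OF g']])
    fix \<eta> assume \<eta>: "\<eta> \<in> test_functions \<Omega>"
    have d: "dir_deriv \<eta> (axis k 1) \<in> test_functions \<Omega>"
      by (rule test_functions_dir_deriv[OF \<eta> axis_Basis])
    show "L2_inner M (G i j) (dir_deriv \<eta> (axis k 1)) = - L2_inner M g' \<eta>"
      using has_weak_partialD(3)[OF g d] has_weak_partialD(3)[OF has_weak_partial_G[of i j] d]
        has_weak_partialD(3)[OF g' \<eta>] by simp
  qed
  then show ?thesis by (rule weak_partial_works)
qed

definition GG :: "2 \<Rightarrow> 2 \<Rightarrow> nat \<Rightarrow> real^2 \<Rightarrow> real" where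
  "GG k i j = weak_partial \<Omega> k (G i j)"

lemma has_weak_partial_GG: "has_weak_partial \<Omega> k (G i j) (GG k i j)"
  unfolding GG_def by (rule has_weak_partial_G2)

lemma GG_L2: "GG k i j \<in> L2 M"
  using has_weak_partialD(2)[OF has_weak_partial_GG] .

text \<open>Symmetry of second weak derivatives, inherited from the test function: its mixed
  derivatives commute, and in either order they can be moved onto \<open>w j\<close>.\<close>

lemma has_weak_partial_GG': "has_weak_partial \<Omega> k (G i j) (GG i k j)"
proof (rule has_weak_partialI[OF G_L2 GG_L2])
  fix \<eta> assume \<eta>: "\<eta> \<in> test_functions \<Omega>"
  let ?d = "\<lambda>i \<eta>. dir_deriv \<eta> (axis i (1::real))"
  have d: "?d k \<eta> \<in> test_functions \<Omega>" "?d i \<eta> \<in> test_functions \<Omega>"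
    by (auto intro: test_functions_dir_deriv[OF \<eta>])
  have "?d i (?d k \<eta>) = ?d k (?d i \<eta>)"
    using smooth_dir_deriv_commute[OF test_functions_smooth[OF \<eta>] axis_Basis axis_Basis] by blast
  then show "L2_inner M (G i j) (?d k \<eta>) = - L2_inner M (GG i k j) \<eta>"
    using has_weak_partialD(3)[OF has_weak_partial_G[of i j] d(1)]
      has_weak_partialD(3)[OF has_weak_partial_G[of k j] d(2)]
      has_weak_partialD(3)[OF has_weak_partial_GG[of i k j] \<eta>] by simp
qed

lemma eigen_weak: "g \<in> L2 M \<Longrightarrow> \<mu> j * L2_inner M (w j) g = - (L2_inner M (GG 1 1 j) g + L2_inner M (GG 2 2 j) g)"
proof -
  assume g: "g \<in> L2 M"
  have "L2_inner M (\<lambda>x. \<mu> j * w j x) g = L2_inner M (\<lambda>x. - (GG 1 1 j x + GG 2 2 j x)) g"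
  proof (rule L2_inner_AE_cong)
    show "AE x in M. \<mu> j * w j x = - (GG 1 1 j x + GG 2 2 j x)"
      using eigenfunction_eq[of j]
      by (auto simp: weak_laplacian_def G_def GG_def sum_2 elim: eventually_mono)
  qed (intro L2_measurable L2_cmult L2_uminus L2_add eigenfunction_L2 GG_L2 g)+
  then show ?thesis
    by (simp only: L2_inner_cmult_left L2_inner_uminus_left L2_inner_add_left[OF GG_L2 GG_L2 g])
qed

text \<open>Green's formula for \<open>w j\<close> against \<open>w k\<close>. There is no boundary
  term because \<open>w k\<close> is a limit of test functions together with its gradient, which is
  where H^1_0 enters.\<close>

lemma G_orthogonal:
  "L2_inner M (G 1 j) (G 1 k) + L2_inner M (G 2 j) (G 2 k) = (if j = k then \<mu> j else 0)"
proof -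
  obtain \<eta> where \<eta>: "\<And>n::nat. \<eta> n \<in> test_functions \<Omega>" "L2_converges M \<eta> (w k)"
    "\<And>i. L2_converges M (\<lambda>n. dir_deriv (\<eta> n) (axis i 1)) (G i k)"
    using eigenfunction_approx[of k] unfolding G_def by blast
  have "(\<lambda>n. L2_inner M (G 1 j) (dir_deriv (\<eta> n) (axis 1 1)) + L2_inner M (G 2 j) (dir_deriv (\<eta> n) (axis 2 1)))
    \<longlonglongrightarrow> L2_inner M (G 1 j) (G 1 k) + L2_inner M (G 2 j) (G 2 k)"
    by (intro tendsto_add L2_converges_inner L2_converges_const G_L2 \<eta>)
  moreover have "L2_inner M (G 1 j) (dir_deriv (\<eta> n) (axis 1 1)) + L2_inner M (G 2 j) (dir_deriv (\<eta> n) (axis 2 1))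
    = \<mu> j * L2_inner M (w j) (\<eta> n)" for n
    using has_weak_partialD(3)[OF has_weak_partial_GG \<eta>(1)] eigen_weak[OF L2_test_function[OF \<eta>(1)]]
    by simp
  moreover have "(\<lambda>n. \<mu> j * L2_inner M (w j) (\<eta> n)) \<longlonglongrightarrow> \<mu> j * L2_inner M (w j) (w k)"
    by (intro tendsto_mult_left L2_converges_inner L2_converges_const eigenfunction_L2 \<eta>)
  ultimately have "L2_inner M (G 1 j) (G 1 k) + L2_inner M (G 2 j) (G 2 k) = \<mu> j * L2_inner M (w j) (w k)"
    using LIMSEQ_unique by simp
  then show ?thesis by (simp add: orthonormal)
qed

text \<open>The transport operator \<open>\<nabla>\<phi> \<cdot> \<nabla>\<^sup>\<bottom>\<close>, applied to a pair of weak partial derivatives.\<close>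

definition tr :: "(real^2 \<Rightarrow> real) \<Rightarrow> (real^2 \<Rightarrow> real) \<Rightarrow> (real^2 \<Rightarrow> real) \<Rightarrow> real^2 \<Rightarrow> real" where
  "tr \<phi> f1 f2 = (\<lambda>x. dir_deriv \<phi> (axis 2 1) x * f1 x - dir_deriv \<phi> (axis 1 1) x * f2 x)"

lemma tr_L2:
  assumes "\<phi> \<in> test_functions S" "f1 \<in> L2 M" "f2 \<in> L2 M"
  shows "tr \<phi> f1 f2 \<in> L2 M"
  unfolding tr_def using assms
  by (intro L2_diff L2_test_mult[OF test_functions_dir_deriv[OF assms(1)]]) auto

lemma tr_inner:
  assumes \<phi>: "\<phi> \<in> test_functions \<Omega>" and L: "f1 \<in> L2 M" "f2 \<in> L2 M" "g \<in> L2 M"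
  shows "L2_inner M g (tr \<phi> f1 f2) = L2_inner M (\<lambda>x. dir_deriv \<phi> (axis 2 1) x * f1 x) g
    - L2_inner M (\<lambda>x. dir_deriv \<phi> (axis 1 1) x * f2 x) g"
  unfolding tr_def using L test_functions_dir_deriv[OF \<phi> axis_Basis]
  by (subst L2_inner_diff_right) (auto simp: L2_inner_commute[of M g] intro: L2_test_mult)

text \<open>The field (\<partial>_2 \<phi>, -\<partial>_1 \<phi>) is divergence free: in the two
  integrations by parts the terms with a second derivative of \<phi> carry \<partial>_1 \<partial>_2
  \<phi> and \<partial>_2 \<partial>_1 \<phi>, and they cancel.\<close>

lemma tr_antisymmetric:
  assumes \<phi>: "\<phi> \<in> test_functions \<Omega>"
    and u: "has_weak_partial \<Omega> 1 u u1" "has_weak_partial \<Omega> 2 u u2"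
    and v: "has_weak_partial \<Omega> 1 v v1" "has_weak_partial \<Omega> 2 v v2"
  shows "L2_inner M u (tr \<phi> v1 v2) = - L2_inner M v (tr \<phi> u1 u2)"
proof -
  let ?d = "\<lambda>i \<eta>. dir_deriv \<eta> (axis (i::2) (1::real))"
  have d: "?d i \<phi> \<in> test_functions \<Omega>" for i by (rule test_functions_dir_deriv[OF \<phi> axis_Basis])
  have dd: "?d i (?d k \<phi>) \<in> test_functions \<Omega>" for i k by (rule test_functions_dir_deriv[OF d axis_Basis])
  have com: "?d 1 (?d 2 \<phi>) = ?d 2 (?d 1 \<phi>)"
    using smooth_dir_deriv_commute[OF test_functions_smooth[OF \<phi>] axis_Basis axis_Basis] by blast
  note L = has_weak_partialD(1,2)[OF u(1)] has_weak_partialD(2)[OF u(2)]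
    has_weak_partialD(1,2)[OF v(1)] has_weak_partialD(2)[OF v(2)]
  have 1: "L2_inner M (\<lambda>x. ?d 2 \<phi> x * u x) v1
      = - (L2_inner M (\<lambda>x. ?d 2 \<phi> x * u1 x) v + L2_inner M (\<lambda>x. ?d 1 (?d 2 \<phi>) x * u x) v)"
    using weak_product_rule[OF u(1) v(1) d[of 2]] L2_inner_add_left[OF L2_test_mult[OF d L(2)] L2_test_mult[OF dd L(1)] L(4)] by simp
  have 2: "L2_inner M (\<lambda>x. ?d 1 \<phi> x * u x) v2
      = - (L2_inner M (\<lambda>x. ?d 1 \<phi> x * u2 x) v + L2_inner M (\<lambda>x. ?d 2 (?d 1 \<phi>) x * u x) v)"
    using weak_product_rule[OF u(2) v(2) d[of 1]] L2_inner_add_left[OF L2_test_mult[OF d L(3)] L2_test_mult[OF dd L(1)] L(4)] by simp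
  have "L2_inner M u (tr \<phi> v1 v2) = L2_inner M (\<lambda>x. ?d 2 \<phi> x * u x) v1 - L2_inner M (\<lambda>x. ?d 1 \<phi> x * u x) v2"
    using tr_inner[OF \<phi> L(5,6,1)] by (simp add: L2_inner_def ac_simps)
  also have "\<dots> = - L2_inner M v (tr \<phi> u1 u2)"
    unfolding 1 2 tr_inner[OF \<phi> L(2,3,4)] com by simp
  finally show ?thesis .
qed

section \<open>The commutator of the Laplacian with transport\<close>

definition Dmat :: "(real^2 \<Rightarrow> real) \<Rightarrow> nat \<Rightarrow> nat \<Rightarrow> real" where
  "Dmat \<phi> j k = L2_inner M (w j) (tr \<phi> (G 1 k) (G 2 k))"

text \<open>
  The matrix of the commutator of \<open>-\<Delta>\<close> with the transport operator, as a form on gradients: the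
  second derivatives fall on \<open>\<phi>\<close>, since the terms with second derivatives of the eigenfunctions
  cancel by antisymmetry.
\<close>

definition Smat :: "(real^2 \<Rightarrow> real) \<Rightarrow> nat \<Rightarrow> nat \<Rightarrow> real" where
  "Smat \<phi> j k = (\<Sum>i\<in>UNIV. L2_inner M (G i j) (tr (dir_deriv \<phi> (axis i 1)) (G 1 k) (G 2 k)))"

lemma Dmat_antisymmetric: "\<phi> \<in> test_functions \<Omega> \<Longrightarrow> Dmat \<phi> j k = - Dmat \<phi> k j"
  unfolding Dmat_def by (rule tr_antisymmetric) (auto intro: has_weak_partial_G)

lemma Dmat_Smat:
  assumes \<phi>: "\<phi> \<in> test_functions \<Omega>"
  shows "\<mu> j * Dmat \<phi> j k + \<mu> k * Dmat \<phi> k j = Smat \<phi> j k + Smat \<phi> k j"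
proof -
  let ?d = "\<lambda>i \<eta>. dir_deriv \<eta> (axis (i::2) (1::real))"
  \<comment> \<open>The transport form evaluated on the i-th partials of \<open>w j\<close> and
    \<open>w k\<close>; these partials are again weakly differentiable, so antisymmetry applies to
    them.\<close>
  define R where "R i j k = L2_inner M (G i j) (tr \<phi> (GG 1 i k) (GG 2 i k))" for i j k
  have d: "?d i \<phi> \<in> test_functions \<Omega>" for i by (rule test_functions_dir_deriv[OF \<phi> axis_Basis])
  have dd: "?d i (?d k \<phi>) \<in> test_functions \<Omega>" for i k by (rule test_functions_dir_deriv[OF d axis_Basis])
  have com: "?d i (?d k \<phi>) = ?d k (?d i \<phi>)" for i k
    using smooth_dir_deriv_commute[OF test_functions_smooth[OF \<phi>] axis_Basis axis_Basis] by blast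
  have R_anti: "R i j k = - R i k j" for i j k
    unfolding R_def by (rule tr_antisymmetric[OF \<phi>]) (rule has_weak_partial_GG)+
  \<comment> \<open>Antisymmetry uses the derivatives of \<open>G i k\<close> in the two directions
    of \<open>tr\<close>, integration by parts produces the i-th derivatives of \<open>G 1 k\<close>
    and \<open>G 2 k\<close>. They agree almost everywhere, being weak derivatives of the same
    function.\<close>
  have R_alt: "R i j k = L2_inner M (G i j) (tr \<phi> (GG i 1 k) (GG i 2 k))" for i j k
  proof -
    have "AE x in M. GG k i l x = GG i k l x" for k l
    proof -
      have "L2_inner M (\<lambda>x. GG k i l x - GG i k l x) \<eta> = 0" if \<eta>: "\<eta> \<in> test_functions \<Omega>" for \<eta>
        using has_weak_partialD(3)[OF has_weak_partial_GG[of k i l] \<eta>]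
          has_weak_partialD(3)[OF has_weak_partial_GG'[of k i l] \<eta>]
        by (simp add: L2_inner_diff_left GG_L2 L2_test_function[OF \<eta>])
      from L2_zero_from_test(2)[OF L2_diff[OF GG_L2 GG_L2] this] show ?thesis by simp
    qed
    from this[of 1 k] this[of 2 k]
    have "AE x in M. tr \<phi> (GG 1 i k) (GG 2 i k) x = tr \<phi> (GG i 1 k) (GG i 2 k) x"
      by eventually_elim (simp add: tr_def)
    then show ?thesis unfolding R_def L2_inner_commute[of M "G i j"]
      by (intro L2_inner_AE_cong L2_measurable tr_L2[OF \<phi>] GG_L2 G_L2)
  qed
  \<comment> \<open>The eigenvalue is traded for the Laplacian on \<open>w j\<close>, and one
    derivative is moved across \<open>tr\<close>: falling on \<phi> it gives \<open>Smat\<close>,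
    falling on the gradient of \<open>w k\<close> it gives R.\<close>
  have main: "\<mu> j * Dmat \<phi> j k = Smat \<phi> j k + (R 1 j k + R 2 j k)" for j k
  proof -
    have 1: "- L2_inner M (GG i i j) (tr \<phi> (G 1 k) (G 2 k))
        = L2_inner M (G i j) (tr (?d i \<phi>) (G 1 k) (G 2 k)) + R i j k" for i
    proof -
      have p: "L2_inner M (\<lambda>x. ?d l \<phi> x * G m k x) (GG i i j)
         = - (L2_inner M (\<lambda>x. ?d l \<phi> x * GG i m k x) (G i j) + L2_inner M (\<lambda>x. ?d l (?d i \<phi>) x * G m k x) (G i j))" for l m
        using weak_product_rule[OF has_weak_partial_GG[of i m k] has_weak_partial_GG[of i i j] d[of l]]
          L2_inner_add_left[OF L2_test_mult[OF d[of l] GG_L2[of i m k]] L2_test_mult[OF dd[of l i] G_L2[of m k]] G_L2[of i j]]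
          com[of i l]
        by simp
      show ?thesis
        unfolding tr_inner[OF \<phi> G_L2 G_L2 GG_L2] tr_inner[OF d G_L2 G_L2 G_L2] R_alt
          tr_inner[OF \<phi> GG_L2 GG_L2 G_L2] p by simp
    qed
    have "\<mu> j * Dmat \<phi> j k = - (L2_inner M (GG 1 1 j) (tr \<phi> (G 1 k) (G 2 k)) + L2_inner M (GG 2 2 j) (tr \<phi> (G 1 k) (G 2 k)))"
      unfolding Dmat_def by (rule eigen_weak[OF tr_L2[OF \<phi> G_L2 G_L2]])
    then show ?thesis using 1[of 1] 1[of 2] by (simp add: Smat_def sum_2)
  qed
  show ?thesis using main[of j k] main[of k j] R_anti[of 1 j k] R_anti[of 2 j k] by simp
qed

end

section \<open>The commutator estimate\<close>

text \<open>Stands for the bound of |p(0)| by the integral of |p'| over s > 0: the function p(s) -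
  (B/l) exp(-s l) is nondecreasing and tends to 0, hence is at most 0 at s = 0; the same holds for
  -p.\<close>

lemma exponential_decay_bound:
  fixes p :: "real \<Rightarrow> real"
  assumes p: "\<And>s. s \<ge> 0 \<Longrightarrow> (p has_real_derivative p' s) (at s)"
    and b: "\<And>s. s \<ge> 0 \<Longrightarrow> \<bar>p' s\<bar> \<le> B * exp (- s * l)" and l: "l > 0"
    and lim: "(p \<longlongrightarrow> 0) at_top"
  shows "\<bar>p 0\<bar> \<le> B / l"
proof -
  have upper: "p 0 \<le> B / l"
    if p: "\<And>s. s \<ge> 0 \<Longrightarrow> (p has_real_derivative p' s) (at s)"
    and b: "\<And>s. s \<ge> 0 \<Longrightarrow> \<bar>p' s\<bar> \<le> B * exp (- s * l)" and lim: "(p \<longlongrightarrow> 0) at_top" for p p'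
  proof -
    define f where "f s = p s - B / l * exp (- s * l)" for s
    have f: "(f has_real_derivative p' s + B * exp (- s * l)) (at s)" if "s \<ge> 0" for s
      unfolding f_def using l by (auto intro!: derivative_eq_intros p[OF that] simp: field_simps)
    have mono: "f 0 \<le> f s" if "s \<ge> 0" for s
    proof (rule DERIV_nonneg_imp_nondecreasing[OF that])
      fix r assume "0 \<le> r" "r \<le> s"
      then show "\<exists>y. (f has_real_derivative y) (at r) \<and> 0 \<le> y"
        using f[of r] b[of r] by (intro exI[of _ "p' r + B * exp (- r * l)"]) auto
    qed
    have "filterlim (\<lambda>s. s * l) at_top at_top"
      using l by (intro filterlim_at_top_mult_tendsto_pos[OF tendsto_const _ filterlim_ident]) auto
    then have "((\<lambda>s. exp (- (s * l))) \<longlongrightarrow> 0) at_top"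
      using exp_at_bot filterlim_compose filterlim_uminus_at_top by blast
    then have "(f \<longlongrightarrow> 0 - B / l * 0) at_top"
      unfolding f_def by (intro tendsto_intros lim) simp
    then have "f 0 \<le> 0"
      using mono by (intro tendsto_lowerbound[of f 0 at_top])
        (auto intro: eventually_mono[OF eventually_ge_at_top[of 0]])
    then show ?thesis by (simp add: f_def)
  qed
  have "p 0 \<le> B / l" by (rule upper[OF p b lim])
  moreover have "- p 0 \<le> B / l"
    by (rule upper[of "\<lambda>s. - p s" "\<lambda>s. - p' s"])
      (use b in \<open>auto intro!: DERIV_minus p tendsto_minus_cancel_left[THEN iffD1] simp: lim\<close>)
  ultimately show ?thesis by linarith
qed

text \<open>A double sum over a square index set sees only the symmetric part of its terms.\<close>

lemma sum_symmetrize: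
  fixes A B :: "'a \<Rightarrow> 'a \<Rightarrow> real"
  assumes "\<And>j k. A j k + A k j = B j k + B k j"
  shows "(\<Sum>j\<in>I. \<Sum>k\<in>I. A j k) = (\<Sum>j\<in>I. \<Sum>k\<in>I. B j k)"
proof -
  have s: "2 * (\<Sum>j\<in>I. \<Sum>k\<in>I. A j k) = (\<Sum>j\<in>I. \<Sum>k\<in>I. A j k + A k j)" for A :: "'a \<Rightarrow> 'a \<Rightarrow> real"
    using sum.swap[of "\<lambda>j k. A j k" I I] by (simp add: sum.distrib)
  show ?thesis using s[of A] s[of B] assms by simp
qed

text \<open>The block estimate is an inequality, so that one criterion covers sums of orthonormal
  functions and also sums of single gradient components, whose norms are bounded by that of the full
  gradient.\<close>

lemma L2_series_converges:
  assumes v: "\<And>j. v j \<in> L2 M" and a: "summable a"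
    and le: "\<And>m n. m \<le> n \<Longrightarrow> (L2_norm M (\<lambda>x. \<Sum>j\<in>{m..<n}. v j x))\<^sup>2 \<le> (\<Sum>j\<in>{m..<n}. a j)"
  obtains g where "L2_converges M (\<lambda>n x. \<Sum>j<n. v j x) g"
proof (rule L2_complete[of "\<lambda>n x. \<Sum>j<n. v j x" M])
  show "(\<lambda>x. \<Sum>j<n. v j x) \<in> L2 M" for n by (rule L2_sum[OF v])
  fix e :: real assume e: "e > 0"
  then obtain N where N: "\<And>m n. m \<ge> N \<Longrightarrow> norm (\<Sum>j\<in>{m..<n}. a j) < e\<^sup>2"
    using a unfolding summable_Cauchy by (meson zero_less_power)
  have *: "L2_norm M (\<lambda>x. (\<Sum>j<n. v j x) - (\<Sum>j<m. v j x)) < e" if "N \<le> m" "m \<le> n" for m n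
  proof -
    have "(\<Sum>j<n. v j x) - (\<Sum>j<m. v j x) = (\<Sum>j\<in>{m..<n}. v j x)" for x
      using that sum_diff_nat_ivl[of 0 m n "\<lambda>j. v j x"] by (simp add: lessThan_atLeast0)
    then have "(L2_norm M (\<lambda>x. (\<Sum>j<n. v j x) - (\<Sum>j<m. v j x)))\<^sup>2 < e\<^sup>2"
      using le[OF that(2)] N[OF that(1), of n] by simp
    then show ?thesis by (rule power_less_imp_less_base) (use e in simp)
  qed
  have "L2_norm M (\<lambda>x. (\<Sum>j<m. v j x) - (\<Sum>j<n. v j x)) < e" if "N \<le> m" "N \<le> n" for m n
    using *[of m n] *[of n m] that L2_norm_minus_commute[of M "\<lambda>x. \<Sum>j<m. v j x" "\<lambda>x. \<Sum>j<n. v j x"]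
    by (cases "m \<le> n") auto
  then show "\<exists>N. \<forall>m\<ge>N. \<forall>n\<ge>N. L2_norm M (\<lambda>x. (\<Sum>j<m. v j x) - (\<Sum>j<n. v j x)) < e" by blast
qed

context dirichlet_domain
begin

section \<open>Energy identities for finite sums of eigenfunctions\<close>

definition lam :: "nat \<Rightarrow> real" where "lam j = sqrt (\<mu> j)"

lemma lam_pos: "lam j > 0" by (simp add: lam_def eigenvalue_pos)

lemma lam_sq: "lam j * lam j = \<mu> j"
  using eigenvalue_pos[of j] by (simp add: lam_def)

lemma lam_mono: "i \<le> j \<Longrightarrow> lam i \<le> lam j"
  using monoD[OF eigenvalue_mono] by (simp add: lam_def)

lemma lam_limit: "filterlim lam at_top sequentially"
  unfolding lam_def[abs_def] using filterlim_compose[OF sqrt_at_top eigenvalue_limit] .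

lemma powr_eigenvalue: "\<mu> j powr (-1/2) = 1 / lam j"
proof -
  have "(-1/2 :: real) = - (1/2)" by simp
  then show ?thesis
    unfolding lam_def powr_half_sqrt[OF less_imp_le[OF eigenvalue_pos], symmetric]
    by (metis powr_minus_divide)
qed

definition Gsum :: "nat set \<Rightarrow> 2 \<Rightarrow> (nat \<Rightarrow> real) \<Rightarrow> real^2 \<Rightarrow> real" where
  "Gsum A i x = (\<lambda>p. \<Sum>j\<in>A. x j * G i j p)"

lemma Gsum_L2: "Gsum A i x \<in> L2 M"
  unfolding Gsum_def by (intro L2_sum L2_cmult G_L2)

lemma Gsum_inner: "g \<in> L2 M \<Longrightarrow> L2_inner M (Gsum A i x) g = (\<Sum>j\<in>A. x j * L2_inner M (G i j) g)"
  unfolding Gsum_def by (subst L2_inner_sum_left) (auto intro: L2_cmult G_L2 simp: L2_inner_cmult_left)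

lemma Gsum_norm:
  assumes "finite A"
  shows "(L2_norm M (Gsum A 1 x))\<^sup>2 + (L2_norm M (Gsum A 2 x))\<^sup>2 = (\<Sum>j\<in>A. \<mu> j * (x j)\<^sup>2)"
proof -
  have 1: "(L2_norm M (Gsum A i x))\<^sup>2 = (\<Sum>j\<in>A. \<Sum>k\<in>A. x j * x k * L2_inner M (G i j) (G i k))" for i
    unfolding L2_norm_sq Gsum_inner[OF Gsum_L2]
    by (simp add: L2_inner_commute[of M "G i _" "Gsum _ _ _"] Gsum_inner[OF G_L2] sum_distrib_left mult.assoc
        L2_inner_commute[of M "G i _" "G i _"])
  have "(L2_norm M (Gsum A 1 x))\<^sup>2 + (L2_norm M (Gsum A 2 x))\<^sup>2
      = (\<Sum>j\<in>A. \<Sum>k\<in>A. x j * x k * (L2_inner M (G 1 j) (G 1 k) + L2_inner M (G 2 j) (G 2 k)))"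
    by (simp add: 1 sum.distrib[symmetric] distrib_left)
  also have "\<dots> = (\<Sum>j\<in>A. \<mu> j * (x j)\<^sup>2)"
    using assms by (simp add: G_orthogonal if_distrib[of "times _"] sum.delta power2_eq_square mult_ac cong: if_cong)
  finally show ?thesis .
qed

lemma Gsum_norm_le:
  assumes "finite A"
  shows "L2_norm M (Gsum A i x) \<le> sqrt (\<Sum>j\<in>A. \<mu> j * (x j)\<^sup>2)"
proof (rule real_le_rsqrt)
  have 1: "(L2_norm M (Gsum A 1 x))\<^sup>2 \<le> (\<Sum>j\<in>A. \<mu> j * (x j)\<^sup>2)"
    and 2: "(L2_norm M (Gsum A 2 x))\<^sup>2 \<le> (\<Sum>j\<in>A. \<mu> j * (x j)\<^sup>2)"
    using Gsum_norm[OF assms, of x] zero_le_power2[of "L2_norm M (Gsum A 1 x)"]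
      zero_le_power2[of "L2_norm M (Gsum A 2 x)"] by linarith+
  have "i = 1 \<or> i = 2" using exhaust_2 by blast
  then show "(L2_norm M (Gsum A i x))\<^sup>2 \<le> (\<Sum>j\<in>A. \<mu> j * (x j)\<^sup>2)"
    using 1 2 by metis
qed

lemma tr_norm:
  assumes \<phi>: "\<phi> \<in> test_functions S" and L: "f1 \<in> L2 M" "f2 \<in> L2 M"
    and C: "\<And>i x. \<bar>dir_deriv \<phi> (axis i 1) x\<bar> \<le> C"
  shows "L2_norm M (tr \<phi> f1 f2) \<le> C * (L2_norm M f1 + L2_norm M f2)"
proof -
  have C0: "0 \<le> C" using C[of 1 0] by linarith
  note d = test_function_measurable[OF test_functions_dir_deriv[OF \<phi> axis_Basis]]
  have "L2_norm M (tr \<phi> f1 f2) \<le> L2_norm M (\<lambda>x. dir_deriv \<phi> (axis 2 1) x * f1 x) + L2_norm M (\<lambda>x. - (dir_deriv \<phi> (axis 1 1) x * f2 x))"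
    using L2_norm_triangle[OF L2_test_mult[OF test_functions_dir_deriv[OF \<phi> axis_Basis] L(1)]
      L2_uminus[OF L2_test_mult[OF test_functions_dir_deriv[OF \<phi> axis_Basis] L(2)]], of 2 1]
    unfolding tr_def by simp
  also have "\<dots> \<le> C * L2_norm M f1 + C * L2_norm M f2"
    unfolding L2_norm_uminus by (intro add_mono L2_norm_bounded_mult L d C C0)
  finally show ?thesis by (simp add: distrib_left)
qed

lemma tr_Gsum:
  "tr \<phi> (Gsum A 1 y) (Gsum A 2 y) = (\<lambda>p. \<Sum>k\<in>A. y k * tr \<phi> (G 1 k) (G 2 k) p)"
  unfolding tr_def Gsum_def
  by (simp add: sum_distrib_left sum_subtractf[symmetric] right_diff_distrib mult_ac)

lemma Smat_sum:
  assumes \<phi>: "\<phi> \<in> test_functions \<Omega>"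
  shows "(\<Sum>j\<in>A. \<Sum>k\<in>A. x j * y k * Smat \<phi> j k)
    = (\<Sum>i\<in>UNIV. L2_inner M (Gsum A i x) (tr (dir_deriv \<phi> (axis i 1)) (Gsum A 1 y) (Gsum A 2 y)))"
proof -
  have d: "dir_deriv \<phi> (axis i 1) \<in> test_functions \<Omega>" for i
    by (rule test_functions_dir_deriv[OF \<phi> axis_Basis])
  have "L2_inner M (Gsum A i x) (tr (dir_deriv \<phi> (axis i 1)) (Gsum A 1 y) (Gsum A 2 y))
     = (\<Sum>j\<in>A. \<Sum>k\<in>A. x j * y k * L2_inner M (G i j) (tr (dir_deriv \<phi> (axis i 1)) (G 1 k) (G 2 k)))" for i
  proof -
    have "L2_inner M (Gsum A i x) (tr (dir_deriv \<phi> (axis i 1)) (Gsum A 1 y) (Gsum A 2 y))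
      = (\<Sum>j\<in>A. x j * L2_inner M (G i j) (tr (dir_deriv \<phi> (axis i 1)) (Gsum A 1 y) (Gsum A 2 y)))"
      by (rule Gsum_inner[OF tr_L2[OF d Gsum_L2 Gsum_L2]])
    also have "\<dots> = (\<Sum>j\<in>A. x j * (\<Sum>k\<in>A. y k * L2_inner M (G i j) (tr (dir_deriv \<phi> (axis i 1)) (G 1 k) (G 2 k))))"
      unfolding tr_Gsum
      by (subst L2_inner_sum_right) (auto intro: L2_cmult tr_L2[OF d] G_L2 simp: L2_inner_cmult_right)
    finally show ?thesis by (simp add: sum_distrib_left mult.assoc)
  qed
  then show ?thesis
    by (simp add: Smat_def sum_2 sum.distrib[symmetric] distrib_left)
qed

text \<open>Each of the two directions i contributes an inner product of one gradient component with
  \<open>tr\<close>, and \<open>tr\<close> has two terms with coefficient at most C; bounding every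
  component by the full energy gives the factor 2 * 2 = 4.\<close>

lemma Smat_bound:
  assumes \<phi>: "\<phi> \<in> test_functions \<Omega>" and A: "finite A"
    and C: "\<And>i k x. \<bar>dir_deriv (dir_deriv \<phi> (axis i 1)) (axis k 1) x\<bar> \<le> C"
  shows "\<bar>\<Sum>j\<in>A. \<Sum>k\<in>A. x j * y k * Smat \<phi> j k\<bar>
    \<le> 4 * C * sqrt (\<Sum>j\<in>A. \<mu> j * (x j)\<^sup>2) * sqrt (\<Sum>j\<in>A. \<mu> j * (y j)\<^sup>2)"
proof -
  let ?E = "\<lambda>x. sqrt (\<Sum>j\<in>A. \<mu> j * (x j)\<^sup>2)"
  have C0: "0 \<le> C" using C[of 1 1 0] by linarith
  have E0: "0 \<le> ?E x" for x by (intro real_sqrt_ge_zero sum_nonneg mult_nonneg_nonneg less_imp_le[OF eigenvalue_pos]) simp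
  have d: "dir_deriv \<phi> (axis i 1) \<in> test_functions \<Omega>" for i
    by (rule test_functions_dir_deriv[OF \<phi> axis_Basis])
  have 1: "\<bar>L2_inner M (Gsum A i x) (tr (dir_deriv \<phi> (axis i 1)) (Gsum A 1 y) (Gsum A 2 y))\<bar> \<le> ?E x * (C * (?E y + ?E y))" for i
  proof -
    have "L2_norm M (tr (dir_deriv \<phi> (axis i 1)) (Gsum A 1 y) (Gsum A 2 y)) \<le> C * (?E y + ?E y)"
      by (rule order_trans[OF tr_norm[OF d Gsum_L2 Gsum_L2 C]])
        (intro mult_left_mono add_mono Gsum_norm_le A C0)
    then show ?thesis
      by (intro order_trans[OF L2_Cauchy_Schwarz[OF Gsum_L2 tr_L2[OF d Gsum_L2 Gsum_L2]]] mult_mono Gsum_norm_le A E0) auto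
  qed
  have "\<bar>\<Sum>j\<in>A. \<Sum>k\<in>A. x j * y k * Smat \<phi> j k\<bar> \<le> ?E x * (C * (?E y + ?E y)) + ?E x * (C * (?E y + ?E y))"
    unfolding Smat_sum[OF \<phi>] sum_2 by (rule order_trans[OF abs_triangle_ineq]) (intro add_mono 1)
  then show ?thesis by (simp add: algebra_simps)
qed

text \<open>The nonlinear term on n modes: \<open>c j\<close> are the coefficients of \<theta>, and
  \<open>c k / lam k\<close> those of \<Lambda>^-1 \<theta>.\<close>

definition Qsum :: "(real^2 \<Rightarrow> real) \<Rightarrow> (nat \<Rightarrow> real) \<Rightarrow> nat \<Rightarrow> real" where
  "Qsum \<phi> c n = (\<Sum>j<n. \<Sum>k<n. c j * c k * (Dmat \<phi> j k / lam k))"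

lemma Qsum_truncate:
  assumes "N \<le> m"
  shows "Qsum \<phi> c N = Qsum \<phi> (\<lambda>j. if j < N then c j else 0) m"
proof -
  have "(\<Sum>k<m. (if j < N then c j else 0) * (if k < N then c k else 0) * (Dmat \<phi> j k / lam k))
    = (\<Sum>k<N. (if j < N then c j else 0) * c k * (Dmat \<phi> j k / lam k))" for j
    using assms by (intro sum.mono_neutral_cong_right) auto
  moreover have "(\<Sum>j<m. \<Sum>k<N. (if j < N then c j else 0) * c k * (Dmat \<phi> j k / lam k))
    = (\<Sum>j<N. \<Sum>k<N. c j * c k * (Dmat \<phi> j k / lam k))"
    using assms by (intro sum.mono_neutral_cong_right) auto
  ultimately show ?thesis by (simp add: Qsum_def)
qed

text \<open>Damping the coefficients by exp(-s lam j) brings down the factor lam j + lam k.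
  Symmetrization and antisymmetry of \<open>Dmat\<close> complete it to (lam j + lam k)(lam j - lam
  k) = \<mu> j - \<mu> k over lam j lam k, so that the commutator appears, as a form in the
  coefficients c j / lam j.\<close>

lemma Qsum_derivative:
  assumes \<phi>: "\<phi> \<in> test_functions \<Omega>"
  shows "((\<lambda>s. Qsum \<phi> (\<lambda>j. c j * exp (- s * lam j)) m) has_real_derivative
    - (\<Sum>j<m. \<Sum>k<m. (c j * exp (- s * lam j) / lam j) * (c k * exp (- s * lam k) / lam k) * Smat \<phi> j k)) (at s)"
proof -
  define e where "e j = c j * exp (- s * lam j)" for j
  have d: "((\<lambda>s. Qsum \<phi> (\<lambda>j. c j * exp (- s * lam j)) m) has_real_derivative
    (\<Sum>j<m. \<Sum>k<m. - (e j * e k * ((lam j + lam k) / lam k * Dmat \<phi> j k)))) (at s)"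
    unfolding Qsum_def e_def
    by (rule DERIV_sum, rule DERIV_sum) (auto intro!: derivative_eq_intros simp: field_simps less_imp_neq[OF lam_pos, symmetric])
  have "(\<Sum>j<m. \<Sum>k<m. e j * e k * ((lam j + lam k) / lam k * Dmat \<phi> j k))
     = (\<Sum>j<m. \<Sum>k<m. (e j / lam j) * (e k / lam k) * Smat \<phi> j k)"
  proof (rule sum_symmetrize)
    fix j k
    have nz: "lam j \<noteq> 0" "lam k \<noteq> 0" using lam_pos[of j] lam_pos[of k] by auto
    have "(lam j + lam k) / lam k * Dmat \<phi> j k + (lam k + lam j) / lam j * Dmat \<phi> k j
      = (lam j * lam j * Dmat \<phi> j k + lam k * lam k * Dmat \<phi> k j) / (lam j * lam k)"
      using nz Dmat_antisymmetric[OF \<phi>, of k j] by (simp add: field_simps)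
    also have "\<dots> = (Smat \<phi> j k + Smat \<phi> k j) / (lam j * lam k)"
      using Dmat_Smat[OF \<phi>, of j k] by (simp add: lam_sq)
    finally have eq: "(lam j + lam k) / lam k * Dmat \<phi> j k + (lam k + lam j) / lam j * Dmat \<phi> k j
      = (Smat \<phi> j k + Smat \<phi> k j) / (lam j * lam k)" .
    have "e j * e k * ((lam j + lam k) / lam k * Dmat \<phi> j k) + e k * e j * ((lam k + lam j) / lam j * Dmat \<phi> k j)
      = e j * e k * ((lam j + lam k) / lam k * Dmat \<phi> j k + (lam k + lam j) / lam j * Dmat \<phi> k j)"
      by (simp add: distrib_left mult.commute[of "e k" "e j"])
    also have "\<dots> = (e j / lam j) * (e k / lam k) * Smat \<phi> j k + (e k / lam k) * (e j / lam j) * Smat \<phi> k j"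
      unfolding eq using nz by (simp add: field_simps)
    finally show "e j * e k * ((lam j + lam k) / lam k * Dmat \<phi> j k) + e k * e j * ((lam k + lam j) / lam j * Dmat \<phi> k j)
      = (e j / lam j) * (e k / lam k) * Smat \<phi> j k + (e k / lam k) * (e j / lam j) * Smat \<phi> k j" .
  qed
  then show ?thesis using d by (simp add: sum_negf e_def)
qed

text \<open>The full and the truncated sum are compared along the damping, which sends both to 0.
  Their derivatives differ by two terms, each with one argument supported on the modes from N on and
  of size exp(-s lam N); integration in s yields 1 / lam N, and 8 = 2 * 4 counts the two
  terms.\<close>

lemma Qsum_tail_bound:
  assumes \<phi>: "\<phi> \<in> test_functions \<Omega>" and N: "N \<le> m"
    and C: "\<And>i k x. \<bar>dir_deriv (dir_deriv \<phi> (axis i 1)) (axis k 1) x\<bar> \<le> C"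
  shows "\<bar>Qsum \<phi> c m - Qsum \<phi> c N\<bar> \<le> 8 * C * (\<Sum>j<m. (c j)\<^sup>2) / lam N"
proof -
  define b where "b j = (if j < N then c j else 0)" for j
  define T where "T = (\<Sum>j<m. (c j)\<^sup>2)"
  have T0: "0 \<le> T" by (simp add: T_def sum_nonneg)
  have C0: "0 \<le> C" using C[of 1 1 0] by linarith
  \<comment> \<open>Dividing by \<open>lam j\<close> makes the gradient energy of X equal to the
    plain sum of squares of the damped coefficients.\<close>
  define X where "X c s j = c j * exp (- s * lam j) / lam j" for c :: "nat \<Rightarrow> real" and s j
  define S where "S x y = (\<Sum>j<m. \<Sum>k<m. x j * y k * Smat \<phi> j k)" for x y
  define p where "p s = Qsum \<phi> (\<lambda>j. c j * exp (- s * lam j)) m - Qsum \<phi> (\<lambda>j. b j * exp (- s * lam j)) m" for s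
  have dp: "(p has_real_derivative - S (X c s) (X c s) - - S (X b s) (X b s)) (at s)" for s
    unfolding p_def S_def X_def by (intro DERIV_diff Qsum_derivative \<phi>)
  let ?E = "\<lambda>x. sqrt (\<Sum>j<m. \<mu> j * (x j)\<^sup>2)"
  have EX: "\<mu> j * (X c s j)\<^sup>2 = (c j)\<^sup>2 * (exp (- s * lam j))\<^sup>2" for c s j
    using lam_pos[of j] by (simp add: X_def power_mult_distrib power_divide lam_sq[symmetric] power2_eq_square[of "lam j"])
  have Ele: "?E (X a s) \<le> sqrt T" if "s \<ge> 0" "\<And>j. (a j)\<^sup>2 \<le> (c j)\<^sup>2" for a s
  proof -
    have "(a j)\<^sup>2 * (exp (- s * lam j))\<^sup>2 \<le> (c j)\<^sup>2" for j
    proof -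
      have "(exp (- s * lam j))\<^sup>2 \<le> 1\<^sup>2"
        using that(1) lam_pos[of j] by (intro power_mono) auto
      then have "(a j)\<^sup>2 * (exp (- s * lam j))\<^sup>2 \<le> (a j)\<^sup>2 * 1" by (intro mult_left_mono) auto
      then show ?thesis using that(2)[of j] by linarith
    qed
    then show ?thesis unfolding EX T_def by (intro real_sqrt_le_mono sum_mono)
  qed
  have Er: "?E (X (\<lambda>j. c j - b j) s) \<le> exp (- s * lam N) * sqrt T" if "s \<ge> 0" for s
  proof -
    have "(c j - b j)\<^sup>2 * (exp (- s * lam j))\<^sup>2 \<le> (exp (- s * lam N))\<^sup>2 * (c j)\<^sup>2" for j
    proof (cases "j < N")
      case False
      then have "(exp (- s * lam j))\<^sup>2 \<le> (exp (- s * lam N))\<^sup>2"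
        using that lam_mono[of N j] by (intro power_mono) (auto simp: mult_left_mono)
      then have "(c j)\<^sup>2 * (exp (- s * lam j))\<^sup>2 \<le> (c j)\<^sup>2 * (exp (- s * lam N))\<^sup>2"
        by (intro mult_left_mono) auto
      then show ?thesis using False by (simp add: b_def mult.commute)
    qed (simp add: b_def)
    then have "(\<Sum>j<m. \<mu> j * (X (\<lambda>j. c j - b j) s j)\<^sup>2) \<le> (exp (- s * lam N))\<^sup>2 * T"
      unfolding EX T_def sum_distrib_left by (intro sum_mono)
    then have "?E (X (\<lambda>j. c j - b j) s) \<le> sqrt ((exp (- s * lam N))\<^sup>2 * T)"
      by (rule real_sqrt_le_mono)
    then show ?thesis by (simp add: real_sqrt_mult)
  qed
  have bound: "\<bar>- S (X c s) (X c s) - - S (X b s) (X b s)\<bar> \<le> (8 * C * T) * exp (- s * lam N)" if s: "s \<ge> 0" for s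
  proof -
    let ?r = "X (\<lambda>j. c j - b j) s"
    have r: "?r j = X c s j - X b s j" for j by (simp add: X_def diff_divide_distrib left_diff_distrib)
    \<comment> \<open>The splitting S(x,x) - S(y,y) = S(x - y, x) + S(y, x - y), in which the
      difference x - y carries only modes from N on.\<close>
    have "S (X c s) (X c s) - S (X b s) (X b s) = S ?r (X c s) + S (X b s) ?r"
      unfolding S_def r by (simp add: sum.distrib[symmetric] sum_subtractf[symmetric] algebra_simps)
    moreover have "\<bar>S ?r (X c s)\<bar> \<le> 4 * C * (exp (- s * lam N) * sqrt T) * sqrt T"
      unfolding S_def
      by (rule order_trans[OF Smat_bound[OF \<phi> _ C]], simp,
          intro mult_mono Er s Ele) (auto simp: C0 T0 intro!: sum_nonneg mult_nonneg_nonneg less_imp_le[OF eigenvalue_pos])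
    moreover have "\<bar>S (X b s) ?r\<bar> \<le> 4 * C * sqrt T * (exp (- s * lam N) * sqrt T)"
      unfolding S_def
      by (rule order_trans[OF Smat_bound[OF \<phi> _ C]], simp,
          intro mult_mono Er s Ele) (auto simp: b_def C0 T0 intro!: sum_nonneg mult_nonneg_nonneg less_imp_le[OF eigenvalue_pos])
    moreover have "4 * C * (exp (- s * lam N) * sqrt T) * sqrt T + 4 * C * sqrt T * (exp (- s * lam N) * sqrt T)
      = (8 * C * T) * exp (- s * lam N)"
      using T0 by (simp add: algebra_simps)
    ultimately show ?thesis by linarith
  qed
  have lim: "(p \<longlongrightarrow> 0) at_top"
  proof -
    have e0: "((\<lambda>s. exp (- s * lam j)) \<longlongrightarrow> 0) at_top" for j
    proof -
      have "filterlim (\<lambda>s. s * lam j) at_top at_top"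
        using lam_pos[of j] by (intro filterlim_at_top_mult_tendsto_pos[OF tendsto_const _ filterlim_ident]) auto
      then have "((\<lambda>s. exp (- (s * lam j))) \<longlongrightarrow> 0) at_top"
        using exp_at_bot filterlim_compose filterlim_uminus_at_top by blast
      then show ?thesis by simp
    qed
    have "((\<lambda>s. Qsum \<phi> (\<lambda>j. a j * exp (- s * lam j)) m) \<longlongrightarrow>
       (\<Sum>j<m. \<Sum>k<m. a j * 0 * (a k * 0) * (Dmat \<phi> j k / lam k))) at_top" for a
      unfolding Qsum_def by (intro tendsto_intros e0)
    then have "((\<lambda>s. Qsum \<phi> (\<lambda>j. a j * exp (- s * lam j)) m) \<longlongrightarrow> 0) at_top" for a by simp
    from tendsto_diff[OF this[of c] this[of b]] show ?thesis by (simp add: p_def[abs_def])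
  qed
  have "\<bar>p 0\<bar> \<le> (8 * C * T) / lam N"
    by (rule exponential_decay_bound[OF dp bound lam_pos lim])
  moreover have "p 0 = Qsum \<phi> c m - Qsum \<phi> c N"
    unfolding p_def Qsum_truncate[OF N] b_def by simp
  ultimately show ?thesis by (simp add: T_def)
qed


section \<open>The velocity and the quadratic form\<close>

definition cf :: "(real^2 \<Rightarrow> real) \<Rightarrow> nat \<Rightarrow> real" where
  "cf \<theta> j = L2_inner M \<theta> (w j)"

lemma wsum_norm:
  assumes "finite A"
  shows "(L2_norm M (\<lambda>p. \<Sum>j\<in>A. x j * w j p))\<^sup>2 = (\<Sum>j\<in>A. (x j)\<^sup>2)"
proof -
  have L: "(\<lambda>p. \<Sum>j\<in>A. x j * w j p) \<in> L2 M" by (intro L2_sum L2_cmult eigenfunction_L2)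
  have "L2_inner M (w k) (\<lambda>p. \<Sum>j\<in>A. x j * w j p) = x k" if "k \<in> A" for k
  proof -
    have "L2_inner M (w k) (\<lambda>p. \<Sum>j\<in>A. x j * w j p) = (\<Sum>j\<in>A. x j * L2_inner M (w k) (w j))"
      by (subst L2_inner_sum_right) (auto intro: L2_cmult eigenfunction_L2 simp: L2_inner_cmult_right)
    then show ?thesis
      using assms that by (simp add: orthonormal if_distrib[of "times _"] sum.delta cong: if_cong)
  qed
  then have "(\<Sum>k\<in>A. x k * L2_inner M (w k) (\<lambda>p. \<Sum>j\<in>A. x j * w j p)) = (\<Sum>j\<in>A. (x j)\<^sup>2)"
    by (simp add: power2_eq_square)
  moreover have "L2_inner M (\<lambda>p. \<Sum>j\<in>A. x j * w j p) (\<lambda>p. \<Sum>j\<in>A. x j * w j p)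
      = (\<Sum>k\<in>A. x k * L2_inner M (w k) (\<lambda>p. \<Sum>j\<in>A. x j * w j p))"
    using L by (subst L2_inner_sum_left) (auto intro: L2_cmult eigenfunction_L2 simp: L2_inner_cmult_left)
  ultimately show ?thesis by (simp add: L2_norm_sq)
qed

lemma Bessel_inequality:
  assumes \<theta>: "\<theta> \<in> L2 M"
  shows "(\<Sum>j<n. (cf \<theta> j)\<^sup>2) \<le> (L2_norm M \<theta>)\<^sup>2"
proof (cases "(\<Sum>j<n. (cf \<theta> j)\<^sup>2) = 0")
  case False
  let ?P = "\<lambda>p. \<Sum>j<n. cf \<theta> j * w j p"
  let ?s = "\<Sum>j<n. (cf \<theta> j)\<^sup>2"
  have L: "?P \<in> L2 M" by (intro L2_sum L2_cmult eigenfunction_L2)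
  have "L2_inner M \<theta> ?P = ?s"
    using \<theta> by (subst L2_inner_sum_right)
      (auto intro: L2_cmult eigenfunction_L2 simp: L2_inner_cmult_right cf_def power2_eq_square)
  then have "?s \<le> L2_norm M \<theta> * L2_norm M ?P"
    using L2_Cauchy_Schwarz[OF \<theta> L] by simp
  then have "?s\<^sup>2 \<le> (L2_norm M \<theta> * L2_norm M ?P)\<^sup>2"
    by (intro power_mono sum_nonneg) auto
  also have "\<dots> = (L2_norm M \<theta>)\<^sup>2 * ?s"
    using wsum_norm[of "{..<n}" "cf \<theta>"] by (simp add: power_mult_distrib)
  finally have "?s * ?s \<le> (L2_norm M \<theta>)\<^sup>2 * ?s" by (simp add: power2_eq_square)
  moreover have "?s > 0" using False sum_nonneg[of "{..<n}" "\<lambda>j. (cf \<theta> j)\<^sup>2"] by simp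
  ultimately show ?thesis by simp
qed simp

lemma cf_summable: "\<theta> \<in> L2 M \<Longrightarrow> summable (\<lambda>j. (cf \<theta> j)\<^sup>2)"
  by (rule summableI_nonneg_bounded[where x="(L2_norm M \<theta>)\<^sup>2"]) (auto intro: Bessel_inequality)

text \<open>\<open>Lambda_inv\<close> is a choice, meaningful once some limit exists; the series
  converges because the eigenvalues are bounded below by the first one.\<close>

lemma Lambda_inv_converges:
  assumes \<theta>: "\<theta> \<in> L2 M"
  shows "L2_converges M (\<lambda>n x. \<Sum>j<n. cf \<theta> j / lam j * w j x) (Lambda_inv \<Omega> w \<mu> \<theta>)"
proof -
  obtain g where g: "L2_converges M (\<lambda>n x. \<Sum>j<n. cf \<theta> j / lam j * w j x) g"
  proof (rule L2_series_converges[where v="\<lambda>j x. cf \<theta> j / lam j * w j x" and a="\<lambda>j. (cf \<theta> j)\<^sup>2 / \<mu> 0"])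
    show "(L2_norm M (\<lambda>x. \<Sum>j=m..<n. cf \<theta> j / lam j * w j x))\<^sup>2 \<le> (\<Sum>j=m..<n. (cf \<theta> j)\<^sup>2 / \<mu> 0)" for m n
    proof -
      have "(cf \<theta> j / lam j)\<^sup>2 \<le> (cf \<theta> j)\<^sup>2 / \<mu> 0" for j
        using monoD[OF eigenvalue_mono, of 0 j] eigenvalue_pos[of 0] eigenvalue_pos[of j]
        by (simp add: power_divide power2_eq_square[of "lam j"] lam_sq frac_le)
      then show ?thesis
        using wsum_norm[of "{m..<n}" "\<lambda>j. cf \<theta> j / lam j"] by (simp add: sum_mono)
    qed
    show "(\<lambda>x. cf \<theta> j / lam j * w j x) \<in> L2 M" for j by (rule L2_cmult[OF eigenfunction_L2])
  qed (auto intro: summable_divide cf_summable \<theta>)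
  have eq: "(\<lambda>n x. \<Sum>j<n. \<mu> j powr (-1/2) * L2_inner M \<theta> (w j) * w j x)
    = (\<lambda>n x. \<Sum>j<n. cf \<theta> j / lam j * w j x)"
    unfolding powr_eigenvalue cf_def by simp
  show ?thesis
    unfolding Lambda_inv_def eq by (rule someI[of "L2_converges M (\<lambda>n x. \<Sum>j<n. cf \<theta> j / lam j * w j x)", OF g])
qed

text \<open>Equality of functions and not merely almost everywhere: the choice depends on \<theta>
  only through its coefficients, which ignore null sets.\<close>

lemma Lambda_inv_cong:
  assumes "\<theta> \<in> borel_measurable M" "\<theta>' \<in> borel_measurable M" "AE x in M. \<theta> x = \<theta>' x"
  shows "Lambda_inv \<Omega> w \<mu> \<theta> = Lambda_inv \<Omega> w \<mu> \<theta>'"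
proof -
  have "L2_inner M \<theta> (w j) = L2_inner M \<theta>' (w j)" for j
    by (rule L2_inner_AE_cong[OF assms(1,2) L2_measurable[OF eigenfunction_L2] assms(3)])
  then show ?thesis by (simp add: Lambda_inv_def)
qed

definition grad_pot :: "2 \<Rightarrow> (real^2 \<Rightarrow> real) \<Rightarrow> real^2 \<Rightarrow> real" where
  "grad_pot i \<theta> = weak_partial \<Omega> i (Lambda_inv \<Omega> w \<mu> \<theta>)"

lemma Gsum_norm_cf:
  assumes "finite A"
  shows "(L2_norm M (Gsum A i (\<lambda>j. cf \<theta> j / lam j)))\<^sup>2 \<le> (\<Sum>j\<in>A. (cf \<theta> j)\<^sup>2)"
proof -
  have "\<mu> j * (cf \<theta> j / lam j)\<^sup>2 = (cf \<theta> j)\<^sup>2" for j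
    using eigenvalue_pos[of j] by (simp add: power_divide power2_eq_square[of "lam j"] lam_sq)
  then have "L2_norm M (Gsum A i (\<lambda>j. cf \<theta> j / lam j)) \<le> sqrt (\<Sum>j\<in>A. (cf \<theta> j)\<^sup>2)"
    using Gsum_norm_le[OF assms, of i "\<lambda>j. cf \<theta> j / lam j"] by simp
  then have "(L2_norm M (Gsum A i (\<lambda>j. cf \<theta> j / lam j)))\<^sup>2 \<le> (sqrt (\<Sum>j\<in>A. (cf \<theta> j)\<^sup>2))\<^sup>2"
    by (rule power_mono) simp
  then show ?thesis by (simp add: sum_nonneg)
qed

text \<open>Termwise differentiation: the gradients of the partial sums converge because
  \<open>\<mu> j\<close> cancels the square of \<open>lam j\<close>, their limit is a weak partial
  of \<Lambda>^-1 \<theta>, and the partial chosen in \<open>grad_pot\<close> agrees with it almost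
  everywhere.\<close>

lemma grad_pot_converges:
  assumes \<theta>: "\<theta> \<in> L2 M"
  shows "L2_converges M (\<lambda>n. Gsum {..<n} i (\<lambda>j. cf \<theta> j / lam j)) (grad_pot i \<theta>)"
proof -
  let ?x = "\<lambda>j. cf \<theta> j / lam j"
  let ?\<psi> = "Lambda_inv \<Omega> w \<mu> \<theta>"
  obtain g where "L2_converges M (\<lambda>n p. \<Sum>j<n. ?x j * G i j p) g"
  proof (rule L2_series_converges[where v="\<lambda>j p. ?x j * G i j p" and a="\<lambda>j. (cf \<theta> j)\<^sup>2"])
    show "(\<lambda>p. ?x j * G i j p) \<in> L2 M" for j by (rule L2_cmult[OF G_L2])
    show "(L2_norm M (\<lambda>p. \<Sum>j=m..<n. ?x j * G i j p))\<^sup>2 \<le> (\<Sum>j=m..<n. (cf \<theta> j)\<^sup>2)" for m n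
      using Gsum_norm_cf[of "{m..<n}" i \<theta>] by (simp only: Gsum_def finite_atLeastLessThan simp_thms)
  qed (rule cf_summable[OF \<theta>])
  then have g: "L2_converges M (\<lambda>n. Gsum {..<n} i ?x) g" by (simp add: Gsum_def)
  note \<psi> = Lambda_inv_converges[OF \<theta>]
  have L: "?\<psi> \<in> L2 M" "g \<in> L2 M" using \<psi> g by (auto simp: L2_converges_iff)
  have hg: "has_weak_partial \<Omega> i ?\<psi> g"
  proof (rule has_weak_partialI[OF L])
    fix \<eta> assume \<eta>: "\<eta> \<in> test_functions \<Omega>"
    note d = L2_test_function[OF test_functions_dir_deriv[OF \<eta> axis_Basis]]
    have 1: "(\<lambda>n. L2_inner M (\<lambda>p. \<Sum>j<n. ?x j * w j p) (dir_deriv \<eta> (axis i 1))) \<longlonglongrightarrow> L2_inner M ?\<psi> (dir_deriv \<eta> (axis i 1))"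
      by (rule L2_converges_inner[OF \<psi> L2_converges_const[OF d]])
    have 2: "(\<lambda>n. - L2_inner M (Gsum {..<n} i ?x) \<eta>) \<longlonglongrightarrow> - L2_inner M g \<eta>"
      by (rule tendsto_minus[OF L2_converges_inner[OF g L2_converges_const[OF L2_test_function[OF \<eta>]]]])
    have "L2_inner M (\<lambda>p. \<Sum>j<n. ?x j * w j p) (dir_deriv \<eta> (axis i 1)) = - L2_inner M (Gsum {..<n} i ?x) \<eta>" for n
    proof -
      have "L2_inner M (\<lambda>p. \<Sum>j<n. ?x j * w j p) (dir_deriv \<eta> (axis i 1))
         = (\<Sum>j<n. ?x j * L2_inner M (w j) (dir_deriv \<eta> (axis i 1)))"
        using d by (subst L2_inner_sum_left) (auto intro: L2_cmult[OF eigenfunction_L2] simp del: times_divide_eq_left simp: L2_inner_cmult_left)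
      also have "\<dots> = - L2_inner M (Gsum {..<n} i ?x) \<eta>"
        unfolding Gsum_inner[OF L2_test_function[OF \<eta>]] has_weak_partialD(3)[OF has_weak_partial_G \<eta>]
        by (simp add: sum_negf)
      finally show ?thesis .
    qed
    then show "L2_inner M ?\<psi> (dir_deriv \<eta> (axis i 1)) = - L2_inner M g \<eta>"
      using 1 2 LIMSEQ_unique by simp
  qed
  have hw: "has_weak_partial \<Omega> i ?\<psi> (grad_pot i \<theta>)"
    unfolding grad_pot_def by (rule weak_partial_works[OF hg])
  have "AE x in M. g x - grad_pot i \<theta> x = 0"
  proof (rule L2_zero_from_test(2))
    show "L2_inner M (\<lambda>x. g x - grad_pot i \<theta> x) \<eta> = 0" if \<eta>: "\<eta> \<in> test_functions \<Omega>" for \<eta>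
      using has_weak_partialD(3)[OF hg \<eta>] has_weak_partialD(3)[OF hw \<eta>]
      by (simp add: L2_inner_diff_left has_weak_partialD(2)[OF hg] has_weak_partialD(2)[OF hw] L2_test_function[OF \<eta>])
  qed (intro L2_diff has_weak_partialD(2)[OF hg] has_weak_partialD(2)[OF hw])
  then show ?thesis
    by (intro L2_converges_AE_cong[OF g] L2_measurable has_weak_partialD(2)[OF hw]) auto
qed

lemma grad_pot_L2: "\<theta> \<in> L2 M \<Longrightarrow> grad_pot i \<theta> \<in> L2 M"
  using grad_pot_converges by (simp add: L2_converges_iff)

lemma grad_pot_norm:
  assumes \<theta>: "\<theta> \<in> L2 M"
  shows "L2_norm M (grad_pot i \<theta>) \<le> L2_norm M \<theta>"
proof (rule LIMSEQ_le_const2[OF L2_converges_norm[OF grad_pot_converges[OF \<theta>]]])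
  have "L2_norm M (Gsum {..<n} i (\<lambda>j. cf \<theta> j / lam j)) \<le> L2_norm M \<theta>" for n
    by (rule power2_le_imp_le[OF order_trans[OF Gsum_norm_cf[OF finite_lessThan] Bessel_inequality[OF \<theta>]] L2_norm_nonneg])
  then show "\<exists>N. \<forall>n\<ge>N. L2_norm M (Gsum {..<n} i (\<lambda>j. cf \<theta> j / lam j)) \<le> L2_norm M \<theta>" by blast
qed

definition Qform :: "(real^2 \<Rightarrow> real) \<Rightarrow> (real^2 \<Rightarrow> real) \<Rightarrow> real" where
  "Qform \<phi> \<theta> = L2_inner M \<theta> (tr \<phi> (grad_pot 1 \<theta>) (grad_pot 2 \<theta>))"

lemma tr_converges:
  assumes \<phi>: "\<phi> \<in> test_functions S" and f: "L2_converges M f1 g1" "L2_converges M f2 g2"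
  shows "L2_converges M (\<lambda>n. tr \<phi> (f1 n) (f2 n)) (tr \<phi> g1 g2)"
proof -
  obtain C1 where C1: "\<And>x. \<bar>dir_deriv \<phi> (axis (1::2) 1) x\<bar> \<le> C1"
    using test_functions_bounded[OF test_functions_dir_deriv[OF \<phi> axis_Basis]] by metis
  obtain C2 where C2: "\<And>x. \<bar>dir_deriv \<phi> (axis (2::2) 1) x\<bar> \<le> C2"
    using test_functions_bounded[OF test_functions_dir_deriv[OF \<phi> axis_Basis]] by metis
  note m = test_function_measurable[OF test_functions_dir_deriv[OF \<phi> axis_Basis]]
  have "L2_converges M (\<lambda>n x. dir_deriv \<phi> (axis 2 1) x * f1 n x + (- dir_deriv \<phi> (axis 1 1) x) * f2 n x)
    (\<lambda>x. dir_deriv \<phi> (axis 2 1) x * g1 x + (- dir_deriv \<phi> (axis 1 1) x) * g2 x)"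
  proof (rule L2_converges_add)
    show "L2_converges M (\<lambda>n x. dir_deriv \<phi> (axis 2 1) x * f1 n x) (\<lambda>x. dir_deriv \<phi> (axis 2 1) x * g1 x)"
      by (rule L2_converges_bounded_mult[OF f(1) m C2])
    show "L2_converges M (\<lambda>n x. - dir_deriv \<phi> (axis 1 1) x * f2 n x) (\<lambda>x. - dir_deriv \<phi> (axis 1 1) x * g2 x)"
      by (rule L2_converges_bounded_mult[OF f(2) borel_measurable_uminus[OF m], where C=C1]) (simp add: C1)
  qed
  then show ?thesis by (simp add: tr_def)
qed

text \<open>Both factors of the inner product converge strongly: the expansion of \<theta> and,
  through \<open>tr\<close>, the gradient of the potential.\<close>

lemma Qsum_limit:
  assumes \<phi>: "\<phi> \<in> test_functions \<Omega>" and \<theta>: "\<theta> \<in> L2 M"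
  shows "(\<lambda>n. Qsum \<phi> (cf \<theta>) n) \<longlonglongrightarrow> Qform \<phi> \<theta>"
proof -
  let ?x = "\<lambda>j. cf \<theta> j / lam j"
  have "(\<lambda>n. L2_inner M (\<lambda>x. \<Sum>j<n. cf \<theta> j * w j x) (tr \<phi> (Gsum {..<n} 1 ?x) (Gsum {..<n} 2 ?x)))
     \<longlonglongrightarrow> Qform \<phi> \<theta>"
    unfolding Qform_def
    by (rule L2_converges_inner[OF basis_expansion[OF \<theta>, folded cf_def] tr_converges[OF \<phi> grad_pot_converges[OF \<theta>] grad_pot_converges[OF \<theta>]]])
  moreover have "L2_inner M (\<lambda>x. \<Sum>j<n. cf \<theta> j * w j x) (tr \<phi> (Gsum {..<n} 1 ?x) (Gsum {..<n} 2 ?x)) = Qsum \<phi> (cf \<theta>) n" for n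
  proof -
    have "L2_inner M (\<lambda>x. \<Sum>j<n. cf \<theta> j * w j x) (tr \<phi> (Gsum {..<n} 1 ?x) (Gsum {..<n} 2 ?x))
      = (\<Sum>j<n. cf \<theta> j * L2_inner M (w j) (tr \<phi> (Gsum {..<n} 1 ?x) (Gsum {..<n} 2 ?x)))"
      by (subst L2_inner_sum_left) (auto intro: L2_cmult eigenfunction_L2 tr_L2[OF \<phi>] Gsum_L2 simp: L2_inner_cmult_left)
    moreover have "L2_inner M (w j) (tr \<phi> (Gsum {..<n} 1 ?x) (Gsum {..<n} 2 ?x)) = (\<Sum>k<n. ?x k * Dmat \<phi> j k)" for j
      unfolding tr_Gsum Dmat_def
      by (subst L2_inner_sum_right)
        (auto intro!: L2_cmult[OF tr_L2[OF \<phi> G_L2 G_L2]] eigenfunction_L2 simp del: times_divide_eq_left simp: L2_inner_cmult_right)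
    ultimately show ?thesis by (simp add: Qsum_def sum_distrib_left mult.assoc)
  qed
  ultimately show ?thesis by simp
qed

text \<open>The number m of modes tends to infinity with N fixed; Bessel's inequality makes the
  bound for the finite sums independent of m.\<close>

lemma Qform_tail_bound:
  assumes \<phi>: "\<phi> \<in> test_functions \<Omega>" and \<theta>: "\<theta> \<in> L2 M"
    and C: "\<And>i k x. \<bar>dir_deriv (dir_deriv \<phi> (axis i 1)) (axis k 1) x\<bar> \<le> C"
  shows "\<bar>Qform \<phi> \<theta> - Qsum \<phi> (cf \<theta>) N\<bar> \<le> 8 * C * (L2_norm M \<theta>)\<^sup>2 / lam N"
proof (rule LIMSEQ_le_const2)
  have C0: "0 \<le> C" using C[of 1 1 0] by linarith
  show "(\<lambda>m. \<bar>Qsum \<phi> (cf \<theta>) m - Qsum \<phi> (cf \<theta>) N\<bar>) \<longlonglongrightarrow> \<bar>Qform \<phi> \<theta> - Qsum \<phi> (cf \<theta>) N\<bar>"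
    by (intro tendsto_intros Qsum_limit \<phi> \<theta>)
  have "\<bar>Qsum \<phi> (cf \<theta>) m - Qsum \<phi> (cf \<theta>) N\<bar> \<le> 8 * C * (L2_norm M \<theta>)\<^sup>2 / lam N" if "N \<le> m" for m
  proof -
    have "8 * C * (\<Sum>j<m. (cf \<theta> j)\<^sup>2) / lam N \<le> 8 * C * (L2_norm M \<theta>)\<^sup>2 / lam N"
      using lam_pos[of N] C0 by (intro divide_right_mono mult_left_mono Bessel_inequality \<theta>) auto
    then show ?thesis using Qsum_tail_bound[OF \<phi> that C, of "cf \<theta>"] by linarith
  qed
  then show "\<exists>K. \<forall>m\<ge>K. \<bar>Qsum \<phi> (cf \<theta>) m - Qsum \<phi> (cf \<theta>) N\<bar> \<le> 8 * C * (L2_norm M \<theta>)\<^sup>2 / lam N"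
    by blast
qed

text \<open>Uses just that the velocity is bounded in L^2 by \<theta>. It serves integrability in
  time and bounds the time derivative of pairings with test functions.\<close>

lemma Qform_bound:
  assumes \<phi>: "\<phi> \<in> test_functions \<Omega>" and \<theta>: "\<theta> \<in> L2 M"
    and C: "\<And>i x. \<bar>dir_deriv \<phi> (axis i 1) x\<bar> \<le> C"
  shows "\<bar>Qform \<phi> \<theta>\<bar> \<le> 2 * C * (L2_norm M \<theta>)\<^sup>2"
proof -
  have C0: "0 \<le> C" using C[of 1 0] by linarith
  note L = grad_pot_L2[OF \<theta>]
  have "L2_norm M (tr \<phi> (grad_pot 1 \<theta>) (grad_pot 2 \<theta>)) \<le> C * (L2_norm M \<theta> + L2_norm M \<theta>)"
    by (rule order_trans[OF tr_norm[OF \<phi> L L C]]) (intro mult_left_mono add_mono grad_pot_norm \<theta> C0)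
  then have "L2_norm M \<theta> * L2_norm M (tr \<phi> (grad_pot 1 \<theta>) (grad_pot 2 \<theta>)) \<le> L2_norm M \<theta> * (C * (L2_norm M \<theta> + L2_norm M \<theta>))"
    by (intro mult_left_mono) auto
  then show ?thesis
    using L2_Cauchy_Schwarz[OF \<theta> tr_L2[OF \<phi> L L], of 1 2] by (simp add: Qform_def power2_eq_square algebra_simps)
qed

lemma Dmat_bound:
  assumes \<phi>: "\<phi> \<in> test_functions \<Omega>" and C: "\<And>i x. \<bar>dir_deriv \<phi> (axis i 1) x\<bar> \<le> C"
  shows "\<bar>Dmat \<phi> j k\<bar> \<le> L2_norm M (w j) * (C * (L2_norm M (G 1 k) + L2_norm M (G 2 k)))"
  unfolding Dmat_def
  by (rule order_trans[OF L2_Cauchy_Schwarz[OF eigenfunction_L2 tr_L2[OF \<phi> G_L2 G_L2]]])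
    (intro mult_left_mono tr_norm[OF \<phi> G_L2 G_L2 C] L2_norm_nonneg)

text \<open>With \<psi> = \<Lambda>^-1 \<theta> the integrand contains (-\<partial>_2 \<psi>,
  \<partial>_1 \<psi>) . (\<partial>_1 \<phi>, \<partial>_2 \<phi>), which fixes the signs in
  \<open>tr\<close>.\<close>

lemma sqg_integrand:
  assumes "smooth \<phi>"
  shows "(\<theta> x *\<^sub>R sqg_velocity \<Omega> w \<mu> \<theta> x) \<bullet> space_grad \<phi> (t, x)
    = \<theta> x * tr (\<lambda>x. \<phi> (t, x)) (grad_pot 1 \<theta>) (grad_pot 2 \<theta>) x"
proof -
  have L: "bounded_linear (\<lambda>x::real^2. (0::real, x))"
    by (intro bounded_linear_Pair bounded_linear_zero bounded_linear_ident)
  have "dir_deriv (\<lambda>x. \<phi> (t, x)) v x = dir_deriv \<phi> (0, v) (t, x)" for v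
    using dir_deriv_affine_comp[OF L smooth_differentiable[OF assms], where c="(t, 0)"] by simp
  then show ?thesis
    by (simp add: sqg_velocity_def perp_grad_def space_grad_def tr_def grad_pot_def inner_vec_def sum_2 algebra_simps)
qed

end

section \<open>Cutoff functions on the line\<close>

text \<open>A class of functions closed under differentiation, so that membership implies smoothness.\<close>

definition exp_flat :: "real poly \<Rightarrow> real \<Rightarrow> real" where
  "exp_flat p x = (if x > 0 then poly p (1 / x) * exp (- (1 / x)) else 0)"

lemma poly_div_exp_tendsto_0: "((\<lambda>y. poly p y * exp (- y)) \<longlongrightarrow> (0::real)) at_top"
proof -
  have "((\<lambda>y. \<Sum>i\<le>degree p. coeff p i * (y ^ i / exp y)) \<longlongrightarrow> (\<Sum>i\<le>degree p. coeff p i * 0)) at_top"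
    by (intro tendsto_sum tendsto_mult_left tendsto_power_div_exp_0)
  then show ?thesis
    by (simp add: poly_altdef exp_minus sum_distrib_right divide_inverse mult.assoc)
qed

text \<open>In the variable y = 1/x differentiation is -y^2 d/dy, and applied to p(y) exp(-y) it
  gives y^2 (p - p')(y) exp(-y), the polynomial of the statement. At 0 the exponential beats every
  power of 1/x.\<close>

lemma exp_flat_derivative:
  "(exp_flat p has_real_derivative exp_flat ([:0, 0, 1:] * (p - pderiv p)) x) (at x)"
proof (cases "x = 0")
  case False
  show ?thesis
  proof (cases "x > 0")
    case True
    have "((\<lambda>x. poly p (1 / x) * exp (- (1 / x))) has_real_derivative exp_flat ([:0, 0, 1:] * (p - pderiv p)) x) (at x)"
      using True
      by (auto intro!: derivative_eq_intros DERIV_chain2[OF poly_DERIV] simp: exp_flat_def power2_eq_square field_simps)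
    moreover have "open {0<..<(2 * x)}" "x \<in> {0<..<(2 * x)}" using True by auto
    ultimately show ?thesis
      by (rule has_field_derivative_transform_within_open) (auto simp: exp_flat_def)
  next
    case neg: False
    have "((\<lambda>x::real. 0::real) has_real_derivative exp_flat ([:0, 0, 1:] * (p - pderiv p)) x) (at x)"
      using neg by (simp add: exp_flat_def)
    moreover have "open {..<(0::real)}" "x \<in> {..<0}" using neg False by auto
    ultimately show ?thesis
      by (rule has_field_derivative_transform_within_open) (auto simp: exp_flat_def)
  qed
next
  case True
  have "((\<lambda>y. exp_flat p y / y) \<longlongrightarrow> 0) (at 0)"
  proof (rule filterlim_split_at)
    show "((\<lambda>y. exp_flat p y / y) \<longlongrightarrow> 0) (at_left 0)"
      by (rule tendsto_eventually) (auto simp: exp_flat_def eventually_at_filter)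
    \<comment> \<open>Dividing by y raises the degree by one: p(1/y) / y is the value of
      \<open>pCons 0 p\<close> at 1/y.\<close>
    have "((\<lambda>y. poly (pCons 0 p) (inverse y) * exp (- inverse y)) \<longlongrightarrow> 0) (at_right (0::real))"
      by (rule filterlim_compose[OF poly_div_exp_tendsto_0 filterlim_inverse_at_top_right])
    then show "((\<lambda>y. exp_flat p y / y) \<longlongrightarrow> 0) (at_right 0)"
      by (rule Lim_transform_eventually)
        (auto simp: exp_flat_def eventually_at_filter divide_inverse mult_ac)
  qed
  then show ?thesis using True by (simp add: has_field_derivative_iff exp_flat_def)
qed

lemma dir_deriv_real: "(f has_real_derivative D) (at x) \<Longrightarrow> dir_deriv f 1 x = D"
  using dir_deriv_eq[of f "times D" x 1] by (simp add: has_field_derivative_def)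

lemma exp_flat_smooth: "smooth (exp_flat p)"
proof (rule smooth_coinduct[where P="\<lambda>f. \<exists>p. f = exp_flat p"])
  fix f :: "real \<Rightarrow> real" assume "\<exists>p. f = exp_flat p"
  then obtain p where f: "f = exp_flat p" by blast
  have "dir_deriv f 1 = exp_flat ([:0, 0, 1:] * (p - pderiv p))"
    unfolding f by (intro ext dir_deriv_real exp_flat_derivative)
  moreover have "f differentiable (at x)" for x
    unfolding f using exp_flat_derivative real_differentiable_def by blast
  ultimately show "(\<forall>x. f differentiable (at x)) \<and> (\<forall>b\<in>Basis. \<exists>p. dir_deriv f b = exp_flat p)"
    by auto
qed auto

text \<open>A smooth approximation from below of the indicator of (s, e); the factor
  \<open>Suc k\<close> steepens both flanks and is never 0.\<close>

definition bump :: "real \<Rightarrow> real \<Rightarrow> nat \<Rightarrow> real \<Rightarrow> real" where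
  "bump s e k x = exp_flat 1 (real (Suc k) * (x - s)) * exp_flat 1 (real (Suc k) * (e - x))"

lemma exp_flat_1: "0 \<le> exp_flat 1 x" "exp_flat 1 x \<le> 1" "x \<le> 0 \<Longrightarrow> exp_flat 1 x = 0"
  by (auto simp: exp_flat_def)

lemma bump_bounds: "0 \<le> bump s e k x" "bump s e k x \<le> 1"
  by (auto simp: bump_def exp_flat_1 mult_le_one)

lemma bump_outside: "x \<le> s \<or> e \<le> x \<Longrightarrow> bump s e k x = 0"
  by (auto simp: bump_def exp_flat_1(3) mult_nonneg_nonpos)

lemma bump_smooth: "smooth (bump s e k)"
proof -
  have "smooth (\<lambda>x. exp_flat 1 ((- real (Suc k) * s) + real (Suc k) * x))"
    "smooth (\<lambda>x. exp_flat 1 ((real (Suc k) * e) + (- real (Suc k)) * x))"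
    by (intro smooth_affine_comp bounded_linear_mult_right exp_flat_smooth)+
  from smooth_mult[OF this] show ?thesis
    unfolding bump_def[abs_def] by (simp only: right_diff_distrib mult_minus_left uminus_add_conv_diff add_uminus_conv_diff)
qed

lemma bump_limit:
  assumes "s < x" "x < e"
  shows "(\<lambda>k. bump s e k x) \<longlonglongrightarrow> 1"
proof -
  have "(\<lambda>k. exp_flat 1 (real (Suc k) * y)) \<longlonglongrightarrow> 1" if "y > 0" for y
  proof -
    have "(\<lambda>k. exp (- ((1 / y) * (1 / real (Suc k))))) \<longlonglongrightarrow> exp (- ((1 / y) * 0))"
      by (intro tendsto_intros LIMSEQ_Suc[OF lim_1_over_n])
    then show ?thesis using that by (simp add: exp_flat_def mult.commute)
  qed
  from tendsto_mult[OF this[of "x - s"] this[of "e - x"]] show ?thesis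
    unfolding bump_def using assms by simp
qed

lemma bump_primitive:
  assumes "s \<le> e"
  obtains A where "\<And>x. (A has_real_derivative bump s e k x) (at x)"
    "\<And>x. x \<le> s \<Longrightarrow> A x = 0" "\<And>x. e \<le> x \<Longrightarrow> A x = A e" "\<And>x y. x \<le> y \<Longrightarrow> A x \<le> A y"
    "\<And>x. 0 \<le> A x \<and> A x \<le> e - s"
proof -
  let ?b = "bump s e k"
  \<comment> \<open>The lower limit s - 1 makes every x \<ge> s interior to the interval of
    integration, so the derivative within the interval is a two-sided one.\<close>
  define A where "A x = integral {s - 1..x} ?b" for x
  have cont: "continuous_on S ?b" for S by (rule smooth_continuous_on[OF bump_smooth])
  have A0: "A x = 0" if "x \<le> s" for x
  proof -
    have "integral {s - 1..x} ?b = integral {s - 1..x} (\<lambda>x. 0)"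
      using that by (intro integral_cong) (auto simp: bump_outside)
    then show ?thesis by (simp add: A_def)
  qed
  have d: "(A has_real_derivative ?b x) (at x)" for x
  proof (cases "x < s")
    case True
    have "((\<lambda>x. 0) has_real_derivative ?b x) (at x)" using True by (simp add: bump_outside)
    then show ?thesis
      by (rule has_field_derivative_transform_within_open[where S="{..<s}"]) (use True A0 in auto)
  next
    case False
    have "(A has_real_derivative ?b x) (at x within {s - 1..x + 1})"
      unfolding A_def by (rule integral_has_real_derivative[OF cont]) (use False in auto)
    moreover have "at x within {s - 1..x + 1} = at x"
      by (rule at_within_interior) (use False in auto)
    ultimately show ?thesis by simp
  qed
  have mono: "A x \<le> A y" if "x \<le> y" for x y
    by (rule DERIV_nonneg_imp_nondecreasing[OF that]) (use d bump_bounds in blast)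
  have Ae: "A x = A e" if "e \<le> x" for x
  proof (cases "e = x")
    case False
    show ?thesis
    proof (rule DERIV_isconst_end[where f=A and a=e and b=x])
      show "continuous_on {e..x} A"
        using d by (intro continuous_at_imp_continuous_on) (auto intro: DERIV_isCont)
      show "(A has_real_derivative 0) (at y)" if "e < y" for y
        using d[of y] bump_outside[of y s e k] that by simp
    qed (use that False in auto)
  qed simp
  have up: "A x \<le> e - s" for x
  proof -
    have "A e - e \<le> A s - s"
    proof (rule DERIV_nonpos_imp_nonincreasing[OF assms, where f="\<lambda>x. A x - x"])
      fix y
      have "((\<lambda>x. A x - x) has_real_derivative ?b y - 1) (at y)"
        by (intro DERIV_diff d DERIV_ident)
      then show "\<exists>z. ((\<lambda>x. A x - x) has_real_derivative z) (at y) \<and> z \<le> 0"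
        using bump_bounds(2)[of s e k y] by (intro exI[of _ "?b y - 1"]) auto
    qed
    moreover have "A x \<le> A e" using mono[of x e] Ae[of x] by (cases "x \<le> e") auto
    ultimately show ?thesis using A0[of s] by simp
  qed
  have low: "0 \<le> A x" for x
    using A0[of x] mono[of s x] A0[of s] by (cases "x \<le> s") auto
  show thesis using that[OF d A0 Ae mono] up low by blast
qed

text \<open>A primitive of one bump is not compactly supported in general, but a bump minus its
  translate has integral 0, so the difference of the two primitives is. As a test function it
  compares the integrals of a function over an interval and over its translate.\<close>

lemma bump_difference:
  assumes s: "0 < s" "s \<le> e" "0 \<le> d" "e + d < T"
  obtains a where "a \<in> test_functions {0<..<T}" "dir_deriv a 1 = (\<lambda>x. bump s e k x - bump s e k (x - d))"
    "\<And>x. \<bar>a x\<bar> \<le> (e - s) * indicator {s..e + d} x"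
proof -
  obtain A where A: "\<And>x. (A has_real_derivative bump s e k x) (at x)"
    "\<And>x. x \<le> s \<Longrightarrow> A x = 0" "\<And>x. e \<le> x \<Longrightarrow> A x = A e" "\<And>x y. x \<le> y \<Longrightarrow> A x \<le> A y"
    "\<And>x. 0 \<le> A x \<and> A x \<le> e - s"
    using bump_primitive[OF s(2)] by blast
  define a where "a x = A x - A (x - d)" for x
  have da: "(a has_real_derivative bump s e k x - bump s e k (x - d)) (at x)" for x
    unfolding a_def by (auto intro!: derivative_eq_intros DERIV_chain2[OF A(1)] A(1))
  have dd: "dir_deriv a 1 = (\<lambda>x. bump s e k x - bump s e k (x - d))"
    by (intro ext dir_deriv_real da)
  have out: "a x = 0" if "x \<notin> {s..e + d}" for x
  proof (cases "x < s")
    case True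
    then show ?thesis using A(2)[of x] A(2)[of "x - d"] s by (simp add: a_def)
  next
    case False
    then have "x > e + d" using that by auto
    then show ?thesis using A(3)[of x] A(3)[of "x - d"] s by (simp add: a_def)
  qed
  have "smooth a"
    unfolding smooth_unfold[of a]
  proof (intro conjI allI ballI)
    show "a differentiable (at x)" for x using da real_differentiable_def by blast
    show "smooth (dir_deriv a b)" if "b \<in> Basis" for b
    proof -
      have "smooth (\<lambda>x. bump s e k (- d + x))"
        by (rule smooth_affine_comp[OF bounded_linear_ident bump_smooth])
      then have "smooth (\<lambda>x. bump s e k x - bump s e k (x - d))"
        by (intro smooth_diff bump_smooth) simp
      then show ?thesis using that dd by simp
    qed
  qed
  then have "a \<in> test_functions {0<..<T}"
    using s out by (intro test_functionsI[of _ "{s..e + d}"]) auto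
  moreover have "\<bar>a x\<bar> \<le> (e - s) * indicator {s..e + d} x" for x
    using out[of x] A(4)[of "x - d" x] A(5)[of x] A(5)[of "x - d"] s
    by (cases "x \<in> {s..e + d}") (auto simp: a_def)
  ultimately show thesis using that dd by blast
qed

section \<open>Functions of one variable with integrable weak derivative\<close>

lemma integrable_bounded_mult:
  fixes f g :: "'a \<Rightarrow> real"
  assumes "integrable M f" "g \<in> borel_measurable M" "\<And>x. x \<in> space M \<Longrightarrow> \<bar>g x\<bar> \<le> C"
  shows "integrable M (\<lambda>x. g x * f x)"
proof (rule Bochner_Integration.integrable_bound)
  show "integrable M (\<lambda>x. \<bar>C\<bar> * f x)" using assms by simp
  have "\<bar>g x\<bar> \<le> \<bar>C\<bar>" if "x \<in> space M" for x using assms(3)[OF that] by simp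
  then show "AE x in M. norm (g x * f x) \<le> norm (\<bar>C\<bar> * f x)"
    by (auto simp: abs_mult intro!: mult_right_mono)
  show "(\<lambda>x. g x * f x) \<in> borel_measurable M" using assms by auto
qed

lemma integral_indicator_interval:
  fixes g :: "real \<Rightarrow> real"
  assumes g: "integrable lborel g"
  shows "(LINT x|lborel. indicator {s<..<e} x * g x) = integral {s..e} g" "g integrable_on {s..e}"
proof -
  have 1: "set_integrable lborel {s<..<e} g" "set_integrable lborel {s..e} g"
    unfolding set_integrable_def using g by (auto intro!: integrable_bounded_mult[where C=1])
  have "(LINT x|lborel. indicator {s<..<e} x * g x) = integral {s<..<e} g"
    using set_borel_integral_eq_integral(2)[OF 1(1)] by (simp add: set_lebesgue_integral_def)
  then show "(LINT x|lborel. indicator {s<..<e} x * g x) = integral {s..e} g"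
    using integral_open_interval[of s e g] by simp
  show "g integrable_on {s..e}" by (rule set_borel_integral_eq_integral(1)[OF 1(2)])
qed

context
  fixes T :: real and g h :: "real \<Rightarrow> real"
  assumes g: "integrable lborel g" and h: "integrable lborel h"
    and weak: "\<And>\<xi>. \<xi> \<in> test_functions {0<..<T} \<Longrightarrow>
      (LINT x|lborel. dir_deriv \<xi> 1 x * g x) + (LINT x|lborel. \<xi> x * h x) = 0"
begin

text \<open>The hypothesis says that g has weak derivative h on (0, T). Testing with a primitive of
  bump minus shifted bump, and letting the bumps tend to indicators, turns the difference of
  integrals of g into integrals of h against functions bounded by e - s.\<close>

lemma averages_close:
  assumes s: "0 < s" "s \<le> e" "0 \<le> d" "e + d < T"
  shows "\<bar>integral {s..e} g - integral {s + d..e + d} g\<bar> \<le> (e - s) * (LINT x|lborel. indicator {s..e + d} x * \<bar>h x\<bar>)"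
proof -
  let ?b = "bump s e"
  have bm: "?b k \<in> borel_measurable borel" for k by (rule smooth_borel_measurable[OF bump_smooth])
  have gm: "g \<in> borel_measurable borel" and hm: "h \<in> borel_measurable borel"
    using g h by (auto dest: borel_measurable_integrable)
  have int: "integrable lborel (\<lambda>x. ?b k (x - c) * g x)" for k c
    by (rule integrable_bounded_mult[OF g, where C=1])
      (use bump_bounds bm in \<open>auto intro: measurable_compose[OF _ bm]\<close>)
  have lim: "(\<lambda>k. LINT x|lborel. ?b k (x - c) * g x) \<longlonglongrightarrow> integral {s + c..e + c} g" for c
  proof -
    have "(\<lambda>k. LINT x|lborel. ?b k (x - c) * g x) \<longlonglongrightarrow> (LINT x|lborel. indicator {s + c<..<e + c} x * g x)"
    proof (rule integral_dominated_convergence)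
      show "integrable lborel (\<lambda>x. \<bar>g x\<bar>)" using g by simp
      show "AE x in lborel. (\<lambda>k. ?b k (x - c) * g x) \<longlonglongrightarrow> indicator {s + c<..<e + c} x * g x"
      proof (intro AE_I2 tendsto_mult_right)
        show "(\<lambda>k. ?b k (x - c)) \<longlonglongrightarrow> indicator {s + c<..<e + c} x" for x
        proof (cases "s + c < x \<and> x < e + c")
          case True
          then show ?thesis using bump_limit[of s "x - c" e] by simp
        next
          case False
          then have "?b k (x - c) = 0" for k by (intro bump_outside) auto
          then show ?thesis using False by auto
        qed
      qed
      show "AE x in lborel. norm (?b k (x - c) * g x) \<le> \<bar>g x\<bar>" for k
        using bump_bounds[of s e k] by (auto simp: abs_mult intro!: mult_left_le_one_le)
    qed (use gm bm in \<open>auto intro: measurable_compose[OF _ bm]\<close>)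
    then show ?thesis using integral_indicator_interval(1)[OF g] by simp
  qed
  have bound: "\<bar>(LINT x|lborel. ?b k (x - 0) * g x) - (LINT x|lborel. ?b k (x - d) * g x)\<bar>
      \<le> (e - s) * (LINT x|lborel. indicator {s..e + d} x * \<bar>h x\<bar>)" for k
  proof -
    obtain a where a: "a \<in> test_functions {0<..<T}" "dir_deriv a 1 = (\<lambda>x. ?b k x - ?b k (x - d))"
      "\<And>x. \<bar>a x\<bar> \<le> (e - s) * indicator {s..e + d} x"
      using bump_difference[OF s] by blast
    have am: "a \<in> borel_measurable borel" by (rule smooth_borel_measurable[OF test_functions_smooth[OF a(1)]])
    have "(LINT x|lborel. ?b k (x - 0) * g x) - (LINT x|lborel. ?b k (x - d) * g x) = (LINT x|lborel. dir_deriv a 1 x * g x)"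
      using int[of k 0] int[of k d] by (simp add: a(2) left_diff_distrib)
    then have "\<bar>(LINT x|lborel. ?b k (x - 0) * g x) - (LINT x|lborel. ?b k (x - d) * g x)\<bar> = \<bar>LINT x|lborel. a x * h x\<bar>"
      using weak[OF a(1)] by linarith
    also have "\<dots> \<le> (LINT x|lborel. \<bar>a x * h x\<bar>)" by (rule integral_abs_bound)
    also have "\<dots> \<le> (LINT x|lborel. (e - s) * (indicator {s..e + d} x * \<bar>h x\<bar>))"
    proof (rule integral_mono')
      show "integrable lborel (\<lambda>x. (e - s) * (indicator {s..e + d} x * \<bar>h x\<bar>))"
        using h by (intro integrable_mult_right integrable_bounded_mult[where C=1]) auto
      show "\<bar>a x * h x\<bar> \<le> (e - s) * (indicator {s..e + d} x * \<bar>h x\<bar>)" for x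
        using mult_right_mono[OF a(3)[of x], of "\<bar>h x\<bar>"] by (simp add: abs_mult mult.assoc)
      show "0 \<le> (e - s) * (indicator {s..e + d} x * \<bar>h x\<bar>)" for x using s by simp
    qed
    finally show ?thesis by simp
  qed
  have "(\<lambda>k. \<bar>(LINT x|lborel. ?b k (x - 0) * g x) - (LINT x|lborel. ?b k (x - d) * g x)\<bar>)
     \<longlonglongrightarrow> \<bar>integral {s + 0..e + 0} g - integral {s + d..e + d} g\<bar>"
    by (intro tendsto_intros lim)
  from LIMSEQ_le_const2[OF this] bound show ?thesis by auto
qed

text \<open>At Lebesgue points the values of g are limits of averages over [s, s + r] and
  [t, t + r], to which \<open>averages_close\<close> applies with shift t - s. The null set N is
  chosen once, before the interval (a, b).\<close>

lemma weak_derivative_oscillation: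
  "\<exists>N. negligible N \<and> (\<forall>a b s t. s \<notin> N \<longrightarrow> t \<notin> N \<longrightarrow> 0 \<le> a \<longrightarrow> a < s \<longrightarrow> s \<le> t \<longrightarrow> t < b \<longrightarrow> b \<le> T \<longrightarrow>
     \<bar>g s - g t\<bar> \<le> (LINT x|lborel. indicator {a<..<b} x * \<bar>h x\<bar>))"
proof -
  obtain N where N: "negligible N" and lim: "\<And>x e. x \<notin> N \<Longrightarrow> 0 < e \<Longrightarrow>
      \<exists>d>0. \<forall>r. 0 < r \<and> r < d \<longrightarrow> norm (integral (cbox x (x + r *\<^sub>R One)) g /\<^sub>R r ^ DIM(real) - g x) < e"
  proof (rule integrable_ccontinuous_explicit)
    show "g integrable_on cbox a b" for a b using integral_indicator_interval(2)[OF g] by simp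
  qed (rule that)
  have lim': "\<exists>d>0. \<forall>r. 0 < r \<and> r < d \<longrightarrow> \<bar>integral {x..x + r} g / r - g x\<bar> < e" if "x \<notin> N" "0 < e" for x e
    using lim[OF that] by (simp add: divide_inverse_commute)
  have "\<bar>g s - g t\<bar> \<le> (LINT x|lborel. indicator {a<..<b} x * \<bar>h x\<bar>)"
    if nN: "s \<notin> N" "t \<notin> N" and st: "0 \<le> a" "a < s" "s \<le> t" "t < b" "b \<le> T" for a b s t
  proof (rule field_le_epsilon)
    let ?V = "LINT x|lborel. indicator {a<..<b} x * \<bar>h x\<bar>"
    fix e :: real assume "e > 0"
    then have e: "e / 2 > 0" by simp
    obtain d1 where d1: "d1 > 0" "\<And>r. 0 < r \<Longrightarrow> r < d1 \<Longrightarrow> \<bar>integral {s..s + r} g / r - g s\<bar> < e / 2"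
      using lim'[OF nN(1) e] by blast
    obtain d2 where d2: "d2 > 0" "\<And>r. 0 < r \<Longrightarrow> r < d2 \<Longrightarrow> \<bar>integral {t..t + r} g / r - g t\<bar> < e / 2"
      using lim'[OF nN(2) e] by blast
    \<comment> \<open>Half of the minimum keeps both windows of length r inside (a, b) and both
      averages within e / 2 of the values of g.\<close>
    define r where "r = min (min d1 d2) (b - t) / 2"
    have "0 < r" "r \<le> d1 / 2" "r \<le> d2 / 2" "r \<le> (b - t) / 2"
      using d1(1) d2(1) st by (auto simp: r_def)
    then have r: "0 < r" "r < d1" "r < d2" "t + r < b" using d1(1) d2(1) by (auto simp: field_simps)
    have "\<bar>integral {s..s + r} g - integral {s + (t - s)..s + r + (t - s)} g\<bar>
        \<le> (s + r - s) * (LINT x|lborel. indicator {s..s + r + (t - s)} x * \<bar>h x\<bar>)"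
      by (rule averages_close) (use st r in auto)
    also have "\<dots> \<le> r * ?V"
    proof -
      have "(LINT x|lborel. indicator {s..s + r + (t - s)} x * \<bar>h x\<bar>) \<le> ?V"
      proof (rule integral_mono')
        show "integrable lborel (\<lambda>x. indicator {a<..<b} x * \<bar>h x\<bar>)"
          using h by (intro integrable_bounded_mult[where C=1]) auto
        show "indicator {s..s + r + (t - s)} x * \<bar>h x\<bar> \<le> indicator {a<..<b} x * \<bar>h x\<bar>" for x
          using st r by (auto simp: indicator_def)
      qed auto
      then show ?thesis using r by simp
    qed
    finally have "\<bar>integral {s..s + r} g - integral {t..t + r} g\<bar> / r \<le> ?V"
      using r(1) by (simp add: pos_divide_le_eq algebra_simps)
    then have "\<bar>integral {s..s + r} g / r - integral {t..t + r} g / r\<bar> \<le> ?V"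
      using r(1) by (simp add: diff_divide_distrib[symmetric] abs_divide)
    then show "\<bar>g s - g t\<bar> \<le> ?V + e"
      using d1(2)[OF r(1,2)] d2(2)[OF r(1,3)] by linarith
  qed
  then show ?thesis using N by blast
qed

end

section \<open>Compactness in time\<close>

text \<open>Exchange of limits: the error e is uniform in n and covers the limit as well, and the
  approximating sequence may depend on e.\<close>

lemma LIMSEQ_approx:
  fixes x :: "nat \<Rightarrow> real"
  assumes "\<And>e. e > 0 \<Longrightarrow> \<exists>y y0. y \<longlonglongrightarrow> y0 \<and> (\<forall>n. \<bar>x n - y n\<bar> \<le> e) \<and> \<bar>x0 - y0\<bar> \<le> e"
  shows "x \<longlonglongrightarrow> x0"
proof (rule LIMSEQ_I)
  fix e :: real assume "e > 0"
  then have "e / 4 > 0" by simp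
  then obtain y y0 where y: "y \<longlonglongrightarrow> y0" "\<And>n. \<bar>x n - y n\<bar> \<le> e / 4" "\<bar>x0 - y0\<bar> \<le> e / 4"
    using assms by blast
  obtain N where N: "\<And>n. n \<ge> N \<Longrightarrow> \<bar>y n - y0\<bar> < e / 4"
    using LIMSEQ_D[OF y(1) \<open>e / 4 > 0\<close>] by auto
  have "norm (x n - x0) < e" if "n \<ge> N" for n
    using N[OF that] y(2)[of n] y(3) \<open>e > 0\<close> unfolding real_norm_def by linarith
  then show "\<exists>N. \<forall>n\<ge>N. norm (x n - x0) < e" by blast
qed

text \<open>Open cells match the oscillation bound, which holds on open intervals; the grid points
  lie in no cell and form a null set.\<close>

definition cell :: "real \<Rightarrow> nat \<Rightarrow> real set" where
  "cell \<delta> i = {real i * \<delta> <..< real (Suc i) * \<delta>}"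


lemma cell_measurable [measurable]: "cell \<delta> i \<in> sets borel"
  by (simp add: cell_def)

lemma cell_index:
  assumes "\<delta> > 0" "x \<in> cell \<delta> i" shows "i = nat \<lfloor>x / \<delta>\<rfloor>"
proof -
  have "real i < x / \<delta>" "x / \<delta> < real i + 1"
    using assms by (auto simp: cell_def field_simps)
  then have "\<lfloor>x / \<delta>\<rfloor> = int i" by (intro floor_unique) auto
  then show ?thesis by simp
qed

lemma sum_cell:
  fixes f :: "nat \<Rightarrow> real"
  assumes "\<delta> > 0" "x \<in> cell \<delta> i" "i < m"
  shows "(\<Sum>j<m. f j * indicator (cell \<delta> j) x) = f i"
proof -
  have "f j * indicator (cell \<delta> j) x = (if j = i then f i else 0)" for j
  proof (cases "j = i")
    case False
    then have "x \<notin> cell \<delta> j" using cell_index[OF assms(1)] assms(2) by blast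
    then show ?thesis using False by simp
  qed (use assms(2) in simp)
  then show ?thesis using assms(3) by simp
qed

lemma sum_cell_outside:
  fixes f :: "nat \<Rightarrow> real"
  assumes "\<And>i. i < m \<Longrightarrow> x \<notin> cell \<delta> i"
  shows "(\<Sum>j<m. f j * indicator (cell \<delta> j) x) = 0"
  using assms by (intro sum.neutral) auto

lemma integrable_cell: "integrable lborel (indicator (cell \<delta> i) :: real \<Rightarrow> real)"
proof (rule integrable_real_indicator)
  show "emeasure lborel (cell \<delta> i) < \<infinity>"
    unfolding cell_def by (rule emeasure_bounded_finite) simp
qed (simp add: cell_def)

lemma cell_L2: "indicator (cell \<delta> i) \<in> L2 (lborel :: real measure)"
proof -
  have "(\<lambda>x. (indicator (cell \<delta> i) x)\<^sup>2) = (indicator (cell \<delta> i) :: real \<Rightarrow> real)"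
    by (auto simp: indicator_def)
  then show ?thesis using integrable_cell by (auto simp: L2_def)
qed

text \<open>Averaging over the cells of a grid of mesh \<delta>. It depends on g through finitely
  many inner products, so weak convergence of g makes it converge coefficient by
  coefficient.\<close>

definition step_avg :: "real \<Rightarrow> nat \<Rightarrow> (real \<Rightarrow> real) \<Rightarrow> real \<Rightarrow> real" where
  "step_avg \<delta> m g x = (\<Sum>i<m. L2_inner lborel g (indicator (cell \<delta> i)) / \<delta> * indicator (cell \<delta> i) x)"

lemma step_avg_L2: "step_avg \<delta> m g \<in> L2 lborel"
  unfolding step_avg_def[abs_def] by (intro L2_sum L2_cmult cell_L2)

lemma step_avg_inner:
  assumes "a \<in> L2 lborel"
  shows "L2_inner lborel (step_avg \<delta> m g) a
    = (\<Sum>i<m. L2_inner lborel g (indicator (cell \<delta> i)) / \<delta> * L2_inner lborel (indicator (cell \<delta> i)) a)"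
  unfolding step_avg_def[abs_def]
  by (subst L2_inner_sum_left[OF L2_cmult[OF cell_L2] assms]) (simp only: L2_inner_cmult_left)

text \<open>On cell i the function differs from its mean by at most \<open>v i\<close>, the integral
  of |h| over the cell. The squared error is at most \<delta> times the sum of the squares of
  \<open>v i\<close>, which the L^1 norm of h controls.\<close>

lemma step_avg_error:
  fixes g h :: "real \<Rightarrow> real"
  assumes g: "integrable lborel g" "g \<in> L2 lborel" "\<And>x. x \<notin> {0<..<T} \<Longrightarrow> g x = 0" and h: "integrable lborel h"
    and weak: "\<And>\<xi>. \<xi> \<in> test_functions {0<..<T} \<Longrightarrow>
      (LINT x|lborel. dir_deriv \<xi> 1 x * g x) + (LINT x|lborel. \<xi> x * h x) = 0"
    and T: "T > 0" and m: "m > 0" and V: "(LINT x|lborel. \<bar>h x\<bar>) \<le> V"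
  shows "L2_norm lborel (\<lambda>x. g x - step_avg (T / real m) m g x) \<le> V * sqrt (T / real m)"
proof -
  define \<delta> where "\<delta> = T / real m"
  have \<delta>: "\<delta> > 0" "real m * \<delta> = T" using T m by (auto simp: \<delta>_def)
  let ?I = "cell \<delta>"
  have gm[measurable]: "g \<in> borel_measurable borel" and hm[measurable]: "h \<in> borel_measurable borel"
    using g h by (auto dest: borel_measurable_integrable)
  obtain N where N': "negligible N \<and> (\<forall>a b s t. s \<notin> N \<longrightarrow> t \<notin> N \<longrightarrow> 0 \<le> a \<longrightarrow> a < s \<longrightarrow> s \<le> t \<longrightarrow> t < b \<longrightarrow> b \<le> T \<longrightarrow>
     \<bar>g s - g t\<bar> \<le> (LINT x|lborel. indicator {a<..<b} x * \<bar>h x\<bar>))"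
    using weak_derivative_oscillation[OF g(1) h weak] ..
  note N = conjunct1[OF N'] and osc = conjunct2[OF N', rule_format]
  define v where "v i = (LINT x|lborel. indicator (?I i) x * \<bar>h x\<bar>)" for i
  have v0: "v i \<ge> 0" for i unfolding v_def by (intro integral_nonneg_AE) simp
  have hI: "integrable lborel (\<lambda>x. indicator (?I i) x * \<bar>h x\<bar>)" for i
    using h by (intro integrable_bounded_mult[where C=1]) auto
  have cell_sub: "0 \<le> real i * \<delta>" "real (Suc i) * \<delta> \<le> T" if "i < m" for i
  proof -
    have "real (Suc i) * \<delta> \<le> real m * \<delta>" using that \<delta>(1) by (intro mult_right_mono) auto
    then show "0 \<le> real i * \<delta>" "real (Suc i) * \<delta> \<le> T" using \<delta> by auto
  qed
  have osc': "\<bar>g s - g t\<bar> \<le> v i" if "s \<notin> N" "t \<notin> N" "s \<in> ?I i" "t \<in> ?I i" "i < m" for s t i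
    using osc[OF that(1,2), of "real i * \<delta>" "real (Suc i) * \<delta>"] osc[OF that(2,1), of "real i * \<delta>" "real (Suc i) * \<delta>"]
      cell_sub[OF that(5)] that(3,4) unfolding v_def cell_def by (cases "s \<le> t") (auto simp: abs_minus_commute)
  have AEN: "AE y in lborel. y \<notin> N"
  proof -
    have "AE y in lebesgue. y \<notin> N"
      using N by (intro AE_not_in) (simp add: negligible_iff_null_sets)
    then show ?thesis by (simp add: AE_completion_iff)
  qed
  have meas: "(LINT y|lborel. indicator (?I i) y) = \<delta>" for i
    using \<delta>(1) by (simp add: cell_def algebra_simps)
  note Iint = integrable_cell
  have avg: "\<bar>g x - L2_inner lborel g (indicator (?I i)) / \<delta>\<bar> \<le> v i" if x: "x \<notin> N" "x \<in> ?I i" "i < m" for x i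
  proof -
    have gI: "integrable lborel (\<lambda>y. g y * indicator (?I i) y)"
      using integrable_bounded_mult[OF g(1), of "indicator (?I i)" 1] by (simp add: mult.commute)
    have "\<delta> * (g x - L2_inner lborel g (indicator (?I i)) / \<delta>) = g x * (LINT y|lborel. indicator (?I i) y) - (LINT y|lborel. g y * indicator (?I i) y)"
      using \<delta>(1) unfolding meas L2_inner_def by (simp add: field_simps)
    also have "\<dots> = (LINT y|lborel. g x * indicator (?I i) y - g y * indicator (?I i) y)"
      using Iint gI by simp
    finally have "\<bar>\<delta> * (g x - L2_inner lborel g (indicator (?I i)) / \<delta>)\<bar> \<le> (LINT y|lborel. \<bar>g x * indicator (?I i) y - g y * indicator (?I i) y\<bar>)"
      by (metis integral_abs_bound)
    also have "\<dots> \<le> (LINT y|lborel. v i * indicator (?I i) y)"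
    proof (rule integral_mono_AE)
      show "AE y in lborel. \<bar>g x * indicator (?I i) y - g y * indicator (?I i) y\<bar> \<le> v i * indicator (?I i) y"
        using AEN
      proof eventually_elim
        case (elim y)
        then show ?case using osc'[OF x(1) elim x(2) _ x(3)] by (auto simp: indicator_def)
      qed
    qed (use Iint gI in auto)
    also have "\<dots> = v i * \<delta>" by (simp only: integral_mult_right_zero meas)
    finally show ?thesis using \<delta>(1) by (simp add: abs_mult mult.commute)
  qed
  have grid: "\<exists>i<m. x \<in> ?I i" if x: "x \<in> {0<..<T}" "x \<notin> (\<lambda>i. real i * \<delta>) ` {..m}" for x
  proof -
    define i where "i = nat \<lfloor>x / \<delta>\<rfloor>"
    have "x / \<delta> \<ge> 0" using x \<delta> by simp
    then have "real i \<le> x / \<delta>" "x / \<delta> < real i + 1" unfolding i_def by linarith+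
    then have le: "real i * \<delta> \<le> x" "x < real (Suc i) * \<delta>" using \<delta>(1) by (auto simp: field_simps)
    have "real i * \<delta> < real m * \<delta>" using le x \<delta> by auto
    then have im: "i < m" using \<delta>(1) by simp
    then have "x \<noteq> real i * \<delta>" using x(2) by auto
    then show ?thesis using le im by (intro exI[of _ i]) (auto simp: cell_def)
  qed
  have AEgrid: "AE x in lborel. x \<notin> (\<lambda>i. real i * \<delta>) ` {..m}"
    by (rule AE_not_in) (auto intro: finite_imp_null_set_lborel)
  have AEb: "AE x in lborel. (g x - step_avg \<delta> m g x)\<^sup>2 \<le> (\<Sum>i<m. (v i)\<^sup>2 * indicator (?I i) x)"
    using AEN AEgrid
  proof eventually_elim
    case (elim x)
    show ?case
    proof (cases "\<exists>i<m. x \<in> ?I i")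
      case True
      then obtain i where i: "i < m" "x \<in> ?I i" by blast
      have "(g x - step_avg \<delta> m g x)\<^sup>2 \<le> (v i)\<^sup>2"
        unfolding step_avg_def sum_cell[OF \<delta>(1) i(2,1)]
        using avg[OF elim(1) i(2,1)] by (subst abs_le_square_iff[symmetric]) (simp add: v0)
      then show ?thesis unfolding sum_cell[OF \<delta>(1) i(2,1)] .
    next
      case False
      then have "g x = 0" using grid elim(2) g(3) by blast
      then show ?thesis using False by (simp add: step_avg_def sum_cell_outside)
    qed
  qed
  have "(L2_norm lborel (\<lambda>x. g x - step_avg \<delta> m g x))\<^sup>2 = (LINT x|lborel. (g x - step_avg \<delta> m g x)\<^sup>2)"
    by (simp add: L2_norm_def)
  also have "\<dots> \<le> (LINT x|lborel. (\<Sum>i<m. (v i)\<^sup>2 * indicator (?I i) x))"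
    by (intro integral_mono_AE AEb L2_integrable_sq L2_diff g(2) step_avg_L2
      Bochner_Integration.integrable_sum integrable_mult_right Iint)
  also have "\<dots> = (\<Sum>i<m. (v i)\<^sup>2 * \<delta>)"
  proof -
    have "(LINT x|lborel. (\<Sum>i<m. (v i)\<^sup>2 * indicator (?I i) x)) = (\<Sum>i<m. LINT x|lborel. (v i)\<^sup>2 * indicator (?I i) x)"
      by (intro Bochner_Integration.integral_sum integrable_mult_right Iint)
    then show ?thesis by (simp only: integral_mult_right_zero meas)
  qed
  also have "\<dots> = \<delta> * (\<Sum>i<m. v i * v i)"
    by (simp add: sum_distrib_left power2_eq_square mult_ac)
  \<comment> \<open>The numbers \<open>v i\<close> are nonnegative, so each is at most their total
    and the sum of squares is at most the square of the sum. The remaining factor \<delta> is the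
    source of the square root in the bound.\<close>
  also have "\<dots> \<le> \<delta> * (\<Sum>i<m. v i * (\<Sum>i<m. v i))"
    using \<delta>(1) v0 by (intro mult_left_mono sum_mono member_le_sum) auto
  also have "\<dots> = \<delta> * (\<Sum>i<m. v i)\<^sup>2"
    by (simp add: sum_distrib_right[symmetric] power2_eq_square)
  also have "\<dots> \<le> \<delta> * V\<^sup>2"
  proof -
    have "(\<Sum>i<m. v i) = (LINT x|lborel. (\<Sum>i<m. \<bar>h x\<bar> * indicator (?I i) x))"
      unfolding v_def using hI by (subst Bochner_Integration.integral_sum) (auto simp: mult.commute)
    also have "\<dots> \<le> (LINT x|lborel. \<bar>h x\<bar>)"
    proof (rule integral_mono')
      show "(\<Sum>i<m. \<bar>h x\<bar> * indicator (?I i) x) \<le> \<bar>h x\<bar>" for x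
      proof (cases "\<exists>i<m. x \<in> ?I i")
        case True
        then obtain i where i: "i < m" "x \<in> ?I i" by blast
        show ?thesis unfolding sum_cell[OF \<delta>(1) i(2,1)] by simp
      next
        case False
        then show ?thesis by (simp add: sum_cell_outside)
      qed
    qed (use h in auto)
    finally have "(\<Sum>i<m. v i) \<le> V" using V by simp
    then show ?thesis using \<delta>(1) v0 by (intro mult_left_mono power_mono sum_nonneg) auto
  qed
  finally have sq: "(L2_norm lborel (\<lambda>x. g x - step_avg \<delta> m g x))\<^sup>2 \<le> (V * sqrt \<delta>)\<^sup>2"
    using \<delta>(1) by (simp add: power_mult_distrib mult.commute)
  have "0 \<le> (LINT x|lborel. \<bar>h x\<bar>)" by (rule Bochner_Integration.integral_nonneg) simp
  then have "0 \<le> V" using V by linarith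
  then have "0 \<le> V * sqrt \<delta>" using \<delta>(1) by simp
  then show ?thesis
    unfolding \<delta>_def[symmetric] by (rule power2_le_imp_le[OF sq])
qed

text \<open>An Aubin-Lions argument on the line: g n is approximated in norm by step functions,
  uniformly in n, and for these the product with a weakly convergent f n is a finite sum of products
  of convergent numbers.\<close>

lemma time_compactness:
  fixes g f h :: "nat \<Rightarrow> real \<Rightarrow> real"
  assumes T: "T > 0"
    and g: "\<And>n. integrable lborel (g n)" "\<And>n x. x \<notin> {0<..<T} \<Longrightarrow> g n x = 0"
    and h: "\<And>n. integrable lborel (h n)" "\<And>n. (LINT x|lborel. \<bar>h n x\<bar>) \<le> V"
    and weak: "\<And>n \<xi>. \<xi> \<in> test_functions {0<..<T} \<Longrightarrow>
      (LINT x|lborel. dir_deriv \<xi> 1 x * g n x) + (LINT x|lborel. \<xi> x * h n x) = 0"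
    and cg: "L2_converges_weakly lborel g g0" and cf: "L2_converges_weakly lborel f f0"
    and K: "K \<in> borel_measurable borel" "\<And>x. \<bar>K x\<bar> \<le> C"
  shows "(\<lambda>n. LINT x|lborel. K x * g n x * f n x) \<longlonglongrightarrow> (LINT x|lborel. K x * g0 x * f0 x)"
proof (rule LIMSEQ_approx)
  fix e :: real assume e: "e > 0"
  obtain B where B: "\<And>n. L2_norm lborel (f n) \<le> B" using L2_weakly_converges_bounded[OF cf] by blast
  have B0: "B \<ge> 0" using B[of 0] L2_norm_nonneg[of lborel "f 0"] by linarith
  have C0: "C \<ge> 0" using K(2)[of 0] by linarith
  have "0 \<le> (LINT x|lborel. \<bar>h 0 x\<bar>)" by (rule Bochner_Integration.integral_nonneg) simp
  then have V0: "V \<ge> 0" using h(2)[of 0] by linarith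
  have gL: "g n \<in> L2 lborel" "g0 \<in> L2 lborel" and fL: "f n \<in> L2 lborel" "f0 \<in> L2 lborel" for n
    using cg cf by (auto simp: L2_converges_weakly_def)
  have "(\<lambda>m. C * (V * sqrt (T * (1 / real (Suc m)))) * B) \<longlonglongrightarrow> C * (V * sqrt (T * 0)) * B"
    by (intro tendsto_intros LIMSEQ_Suc[OF lim_1_over_n])
  then have "eventually (\<lambda>m. C * (V * sqrt (T * (1 / real (Suc m)))) * B < e) sequentially"
    using e by (intro order_tendstoD) auto
  then obtain m0 where m0: "C * (V * sqrt (T / real (Suc m0))) * B < e"
    by (auto simp: eventually_sequentially)
  define m where "m = Suc m0"
  define \<delta> where "\<delta> = T / real m"
  have \<delta>0: "\<delta> \<noteq> 0" using T by (simp add: \<delta>_def m_def)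
  let ?S = "step_avg \<delta> m"
  let ?R = "V * sqrt \<delta>"
  have R: "C * ?R * B < e" using m0 by (simp add: m_def \<delta>_def)
  have r: "L2_norm lborel (\<lambda>x. g n x - ?S (g n) x) \<le> ?R" for n
    unfolding \<delta>_def by (rule step_avg_error[OF g(1) gL(1) g(2) h(1) weak T _ h(2)]) (simp_all add: m_def)
  have cS: "(\<lambda>n. L2_inner lborel (?S (g n)) a) \<longlonglongrightarrow> L2_inner lborel (?S g0) a" if a: "a \<in> L2 lborel" for a
    unfolding step_avg_inner[OF a] using cg cell_L2
    by (intro tendsto_sum tendsto_mult tendsto_divide tendsto_const) (auto simp: L2_converges_weakly_def \<delta>0)
  \<comment> \<open>No equation is available for the limit g0; its averaging error is bounded
    because the errors converge weakly and the norm is weakly lower semicontinuous.\<close>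
  have "L2_converges_weakly lborel (\<lambda>n x. g n x - ?S (g n) x) (\<lambda>x. g0 x - ?S g0 x)"
    unfolding L2_converges_weakly_def
  proof (intro conjI allI ballI)
    fix a assume a: "a \<in> L2 (lborel :: real measure)"
    have "(\<lambda>n. L2_inner lborel (g n) a) \<longlonglongrightarrow> L2_inner lborel g0 a"
      using cg a by (simp add: L2_converges_weakly_def)
    from tendsto_diff[OF this cS[OF a]]
    show "(\<lambda>n. L2_inner lborel (\<lambda>x. g n x - ?S (g n) x) a) \<longlonglongrightarrow> L2_inner lborel (\<lambda>x. g0 x - ?S g0 x) a"
      by (simp add: L2_inner_diff_left gL step_avg_L2 a)
  qed (intro L2_diff gL step_avg_L2)+
  then have r0: "L2_norm lborel (\<lambda>x. g0 x - ?S g0 x) \<le> ?R" using L2_weak_limit_norm_le r by blast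
  have KL: "(\<lambda>x. K x * a x) \<in> L2 lborel" if "a \<in> L2 lborel" for a
    using L2_bounded_mult[OF that, of K C] K by simp
  have split: "\<bar>(LINT x|lborel. K x * a x * b x) - L2_inner lborel (\<lambda>x. K x * ?S a x) b\<bar> \<le> e"
    if a: "a \<in> L2 lborel" "L2_norm lborel (\<lambda>x. a x - ?S a x) \<le> ?R" and b: "b \<in> L2 lborel" "L2_norm lborel b \<le> B" for a b
  proof -
    have "(LINT x|lborel. K x * a x * b x) - L2_inner lborel (\<lambda>x. K x * ?S a x) b
      = L2_inner lborel (\<lambda>x. K x * (a x - ?S a x)) b"
      using L2_inner_diff_left[OF KL[OF a(1)] KL[OF step_avg_L2] b(1)]
      by (simp add: L2_inner_def right_diff_distrib)
    also have "\<bar>\<dots>\<bar> \<le> L2_norm lborel (\<lambda>x. K x * (a x - ?S a x)) * L2_norm lborel b"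
      by (rule L2_Cauchy_Schwarz[OF KL[OF L2_diff[OF a(1) step_avg_L2]] b(1)])
    also have "\<dots> \<le> (C * ?R) * B"
    proof (intro mult_mono b)
      have "L2_norm lborel (\<lambda>x. K x * (a x - ?S a x)) \<le> C * L2_norm lborel (\<lambda>x. a x - ?S a x)"
        by (rule L2_norm_bounded_mult[OF L2_diff[OF a(1) step_avg_L2]]) (use K C0 in auto)
      also have "\<dots> \<le> C * ?R" using a(2) C0 by (rule mult_left_mono)
      finally show "L2_norm lborel (\<lambda>x. K x * (a x - ?S a x)) \<le> C * ?R" .
    qed (use C0 V0 in \<open>auto simp: \<delta>_def T less_imp_le\<close>)
    finally show ?thesis using R by linarith
  qed
  have f0B: "L2_norm lborel f0 \<le> B" by (rule L2_weak_limit_norm_le[OF cf B])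
  have eq: "L2_inner lborel (\<lambda>x. K x * ?S a x) b
     = (\<Sum>i<m. L2_inner lborel a (indicator (cell \<delta> i)) / \<delta> * L2_inner lborel b (\<lambda>x. K x * indicator (cell \<delta> i) x))"
    if "b \<in> L2 lborel" for a b
  proof -
    have "L2_inner lborel (\<lambda>x. K x * ?S a x) b = L2_inner lborel (?S a) (\<lambda>x. K x * b x)"
      by (simp add: L2_inner_def mult_ac)
    also have "\<dots> = (\<Sum>i<m. L2_inner lborel a (indicator (cell \<delta> i)) / \<delta> * L2_inner lborel (indicator (cell \<delta> i)) (\<lambda>x. K x * b x))"
      by (rule step_avg_inner[OF KL[OF that]])
    finally show ?thesis by (simp add: L2_inner_def mult_ac)
  qed
  have "(\<lambda>n. L2_inner lborel (\<lambda>x. K x * ?S (g n) x) (f n)) \<longlonglongrightarrow> L2_inner lborel (\<lambda>x. K x * ?S g0 x) f0"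
    unfolding eq[OF fL(1)] eq[OF fL(2)] using cg cf KL[OF cell_L2] cell_L2
    by (intro tendsto_sum tendsto_mult tendsto_divide tendsto_const) (auto simp: L2_converges_weakly_def \<delta>0)
  then show "\<exists>y y0. y \<longlonglongrightarrow> y0 \<and> (\<forall>n. \<bar>(LINT x|lborel. K x * g n x * f n x) - y n\<bar> \<le> e)
      \<and> \<bar>(LINT x|lborel. K x * g0 x * f0 x) - y0\<bar> \<le> e"
    using split[OF gL(1) r fL(1) B] split[OF gL(2) r0 fL(2) f0B] by blast
qed

section \<open>Functions on the space-time cylinder\<close>

text \<open>Completeness of Lebesgue measure. It supplies measurability of the slices of the given
  solutions, for which only measurability on the cylinder is assumed.\<close>

lemma borel_measurable_lebesgue_on_AE:
  fixes f g :: "'a::euclidean_space \<Rightarrow> real"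
  assumes S: "S \<in> sets borel" and g: "g \<in> borel_measurable (lebesgue_on S)"
    and ae: "AE x in lebesgue_on S. f x = g x"
  shows "f \<in> borel_measurable (lebesgue_on S)"
proof -
  let ?f = "\<lambda>x. if x \<in> S then f x else 0" and ?g = "\<lambda>x. if x \<in> S then g x else 0"
  have S': "S \<in> sets lebesgue" using S by simp
  have gm: "?g \<in> borel_measurable lebesgue" by (rule borel_measurable_if_I[OF g S'])
  have "AE x in lebesgue. x \<in> S \<longrightarrow> f x = g x"
    using ae S' by (subst (asm) AE_restrict_space_iff) auto
  then have eq: "AE x in lebesgue. ?f x = ?g x" by (auto elim: eventually_mono)
  have "?f \<in> borel_measurable lebesgue"
  proof (rule measurableI)
    fix A :: "real set" assume "A \<in> sets borel"
    then have 1: "?g -` A \<inter> space lebesgue \<in> sets lebesgue" using gm by (rule measurable_sets[rotated])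
    have "AE x in lebesgue. x \<in> ?f -` A \<inter> space lebesgue \<longleftrightarrow> x \<in> ?g -` A \<inter> space lebesgue"
      using eq by eventually_elim (simp add: vimage_def del: if_split)
    then show "?f -` A \<inter> space lebesgue \<in> sets lebesgue"
      by (intro completion.in_sets_AE[OF _ 1]) (auto elim: eventually_mono)
  qed simp
  then show ?thesis by (rule borel_measurable_if_D)
qed

section \<open>Fubini and Tonelli on products of Euclidean spaces\<close>

lemma
  fixes H :: "'a::euclidean_space \<times> 'b::euclidean_space \<Rightarrow> real"
  assumes H: "integrable lborel H"
  shows Fubini_integrable: "integrable lborel (\<lambda>t. LINT x|lborel. H (t, x))"
    and Fubini_integral: "(LINT t|lborel. LINT x|lborel. H (t, x)) = integral\<^sup>L lborel H"
proof -
  have H': "integrable (lborel \<Otimes>\<^sub>M lborel) H" using H by (simp add: lborel_prod)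
  show "integrable lborel (\<lambda>t. LINT x|lborel. H (t, x))"
    by (rule lborel_pair.integrable_fst'[OF H'])
  show "(LINT t|lborel. LINT x|lborel. H (t, x)) = integral\<^sup>L lborel H"
    using lborel_pair.integral_fst'[OF H'] by (simp add: lborel_prod)
qed

lemma slice_borel:
  fixes H :: "'a::euclidean_space \<times> 'b::euclidean_space \<Rightarrow> real"
  assumes "H \<in> borel_measurable borel" shows "(\<lambda>x. H (t, x)) \<in> borel_measurable borel"
proof -
  have "(\<lambda>x::'b. (t, x)) \<in> borel_measurable borel"
    by (intro borel_measurable_continuous_onI continuous_intros)
  from measurable_compose[OF this assms] show ?thesis .
qed

lemma integral_borel:
  fixes H :: "'a::euclidean_space \<times> 'b::euclidean_space \<Rightarrow> real"
  assumes "H \<in> borel_measurable borel"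
  shows "(\<lambda>t. LINT x|lborel. H (t, x)) \<in> borel_measurable borel"
proof -
  have "H \<in> borel_measurable (borel \<Otimes>\<^sub>M lborel)"
    using assms by (metis borel_prod measurable_cong_sets sets_lborel sets_pair_measure_cong)
  then have "(\<lambda>(t, x). H (t, x)) \<in> borel_measurable (borel \<Otimes>\<^sub>M lborel)" by simp
  then show ?thesis by (rule lborel.borel_measurable_lebesgue_integral)
qed

lemma nn_integral_borel:
  fixes H :: "'a::euclidean_space \<times> 'b::euclidean_space \<Rightarrow> ennreal"
  assumes "H \<in> borel_measurable borel"
  shows "(\<lambda>t. \<integral>\<^sup>+x. H (t, x) \<partial>lborel) \<in> borel_measurable borel"
    and "(\<integral>\<^sup>+t. \<integral>\<^sup>+x. H (t, x) \<partial>lborel \<partial>lborel) = (\<integral>\<^sup>+z. H z \<partial>lborel)"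
proof -
  have "H \<in> borel_measurable (borel \<Otimes>\<^sub>M lborel)"
    using assms by (metis borel_prod measurable_cong_sets sets_lborel sets_pair_measure_cong)
  then show "(\<lambda>t. \<integral>\<^sup>+x. H (t, x) \<partial>lborel) \<in> borel_measurable borel"
    by (rule lborel.borel_measurable_nn_integral_fst)
  have "H \<in> borel_measurable (lborel \<Otimes>\<^sub>M lborel)" using assms by (simp add: lborel_prod)
  from lborel.nn_integral_fst[OF this]
  show "(\<integral>\<^sup>+t. \<integral>\<^sup>+x. H (t, x) \<partial>lborel \<partial>lborel) = (\<integral>\<^sup>+z. H z \<partial>lborel)" by (simp add: lborel_prod)
qed

lemma L2_tensor:
  fixes a :: "'a::euclidean_space \<Rightarrow> real" and b :: "'b::euclidean_space \<Rightarrow> real"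
  assumes a: "a \<in> L2 lborel" and b: "b \<in> L2 lborel"
  shows "(\<lambda>z. a (fst z) * b (snd z)) \<in> L2 lborel"
proof (rule L2_memI)
  have am: "a \<in> borel_measurable borel" and bm: "b \<in> borel_measurable borel"
    using L2_measurable[OF a] L2_measurable[OF b] by auto
  have fs: "(fst :: 'a \<times> 'b \<Rightarrow> 'a) \<in> borel_measurable borel" "(snd :: 'a \<times> 'b \<Rightarrow> 'b) \<in> borel_measurable borel"
    by (intro borel_measurable_continuous_onI continuous_intros)+
  have m: "(\<lambda>z. a (fst z) * b (snd z)) \<in> borel_measurable borel"
    by (intro borel_measurable_times measurable_compose[OF fs(1) am] measurable_compose[OF fs(2) bm])
  then show "(\<lambda>z. a (fst z) * b (snd z)) \<in> borel_measurable lborel" by simp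
  have "(\<integral>\<^sup>+z. ennreal ((a (fst z) * b (snd z))\<^sup>2) \<partial>lborel)
    = (\<integral>\<^sup>+t. \<integral>\<^sup>+x. ennreal ((a t * b x)\<^sup>2) \<partial>lborel \<partial>lborel)"
    using m by (subst nn_integral_borel(2)[symmetric]) auto
  also have "\<dots> = (\<integral>\<^sup>+t. ennreal ((a t)\<^sup>2) * ennreal ((L2_norm lborel b)\<^sup>2) \<partial>lborel)"
    using bm by (simp add: power_mult_distrib ennreal_mult nn_integral_cmult nn_integral_L2[OF b])
  also have "\<dots> = ennreal ((L2_norm lborel a)\<^sup>2) * ennreal ((L2_norm lborel b)\<^sup>2)"
    using am by (simp add: nn_integral_multc nn_integral_L2[OF a])
  also have "\<dots> < \<infinity>" by (simp add: ennreal_mult_less_top)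
  finally show "(\<integral>\<^sup>+z. ennreal ((a (fst z) * b (snd z))\<^sup>2) \<partial>lborel) < \<infinity>" .
qed

lemma test_function_L2_lborel:
  assumes "\<phi> \<in> test_functions S" shows "\<phi> \<in> L2 lborel"
proof -
  obtain K where K: "compact K" "\<And>x. x \<notin> K \<Longrightarrow> \<phi> x = 0" using test_functionsE[OF assms] by metis
  have m: "\<phi> \<in> borel_measurable borel" by (intro smooth_borel_measurable test_functions_smooth[OF assms])
  have "finite_measure (lebesgue_on K)"
    using emeasure_compact_finite[OF K(1)] borel_compact[OF K(1)]
    by (intro finite_measureI) (simp add: emeasure_restrict_space less_top)
  then have "\<phi> \<in> L2 (lebesgue_on K)"
    using test_functions_bounded[OF assms] by (metis L2_bounded borel_measurable_lebesgue_onI m)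
  then show ?thesis using L2_lebesgue_on_borel[of K \<phi>] K m by (simp add: borel_compact)
qed

lemma slice_bounded_linear: "bounded_linear (\<lambda>x::'b::euclidean_space. (0::'a::euclidean_space, x))"
  by (intro bounded_linear_Pair bounded_linear_zero bounded_linear_ident)

lemma slice_dir_deriv:
  assumes "smooth \<phi>"
  shows "dir_deriv (\<lambda>x. \<phi> (t, x)) v = (\<lambda>x. dir_deriv \<phi> (0, v) (t, x))"
  using dir_deriv_affine_comp[OF slice_bounded_linear smooth_differentiable[OF assms], where c="(t, 0)"] by auto

lemma slice_test_function:
  assumes \<phi>: "\<phi> \<in> test_functions (I \<times> \<Omega>)"
  shows "(\<lambda>x. \<phi> (t, x)) \<in> test_functions \<Omega>"
proof -
  obtain K where K: "compact K" "K \<subseteq> I \<times> \<Omega>" "\<And>x. x \<notin> K \<Longrightarrow> \<phi> x = 0"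
    using test_functionsE[OF \<phi>] by metis
  have "smooth (\<lambda>x. \<phi> ((t, 0) + (0, x)))"
    by (rule smooth_affine_comp[OF slice_bounded_linear test_functions_smooth[OF \<phi>]])
  moreover have "compact (snd ` (K \<inter> ({t} \<times> UNIV)))"
    by (intro compact_continuous_image continuous_intros compact_Int_closed K closed_Times)
  ultimately show ?thesis
    using K by (intro test_functionsI[of _ "snd ` (K \<inter> ({t} \<times> UNIV))"]; force simp: image_iff)
qed

lemma tensor_test_function:
  fixes \<xi> :: "'a::euclidean_space \<Rightarrow> real" and \<eta> :: "'b::euclidean_space \<Rightarrow> real"
  assumes \<xi>: "\<xi> \<in> test_functions I" and \<eta>: "\<eta> \<in> test_functions \<Omega>"
  shows "(\<lambda>z. \<xi> (fst z) * \<eta> (snd z)) \<in> test_functions (I \<times> \<Omega>)"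
    and "dir_deriv (\<lambda>z. \<xi> (fst z) * \<eta> (snd z)) (b, 0) (t, x) = dir_deriv \<xi> b t * \<eta> x"
proof -
  note sm = test_functions_smooth[OF \<xi>] test_functions_smooth[OF \<eta>]
  have s1: "smooth (\<lambda>z::'a \<times> 'b. \<xi> (0 + fst z))" by (rule smooth_affine_comp[OF bounded_linear_fst sm(1)])
  have s2: "smooth (\<lambda>z::'a \<times> 'b. \<eta> (0 + snd z))" by (rule smooth_affine_comp[OF bounded_linear_snd sm(2)])
  obtain K where K: "compact K" "K \<subseteq> I" "\<And>x. x \<notin> K \<Longrightarrow> \<xi> x = 0"
    using test_functionsE[OF \<xi>] by metis
  obtain L where L: "compact L" "L \<subseteq> \<Omega>" "\<And>x. x \<notin> L \<Longrightarrow> \<eta> x = 0"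
    using test_functionsE[OF \<eta>] by metis
  show "(\<lambda>z. \<xi> (fst z) * \<eta> (snd z)) \<in> test_functions (I \<times> \<Omega>)"
    using smooth_mult[OF s1 s2] K L
    by (intro test_functionsI[of _ "K \<times> L"]) (auto simp: compact_Times mem_Times_iff)
  have "dir_deriv (\<lambda>z::'a \<times> 'b. \<xi> (0 + fst z)) (b, 0) (t, x) = dir_deriv \<xi> b t"
    using dir_deriv_affine_comp[OF bounded_linear_fst smooth_differentiable[OF sm(1)], of 0 "(b, 0)" "(t, x)"] by simp
  moreover have "dir_deriv (\<lambda>z::'a \<times> 'b. \<eta> (0 + snd z)) (b, 0) (t, x) = dir_deriv \<eta> 0 x"
    using dir_deriv_affine_comp[OF bounded_linear_snd smooth_differentiable[OF sm(2)], of 0 "(b, 0)" "(t, x)"] by simp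
  moreover have "dir_deriv \<eta> 0 x = 0"
    using linear_0[OF has_derivative_linear[OF smooth_has_derivative[OF sm(2)]]] .
  ultimately show "dir_deriv (\<lambda>z. \<xi> (fst z) * \<eta> (snd z)) (b, 0) (t, x) = dir_deriv \<xi> b t * \<eta> x"
    using dir_deriv_mult[OF smooth_differentiable[OF s1] smooth_differentiable[OF s2], of "(b, 0)" "(t, x)"] by simp
qed

context dirichlet_domain
begin

text \<open>
  A representative that is Borel, vanishes off the cylinder and has square integrable slices at
  every time; the last two make the slicewise quantities meaningful without exceptional times.
\<close>

definition good :: "real \<Rightarrow> (real \<Rightarrow> real^2 \<Rightarrow> real) \<Rightarrow> bool" where
  "good T \<theta> \<longleftrightarrow> case_prod \<theta> \<in> L2 lborel \<and> (\<forall>t. \<theta> t \<in> L2 M) \<and>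
     (\<forall>t x. (t, x) \<notin> {0<..<T} \<times> \<Omega> \<longrightarrow> \<theta> t x = 0)"

lemma goodD:
  assumes "good T \<theta>"
  shows "case_prod \<theta> \<in> L2 lborel" "case_prod \<theta> \<in> borel_measurable borel" "\<theta> t \<in> L2 M" "\<theta> t \<in> borel_measurable borel"
    "x \<notin> \<Omega> \<Longrightarrow> \<theta> t x = 0" "t \<notin> {0<..<T} \<Longrightarrow> \<theta> t = (\<lambda>x. 0)"
proof -
  show b: "case_prod \<theta> \<in> borel_measurable borel"
    using assms L2_measurable[of "case_prod \<theta>" lborel] by (simp add: good_def)
  show "\<theta> t \<in> borel_measurable borel" using slice_borel[OF b, of t] by simp
qed (use assms in \<open>auto simp: good_def\<close>)

lemma cylinder_borel: "{0<..<T} \<times> \<Omega> \<in> sets (borel :: (real \<times> (real^2)) measure)"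
  using open_dom by (intro borel_open open_Times) auto

lemma L2_representative:
  assumes f: "f \<in> L2 M"
  obtains f0 where "f0 \<in> borel_measurable borel" "\<And>x. x \<notin> \<Omega> \<Longrightarrow> f0 x = 0" "AE x in M. f x = f0 x"
    "f0 \<in> L2 M" "f0 \<in> L2 lborel"
proof -
  obtain f0 where f0: "f0 \<in> borel_measurable borel" "\<And>x. x \<notin> \<Omega> \<Longrightarrow> f0 x = 0" "AE x in M. f x = f0 x"
    using borel_representative[OF domain_borel L2_measurable[OF f]] by blast
  have "f0 \<in> L2 M" by (rule L2_AE_cong[OF f borel_measurable_lebesgue_onI[OF f0(1)] f0(3)])
  then show thesis using that[OF f0] L2_lebesgue_on_borel[OF domain_borel f0(1,2)] by blast
qed

text \<open>A Borel representative extended by zero is set to 0 at the times whose slice is not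
  square integrable; by Tonelli these times form a null set.\<close>

lemma good_representative:
  assumes "(\<lambda>(t, x). \<theta> t x) \<in> L2 (cylinder T \<Omega>)"
  obtains \<theta>' where "good T \<theta>'" "AE z in cylinder T \<Omega>. (case z of (t, x) \<Rightarrow> \<theta> t x) = (case z of (t, x) \<Rightarrow> \<theta>' t x)"
proof -
  let ?C = "{0<..<T} \<times> \<Omega>"
  have \<theta>: "case_prod \<theta> \<in> L2 (lebesgue_on ?C)" using assms by (simp add: cylinder_def)
  obtain F where F: "F \<in> borel_measurable borel" "\<And>z. z \<notin> ?C \<Longrightarrow> F z = 0" "AE z in lebesgue_on ?C. case_prod \<theta> z = F z"
    using borel_representative[OF cylinder_borel L2_measurable[OF \<theta>]] by blast
  have "F \<in> L2 (lebesgue_on ?C)"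
    by (rule L2_AE_cong[OF \<theta> borel_measurable_lebesgue_onI[OF F(1)] F(3)])
  then have FL: "F \<in> L2 lborel" using L2_lebesgue_on_borel[OF cylinder_borel F(1,2)] by simp
  have F2: "(\<lambda>z. ennreal ((F z)\<^sup>2)) \<in> borel_measurable borel" using F(1) by measurable
  define A where "A = {t. (\<integral>\<^sup>+x. ennreal ((F (t, x))\<^sup>2) \<partial>lborel) < \<infinity>}"
  have Ab: "A \<in> sets borel"
    unfolding A_def using nn_integral_borel(1)[OF F2] by measurable
  have AA: "AE t in lborel. t \<in> A"
  proof -
    have "(\<integral>\<^sup>+t. \<integral>\<^sup>+x. ennreal ((F (t, x))\<^sup>2) \<partial>lborel \<partial>lborel) < \<infinity>"
      unfolding nn_integral_borel(2)[OF F2] nn_integral_L2[OF FL] by simp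
    then have "AE t in lborel. (\<integral>\<^sup>+x. ennreal ((F (t, x))\<^sup>2) \<partial>lborel) \<noteq> \<infinity>"
      using nn_integral_borel(1)[OF F2] by (intro nn_integral_noteq_infinite) simp_all
    then show ?thesis by eventually_elim (simp add: A_def less_top)
  qed
  define \<theta>' where "\<theta>' t x = indicator A t * F (t, x)" for t x
  have fs: "(fst :: real \<times> (real^2) \<Rightarrow> real) \<in> borel_measurable borel"
    by (intro borel_measurable_continuous_onI continuous_intros)
  have eq: "case_prod \<theta>' = (\<lambda>z. indicator A (fst z) * F z)" by (auto simp: \<theta>'_def)
  have L1: "case_prod \<theta>' \<in> L2 lborel"
    unfolding eq by (rule L2_bounded_mult[OF FL, where C=1])
      (use measurable_compose[OF fs borel_measurable_indicator[OF Ab]] in \<open>auto simp: indicator_def\<close>)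
  have L2: "\<theta>' t \<in> L2 M" for t
  proof (cases "t \<in> A")
    case True
    then have e: "\<theta>' t = (\<lambda>x. F (t, x))" by (auto simp: \<theta>'_def)
    have m: "(\<lambda>x. F (t, x)) \<in> borel_measurable borel" by (rule slice_borel[OF F(1)])
    have "(\<lambda>x. F (t, x)) \<in> L2 lborel"
      using True m by (intro L2_memI) (auto simp: A_def)
    then show ?thesis unfolding e using L2_lebesgue_on_borel[OF domain_borel m] F(2) by auto
  next
    case False
    then have "\<theta>' t = (\<lambda>x. 0)" by (auto simp: \<theta>'_def)
    then show ?thesis by (simp add: L2_zero)
  qed
  have g: "good T \<theta>'" using L1 L2 F(2) by (auto simp: good_def \<theta>'_def)
  have "AE z in (lborel :: (real \<times> (real^2)) measure). fst z \<in> A"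
  proof -
    have "{z \<in> space (lborel \<Otimes>\<^sub>M lborel). fst z \<in> A} \<in> sets (lborel \<Otimes>\<^sub>M (lborel :: (real^2) measure))"
      using Ab by measurable
    then have "AE z in lborel \<Otimes>\<^sub>M (lborel :: (real^2) measure). fst z \<in> A"
      by (rule lborel_pair.AE_pair_measure) (use AA in auto)
    from this[unfolded lborel_prod] show ?thesis .
  qed
  then have "AE z in lebesgue_on ?C. fst z \<in> A"
    using cylinder_borel by (subst AE_restrict_space_iff) (auto intro: AE_completion elim: eventually_mono)
  with F(3) have "AE z in cylinder T \<Omega>. (case z of (t, x) \<Rightarrow> \<theta> t x) = (case z of (t, x) \<Rightarrow> \<theta>' t x)"
    unfolding cylinder_def by eventually_elim (auto simp: \<theta>'_def)
  then show thesis using that g by blast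
qed

lemma slice_inner_lborel:
  assumes "good T \<theta>" "a \<in> L2 M" "a0 \<in> borel_measurable borel" "AE x in M. a x = a0 x" "a0 \<in> L2 M"
  shows "L2_inner M (\<theta> t) a = (LINT x|lborel. \<theta> t x * a0 x)"
proof -
  have "L2_inner M (\<theta> t) a = L2_inner M (\<theta> t) a0"
    unfolding L2_inner_commute[of M "\<theta> t"]
    by (intro L2_inner_AE_cong L2_measurable assms goodD(3)[OF assms(1)])
  also have "\<dots> = L2_inner lborel (\<theta> t) a0"
    by (rule L2_inner_lebesgue_on_borel[OF domain_borel goodD(4)[OF assms(1)] assms(3) goodD(5)[OF assms(1)]])
  finally show ?thesis by (simp add: L2_inner_def)
qed

lemma slice_inner_borel:
  assumes \<theta>: "good T \<theta>" and a: "a \<in> L2 M"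
  shows "(\<lambda>t. L2_inner M (\<theta> t) a) \<in> borel_measurable borel"
proof -
  obtain a0 where a0: "a0 \<in> borel_measurable borel" "\<And>x. x \<notin> \<Omega> \<Longrightarrow> a0 x = 0" "AE x in M. a x = a0 x" "a0 \<in> L2 M" "a0 \<in> L2 lborel"
    using L2_representative[OF a] by blast
  have sb: "(snd :: real \<times> (real^2) \<Rightarrow> real^2) \<in> borel_measurable borel"
    by (intro borel_measurable_continuous_onI continuous_intros)
  have "(\<lambda>z. case_prod \<theta> z * a0 (snd z)) \<in> borel_measurable borel"
    by (intro borel_measurable_times goodD(2)[OF \<theta>] measurable_compose[OF sb a0(1)])
  from integral_borel[OF this] show ?thesis
    by (simp add: slice_inner_lborel[OF \<theta> a a0(1,3,4)])
qed

lemma slice_norm: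
  assumes \<theta>: "good T \<theta>"
  shows "integrable lborel (\<lambda>t. (L2_norm M (\<theta> t))\<^sup>2)"
    and "(LINT t|lborel. (L2_norm M (\<theta> t))\<^sup>2) = (L2_norm lborel (case_prod \<theta>))\<^sup>2"
proof -
  have eq: "(L2_norm M (\<theta> t))\<^sup>2 = (LINT x|lborel. (case_prod \<theta> (t, x))\<^sup>2)" for t
  proof -
    have "L2_norm M (\<theta> t) = L2_norm lborel (\<theta> t)"
      by (rule L2_norm_lebesgue_on_borel[OF domain_borel goodD(4)[OF \<theta>] goodD(5)[OF \<theta>]])
    then show ?thesis by (simp add: L2_norm_def)
  qed
  note i = L2_integrable_sq[OF goodD(1)[OF \<theta>]]
  show "integrable lborel (\<lambda>t. (L2_norm M (\<theta> t))\<^sup>2)"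
    unfolding eq by (rule Fubini_integrable[OF i])
  show "(LINT t|lborel. (L2_norm M (\<theta> t))\<^sup>2) = (L2_norm lborel (case_prod \<theta>))\<^sup>2"
    unfolding eq Fubini_integral[OF i] by (simp add: L2_norm_def)
qed

lemma slice_inner_L2:
  assumes \<theta>: "good T \<theta>" and a: "a \<in> L2 M"
  shows "(\<lambda>t. L2_inner M (\<theta> t) a) \<in> L2 lborel"
  unfolding L2_def
proof (safe)
  note m = slice_inner_borel[OF \<theta> a]
  then show "(\<lambda>t. L2_inner M (\<theta> t) a) \<in> borel_measurable lborel" by simp
  show "integrable lborel (\<lambda>t. (L2_inner M (\<theta> t) a)\<^sup>2)"
  proof (rule Bochner_Integration.integrable_bound)
    show "integrable lborel (\<lambda>t. (L2_norm M (\<theta> t))\<^sup>2 * (L2_norm M a)\<^sup>2)"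
      using slice_norm(1)[OF \<theta>] by simp
    show "AE t in lborel. norm ((L2_inner M (\<theta> t) a)\<^sup>2) \<le> norm ((L2_norm M (\<theta> t))\<^sup>2 * (L2_norm M a)\<^sup>2)"
      using power_mono[OF L2_Cauchy_Schwarz[OF goodD(3)[OF \<theta>] a] abs_ge_zero, where n=2]
      by (simp add: power_mult_distrib)
    show "(\<lambda>t. (L2_inner M (\<theta> t) a)\<^sup>2) \<in> borel_measurable lborel" using m by simp
  qed
qed

lemma slice_inner_outside: "good T \<theta> \<Longrightarrow> t \<notin> {0<..<T} \<Longrightarrow> L2_inner M (\<theta> t) a = 0"
  using goodD(6) L2_inner_zero_left by metis

lemma slice_inner_integrable:
  assumes \<theta>: "good T \<theta>" and a: "a \<in> L2 M"
  shows "integrable lborel (\<lambda>t. L2_inner M (\<theta> t) a)"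
proof -
  have "integrable lborel (indicator {0<..<T} :: real \<Rightarrow> real)"
  proof (rule integrable_real_indicator)
    show "emeasure lborel {0<..<T} < \<infinity>" by (rule emeasure_bounded_finite) simp
  qed simp
  moreover have "(\<lambda>t. (indicator {0<..<T} t)\<^sup>2) = (indicator {0<..<T} :: real \<Rightarrow> real)"
    by (auto simp: indicator_def)
  ultimately have "indicator {0<..<T} \<in> L2 (lborel :: real measure)" by (auto simp: L2_def)
  from L2_mult_integrable[OF this slice_inner_L2[OF \<theta> a]]
  have "integrable lborel (\<lambda>t. indicator {0<..<T} t * L2_inner M (\<theta> t) a)" .
  moreover have "indicator {0<..<T} t * L2_inner M (\<theta> t) a = L2_inner M (\<theta> t) a" for t
    using slice_inner_outside[OF \<theta>, of t a] by (cases "t \<in> {0<..<T}") simp_all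
  ultimately show ?thesis by simp
qed

text \<open>Pairing with b in time amounts to pairing \<theta> in space-time with the product of
  b(t) and a(x), which is square integrable.\<close>

lemma slice_inner_weakly:
  assumes \<theta>: "\<And>n. good T (\<theta>s n)" "good T \<theta>" and a: "a \<in> L2 M"
    and c: "L2_converges_weakly lborel (\<lambda>n. case_prod (\<theta>s n)) (case_prod \<theta>)"
  shows "L2_converges_weakly lborel (\<lambda>n t. L2_inner M (\<theta>s n t) a) (\<lambda>t. L2_inner M (\<theta> t) a)"
  unfolding L2_converges_weakly_def
proof (intro conjI allI ballI)
  show "(\<lambda>t. L2_inner M (\<theta>s n t) a) \<in> L2 lborel" for n by (rule slice_inner_L2[OF \<theta>(1) a])
  show "(\<lambda>t. L2_inner M (\<theta> t) a) \<in> L2 lborel" by (rule slice_inner_L2[OF \<theta>(2) a])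
  fix b assume b: "b \<in> L2 (lborel :: real measure)"
  obtain a0 where a0: "a0 \<in> borel_measurable borel" "\<And>x. x \<notin> \<Omega> \<Longrightarrow> a0 x = 0" "AE x in M. a x = a0 x" "a0 \<in> L2 M" "a0 \<in> L2 lborel"
    using L2_representative[OF a] by blast
  have L: "(\<lambda>z. b (fst z) * a0 (snd z)) \<in> L2 lborel" by (rule L2_tensor[OF b a0(5)])
  have "L2_inner lborel (\<lambda>t. L2_inner M (\<theta> t) a) b = L2_inner lborel (case_prod \<theta>) (\<lambda>z. b (fst z) * a0 (snd z))"
    if \<theta>: "good T \<theta>" for \<theta>
  proof -
    have "L2_inner M (\<theta> t) a * b t = (LINT x|lborel. case_prod \<theta> (t, x) * (b (fst (t, x)) * a0 (snd (t, x))))" for t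
    proof -
      have "L2_inner M (\<theta> t) a * b t = (LINT x|lborel. (\<theta> t x * a0 x) * b t)"
        by (simp only: slice_inner_lborel[OF \<theta> a a0(1,3,4)] integral_mult_left_zero)
      also have "\<dots> = (LINT x|lborel. case_prod \<theta> (t, x) * (b (fst (t, x)) * a0 (snd (t, x))))"
        by (rule Bochner_Integration.integral_cong) (simp_all add: mult_ac)
      finally show ?thesis .
    qed
    then show ?thesis
      using Fubini_integral[OF L2_mult_integrable[OF goodD(1)[OF \<theta>] L]] by (simp add: L2_inner_def)
  qed
  then show "(\<lambda>n. L2_inner lborel (\<lambda>t. L2_inner M (\<theta>s n t) a) b) \<longlonglongrightarrow> L2_inner lborel (\<lambda>t. L2_inner M (\<theta> t) a) b"
    using c L \<theta> by (simp add: L2_converges_weakly_def)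
qed

end

section \<open>Passage to the limit\<close>

lemma finite_uniform_bound:
  fixes f :: "'i::finite \<Rightarrow> 'a \<Rightarrow> real"
  assumes "\<And>i. \<exists>c. \<forall>x. \<bar>f i x\<bar> \<le> c"
  shows "\<exists>C. \<forall>i x. \<bar>f i x\<bar> \<le> C"
proof -
  obtain c where c: "\<And>i x. \<bar>f i x\<bar> \<le> c i" using assms by metis
  have "\<bar>f i x\<bar> \<le> (\<Sum>i\<in>UNIV. \<bar>c i\<bar>)" for i x
    using c[of i x] member_le_sum[of i UNIV "\<lambda>i. \<bar>c i\<bar>"] by fastforce
  then show ?thesis by blast
qed

lemma dir_deriv_cmult:
  "f differentiable (at x) \<Longrightarrow> dir_deriv (\<lambda>x. c * f x) v x = c * dir_deriv f v x"
  using has_derivative_mult_right[OF has_derivative_dir_deriv] by (rule dir_deriv_eq)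

lemma space_Basis: "(0, axis (i::2) (1::real)) \<in> (Basis :: (real \<times> (real^2)) set)"
  by (simp add: Basis_prod_def)

lemma time_Basis: "(1, 0) \<in> (Basis :: (real \<times> (real^2)) set)"
  by (simp add: Basis_prod_def)

text \<open>The slices come from one compactly supported function of (t, x), so a single C serves
  every time; the tail bound for \<open>Qform\<close> thereby becomes uniform in t.\<close>

lemma slice_derivative_bounds:
  assumes \<phi>: "\<phi> \<in> test_functions (I \<times> \<Omega>)"
  obtains C :: real where "\<And>t i x. \<bar>dir_deriv (\<lambda>x::real^2. \<phi> (t::real, x)) (axis i 1) x\<bar> \<le> C"
    "\<And>t i k x. \<bar>dir_deriv (dir_deriv (\<lambda>x. \<phi> (t, x)) (axis i 1)) (axis k 1) x\<bar> \<le> C"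
proof -
  let ?d = "\<lambda>i. dir_deriv \<phi> (0, axis i 1)"
  have d: "?d i \<in> test_functions (I \<times> \<Omega>)" for i
    by (rule test_functions_dir_deriv[OF \<phi> space_Basis])
  have dd: "dir_deriv (?d i) (0, axis k 1) \<in> test_functions (I \<times> \<Omega>)" for i k
    by (rule test_functions_dir_deriv[OF d space_Basis])
  obtain C1 where C1: "\<And>i z. \<bar>?d i z\<bar> \<le> C1"
    using finite_uniform_bound[of ?d] test_functions_bounded[OF d] by metis
  have "\<exists>C. \<forall>z. \<bar>dir_deriv (?d (fst p)) (0, axis (snd p) 1) z\<bar> \<le> C" for p
    using test_functions_bounded[OF dd] by metis
  \<comment> \<open>The two indices i and k are packed into one index p of a finite type.\<close>
  from finite_uniform_bound[of "\<lambda>p. dir_deriv (?d (fst p)) (0, axis (snd p) 1)", OF this]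
  obtain C2 where C2: "\<And>p z. \<bar>dir_deriv (?d (fst p)) (0, axis (snd p) 1) z\<bar> \<le> C2" by blast
  have 1: "dir_deriv (\<lambda>x. \<phi> (t, x)) (axis i 1) = (\<lambda>x. ?d i (t, x))" for t i
    by (rule slice_dir_deriv[OF test_functions_smooth[OF \<phi>]])
  have 2: "dir_deriv (dir_deriv (\<lambda>x. \<phi> (t, x)) (axis i 1)) (axis k 1) x = dir_deriv (?d i) (0, axis k 1) (t, x)" for t i k x
    unfolding 1 slice_dir_deriv[OF test_functions_smooth[OF d]] ..
  show thesis
  proof (rule that[of "max C1 C2"])
    show "\<bar>dir_deriv (\<lambda>x. \<phi> (t, x)) (axis i 1) x\<bar> \<le> max C1 C2" for t i x
      unfolding 1 using C1[of i "(t, x)"] by simp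
    show "\<bar>dir_deriv (dir_deriv (\<lambda>x. \<phi> (t, x)) (axis i 1)) (axis k 1) x\<bar> \<le> max C1 C2" for t i k x
      unfolding 2 using C2[of "(i, k)" "(t, x)"] by simp
  qed
qed

context dirichlet_domain
begin

text \<open>Measurability in t is read off from a parameter integral over \<open>lborel\<close>,
  after the eigenfunction and the partials have been replaced by Borel representatives independent
  of t.\<close>

lemma Dmat_borel:
  assumes \<phi>: "\<phi> \<in> test_functions (I \<times> \<Omega>)"
  shows "(\<lambda>t::real. Dmat (\<lambda>x. \<phi> (t, x)) j k) \<in> borel_measurable borel"
proof -
  obtain w0 where w0: "w0 \<in> borel_measurable borel" "\<And>x. x \<notin> \<Omega> \<Longrightarrow> w0 x = 0" "AE x in M. w j x = w0 x" "w0 \<in> L2 M" "w0 \<in> L2 lborel"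
    using L2_representative[OF eigenfunction_L2] by blast
  obtain g1 where g1: "g1 \<in> borel_measurable borel" "\<And>x. x \<notin> \<Omega> \<Longrightarrow> g1 x = 0" "AE x in M. G 1 k x = g1 x" "g1 \<in> L2 M" "g1 \<in> L2 lborel"
    using L2_representative[OF G_L2] by blast
  obtain g2 where g2: "g2 \<in> borel_measurable borel" "\<And>x. x \<notin> \<Omega> \<Longrightarrow> g2 x = 0" "AE x in M. G 2 k x = g2 x" "g2 \<in> L2 M" "g2 \<in> L2 lborel"
    using L2_representative[OF G_L2] by blast
  let ?d = "\<lambda>i. dir_deriv \<phi> (0, axis (i::2) 1)"
  have sb: "(snd :: real \<times> (real^2) \<Rightarrow> real^2) \<in> borel_measurable borel"
    by (intro borel_measurable_continuous_onI continuous_intros)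
  have db: "?d i \<in> borel_measurable borel" for i
    by (intro smooth_borel_measurable test_functions_smooth[OF test_functions_dir_deriv[OF \<phi> space_Basis]])
  have eq: "Dmat (\<lambda>x. \<phi> (t, x)) j k = (LINT x|lborel. w0 (snd (t, x)) * (?d 2 (t, x) * g1 (snd (t, x)) - ?d 1 (t, x) * g2 (snd (t, x))))" for t
  proof -
    let ?\<phi> = "\<lambda>x. \<phi> (t, x)"
    note \<phi>t = slice_test_function[OF \<phi>, of t]
    have tr0: "tr ?\<phi> g1 g2 = (\<lambda>x. ?d 2 (t, x) * g1 x - ?d 1 (t, x) * g2 x)"
      by (simp add: tr_def slice_dir_deriv[OF test_functions_smooth[OF \<phi>]])
    have "Dmat ?\<phi> j k = L2_inner M w0 (tr ?\<phi> (G 1 k) (G 2 k))"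
      unfolding Dmat_def by (intro L2_inner_AE_cong L2_measurable eigenfunction_L2 w0 tr_L2[OF \<phi>t] G_L2)
    also have "\<dots> = L2_inner M w0 (tr ?\<phi> g1 g2)"
    proof -
      have "AE x in M. tr ?\<phi> (G 1 k) (G 2 k) x = tr ?\<phi> g1 g2 x"
        using g1(3) g2(3) by eventually_elim (simp add: tr_def)
      then show ?thesis
        unfolding L2_inner_commute[of M w0]
        by (intro L2_inner_AE_cong L2_measurable w0(4) tr_L2[OF \<phi>t] G_L2 g1(4) g2(4))
    qed
    also have "\<dots> = L2_inner lborel w0 (tr ?\<phi> g1 g2)"
    proof (rule L2_inner_lebesgue_on_borel[OF domain_borel w0(1) _ w0(2)])
      show "tr ?\<phi> g1 g2 \<in> borel_measurable borel"
        unfolding tr0 using slice_borel[OF db] g1(1) g2(1) by (intro borel_measurable_diff borel_measurable_times) auto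
    qed
    finally show ?thesis by (simp add: tr0 L2_inner_def)
  qed
  show ?thesis
    unfolding eq by (rule integral_borel)
      (intro borel_measurable_diff borel_measurable_times db measurable_compose[OF sb] w0(1) g1(1) g2(1))
qed

lemma cf_borel: "good T \<theta> \<Longrightarrow> (\<lambda>t. cf (\<theta> t) j) \<in> borel_measurable borel"
  unfolding cf_def by (rule slice_inner_borel[OF _ eigenfunction_L2])

lemma cf_L2: "good T \<theta> \<Longrightarrow> (\<lambda>t. cf (\<theta> t) j) \<in> L2 lborel"
  unfolding cf_def by (rule slice_inner_L2[OF _ eigenfunction_L2])

lemma cf_bound:
  assumes "f \<in> L2 M" shows "\<bar>cf f j\<bar> \<le> L2_norm M f"
proof -
  have "(L2_norm M (w j))\<^sup>2 = 1\<^sup>2" by (simp add: L2_norm_sq orthonormal)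
  then have "L2_norm M (w j) = 1" by (rule power2_eq_imp_eq[OF _ L2_norm_nonneg zero_le_one])
  then show ?thesis using L2_Cauchy_Schwarz[OF assms eigenfunction_L2, of j] by (simp add: cf_def)
qed

lemma Qsum_borel:
  assumes "good T \<theta>" "\<phi> \<in> test_functions (I \<times> \<Omega>)"
  shows "(\<lambda>t. Qsum (\<lambda>x. \<phi> (t, x)) (cf (\<theta> t)) n) \<in> borel_measurable borel"
  unfolding Qsum_def divide_inverse
  by (intro borel_measurable_sum borel_measurable_times cf_borel[OF assms(1)] Dmat_borel[OF assms(2)] borel_measurable_const)

text \<open>The potential is chosen separately at each time, so joint measurability of the integrand
  is not at hand; measurability in t is inherited from the finite sums \<open>Qsum\<close>.\<close>

lemma Qform_borel:
  assumes "good T \<theta>" "\<phi> \<in> test_functions (I \<times> \<Omega>)"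
  shows "(\<lambda>t. Qform (\<lambda>x. \<phi> (t, x)) (\<theta> t)) \<in> borel_measurable borel"
  by (rule borel_measurable_LIMSEQ_real[OF Qsum_limit Qsum_borel[OF assms]])
    (intro slice_test_function[OF assms(2)] goodD(3)[OF assms(1)])+

lemma Qform_integrable:
  assumes \<theta>: "good T \<theta>" and \<phi>: "\<phi> \<in> test_functions (I \<times> \<Omega>)"
  shows "integrable lborel (\<lambda>t. Qform (\<lambda>x. \<phi> (t, x)) (\<theta> t))"
proof -
  obtain C where C: "\<And>t i x. \<bar>dir_deriv (\<lambda>x. \<phi> (t, x)) (axis i 1) x\<bar> \<le> C"
    using slice_derivative_bounds[OF \<phi>] by metis
  show ?thesis
  proof (rule Bochner_Integration.integrable_bound)
    show "integrable lborel (\<lambda>t. 2 * C * (L2_norm M (\<theta> t))\<^sup>2)"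
      using slice_norm(1)[OF \<theta>] by (intro integrable_mult_right)
    show "AE t in lborel. norm (Qform (\<lambda>x. \<phi> (t, x)) (\<theta> t)) \<le> norm (2 * C * (L2_norm M (\<theta> t))\<^sup>2)"
      unfolding real_norm_def
      by (intro AE_I2 order_trans[OF Qform_bound[OF slice_test_function[OF \<phi>] goodD(3)[OF \<theta>] C] abs_ge_self])
  qed (use Qform_borel[OF assms] in simp)
qed

lemma Dmat_slice_bound:
  assumes \<phi>: "\<phi> \<in> test_functions (I \<times> \<Omega>)"
  shows "\<exists>C. \<forall>t::real. \<bar>Dmat (\<lambda>x. \<phi> (t, x)) j k\<bar> \<le> C"
proof -
  obtain C where C: "\<And>t i x. \<bar>dir_deriv (\<lambda>x. \<phi> (t::real, x)) (axis i 1) x\<bar> \<le> C"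
    using slice_derivative_bounds[OF \<phi>] by metis
  show ?thesis using Dmat_bound[OF slice_test_function[OF \<phi>] C] by blast
qed

lemma Qsum_term_integrable:
  assumes \<theta>: "good T \<theta>" and \<phi>: "\<phi> \<in> test_functions (I \<times> \<Omega>)"
  shows "integrable lborel (\<lambda>t. Dmat (\<lambda>x. \<phi> (t, x)) j k / lam k * cf (\<theta> t) j * cf (\<theta> t) k)"
proof -
  obtain C where C: "\<And>t. \<bar>Dmat (\<lambda>x. \<phi> (t, x)) j k\<bar> \<le> C" using Dmat_slice_bound[OF \<phi>] by blast
  have "(\<lambda>t. Dmat (\<lambda>x. \<phi> (t, x)) j k * cf (\<theta> t) j) \<in> L2 lborel"
    by (rule L2_bounded_mult[OF cf_L2[OF \<theta>] _ C]) (use Dmat_borel[OF \<phi>] in simp)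
  from L2_mult_integrable[OF this cf_L2[OF \<theta>, of k]]
  have "integrable lborel (\<lambda>t. (1 / lam k) * (Dmat (\<lambda>x. \<phi> (t, x)) j k * cf (\<theta> t) j * cf (\<theta> t) k))"
    by (rule integrable_mult_right)
  then show ?thesis by simp
qed

lemma Qsum_integral:
  assumes \<theta>: "good T \<theta>" and \<phi>: "\<phi> \<in> test_functions (I \<times> \<Omega>)"
  shows "integrable lborel (\<lambda>t. Qsum (\<lambda>x. \<phi> (t, x)) (cf (\<theta> t)) n)"
    and "(LINT t|lborel. Qsum (\<lambda>x. \<phi> (t, x)) (cf (\<theta> t)) n)
      = (\<Sum>j<n. \<Sum>k<n. LINT t|lborel. Dmat (\<lambda>x. \<phi> (t, x)) j k / lam k * cf (\<theta> t) j * cf (\<theta> t) k)"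
proof -
  have eq: "Qsum (\<lambda>x. \<phi> (t, x)) (cf (\<theta> t)) n
    = (\<Sum>j<n. \<Sum>k<n. Dmat (\<lambda>x. \<phi> (t, x)) j k / lam k * cf (\<theta> t) j * cf (\<theta> t) k)" for t
    unfolding Qsum_def by (intro sum.cong refl) (simp add: mult_ac)
  show "integrable lborel (\<lambda>t. Qsum (\<lambda>x. \<phi> (t, x)) (cf (\<theta> t)) n)"
    unfolding eq by (intro Bochner_Integration.integrable_sum Qsum_term_integrable[OF \<theta> \<phi>])
  have 1: "integrable lborel (\<lambda>t. \<Sum>k<n. Dmat (\<lambda>x. \<phi> (t, x)) j k / lam k * cf (\<theta> t) j * cf (\<theta> t) k)" for j
    by (intro Bochner_Integration.integrable_sum Qsum_term_integrable[OF \<theta> \<phi>])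
  show "(LINT t|lborel. Qsum (\<lambda>x. \<phi> (t, x)) (cf (\<theta> t)) n)
      = (\<Sum>j<n. \<Sum>k<n. LINT t|lborel. Dmat (\<lambda>x. \<phi> (t, x)) j k / lam k * cf (\<theta> t) j * cf (\<theta> t) k)"
    unfolding eq Bochner_Integration.integral_sum[OF 1] Bochner_Integration.integral_sum[OF Qsum_term_integrable[OF \<theta> \<phi>]] ..
qed

text \<open>The left side of the weak formulation for good representatives. The linear term is a
  space-time pairing, ready for weak convergence; the transport term stays an iterated integral, as
  its velocity is chosen slice by slice.\<close>

definition wform :: "(real \<Rightarrow> real^2 \<Rightarrow> real) \<Rightarrow> (real \<times> (real^2) \<Rightarrow> real) \<Rightarrow> real" where
  "wform \<theta> \<phi> = L2_inner lborel (case_prod \<theta>) (dir_deriv \<phi> (1, 0))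
     + (LINT t|lborel. Qform (\<lambda>x. \<phi> (t, x)) (\<theta> t))"

lemma Qform_cmult:
  assumes "smooth \<eta>" shows "Qform (\<lambda>x. c * \<eta> x) f = c * Qform \<eta> f"
proof -
  have "tr (\<lambda>x. c * \<eta> x) f1 f2 = (\<lambda>x. c * tr \<eta> f1 f2 x)" for f1 f2
    by (simp add: tr_def dir_deriv_cmult[OF smooth_differentiable[OF assms]] algebra_simps)
  then show ?thesis by (simp add: Qform_def L2_inner_cmult_right)
qed

text \<open>Where \<open>wform\<close> vanishes on such products, the pairing of \<theta> with
  \<eta> in space has weak time derivative \<open>Qform \<eta> (\<theta> t)\<close>; this is the
  input to compactness in time.\<close>

lemma wform_tensor:
  assumes \<theta>: "good T \<theta>" and \<xi>: "\<xi> \<in> test_functions {0<..<T}" and \<eta>: "\<eta> \<in> test_functions \<Omega>"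
  shows "wform \<theta> (\<lambda>z. \<xi> (fst z) * \<eta> (snd z))
    = (LINT t|lborel. dir_deriv \<xi> 1 t * L2_inner M (\<theta> t) \<eta>) + (LINT t|lborel. \<xi> t * Qform \<eta> (\<theta> t))"
proof -
  let ?\<phi> = "\<lambda>z. \<xi> (fst z) * \<eta> (snd z)"
  have \<phi>: "?\<phi> \<in> test_functions ({0<..<T} \<times> \<Omega>)" by (rule tensor_test_function(1)[OF \<xi> \<eta>])
  have L: "dir_deriv ?\<phi> (1, 0) \<in> L2 lborel"
    by (rule test_function_L2_lborel[OF test_functions_dir_deriv[OF \<phi> time_Basis]])
  note \<eta>b = smooth_borel_measurable[OF test_functions_smooth[OF \<eta>]]
  have "dir_deriv \<xi> 1 t * L2_inner M (\<theta> t) \<eta> = (LINT x|lborel. case_prod \<theta> (t, x) * dir_deriv ?\<phi> (1, 0) (t, x))" for t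
  proof -
    have "dir_deriv \<xi> 1 t * L2_inner M (\<theta> t) \<eta> = (LINT x|lborel. dir_deriv \<xi> 1 t * (\<theta> t x * \<eta> x))"
      unfolding slice_inner_lborel[OF \<theta> L2_test_function[OF \<eta>] \<eta>b AE_I2[OF refl] L2_test_function[OF \<eta>]]
      by (simp only: integral_mult_right_zero)
    also have "\<dots> = (LINT x|lborel. case_prod \<theta> (t, x) * dir_deriv ?\<phi> (1, 0) (t, x))"
      unfolding case_prod_conv tensor_test_function(2)[OF \<xi> \<eta>] by (simp only: mult_ac)
    finally show ?thesis .
  qed
  then have "L2_inner lborel (case_prod \<theta>) (dir_deriv ?\<phi> (1, 0)) = (LINT t|lborel. dir_deriv \<xi> 1 t * L2_inner M (\<theta> t) \<eta>)"
    using Fubini_integral[OF L2_mult_integrable[OF goodD(1)[OF \<theta>] L]] by (simp add: L2_inner_def)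
  then show ?thesis by (simp add: wform_def Qform_cmult[OF test_functions_smooth[OF \<eta>]])
qed

lemma Qform_time_borel:
  assumes \<theta>: "good T \<theta>" and \<eta>: "\<eta> \<in> test_functions \<Omega>"
  shows "(\<lambda>t. Qform \<eta> (\<theta> t)) \<in> borel_measurable borel"
proof (rule borel_measurable_LIMSEQ_real)
  show "(\<lambda>n. Qsum \<eta> (cf (\<theta> t)) n) \<longlonglongrightarrow> Qform \<eta> (\<theta> t)" for t
    by (rule Qsum_limit[OF \<eta> goodD(3)[OF \<theta>]])
  show "(\<lambda>t. Qsum \<eta> (cf (\<theta> t)) n) \<in> borel_measurable borel" for n
    unfolding Qsum_def by (intro borel_measurable_sum borel_measurable_times cf_borel[OF \<theta>] borel_measurable_const)
qed

text \<open>The bound is quadratic in \<theta> and hence lies in L^1 of time; this is why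
  compactness in time starts from a merely integrable derivative.\<close>

lemma Qform_time_integrable:
  assumes \<theta>: "good T \<theta>" and \<eta>: "\<eta> \<in> test_functions \<Omega>" and C: "\<And>i x. \<bar>dir_deriv \<eta> (axis i 1) x\<bar> \<le> C"
  shows "integrable lborel (\<lambda>t. Qform \<eta> (\<theta> t))"
    and "(LINT t|lborel. \<bar>Qform \<eta> (\<theta> t)\<bar>) \<le> 2 * C * (L2_norm lborel (case_prod \<theta>))\<^sup>2"
proof -
  have b: "\<bar>Qform \<eta> (\<theta> t)\<bar> \<le> 2 * C * (L2_norm M (\<theta> t))\<^sup>2" for t
    by (rule Qform_bound[OF \<eta> goodD(3)[OF \<theta>] C])
  have i: "integrable lborel (\<lambda>t. 2 * C * (L2_norm M (\<theta> t))\<^sup>2)"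
    using slice_norm(1)[OF \<theta>] by (intro integrable_mult_right)
  show 1: "integrable lborel (\<lambda>t. Qform \<eta> (\<theta> t))"
    by (rule Bochner_Integration.integrable_bound[OF i])
      (use Qform_time_borel[OF \<theta> \<eta>] order_trans[OF b abs_ge_self] in auto)
  have "(LINT t|lborel. \<bar>Qform \<eta> (\<theta> t)\<bar>) \<le> (LINT t|lborel. 2 * C * (L2_norm M (\<theta> t))\<^sup>2)"
    using 1 by (intro integral_mono i b) auto
  also have "\<dots> = 2 * C * (L2_norm lborel (case_prod \<theta>))\<^sup>2"
    by (simp only: integral_mult_right_zero slice_norm(2)[OF \<theta>])
  finally show "(LINT t|lborel. \<bar>Qform \<eta> (\<theta> t)\<bar>) \<le> 2 * C * (L2_norm lborel (case_prod \<theta>))\<^sup>2" .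
qed

context
  fixes T :: real and \<theta>s :: "nat \<Rightarrow> real \<Rightarrow> real^2 \<Rightarrow> real" and \<theta> :: "real \<Rightarrow> real^2 \<Rightarrow> real"
  assumes T: "T > 0" and good_s: "\<And>n. good T (\<theta>s n)" and good_l: "good T \<theta>"
    and weakly: "L2_converges_weakly lborel (\<lambda>n. case_prod (\<theta>s n)) (case_prod \<theta>)"
    and solution: "\<And>n \<phi>. \<phi> \<in> test_functions ({0<..<T} \<times> \<Omega>) \<Longrightarrow> wform (\<theta>s n) \<phi> = 0"
begin

lemma norm_bound:
  obtains B where "B \<ge> 0" "\<And>n. L2_norm lborel (case_prod (\<theta>s n)) \<le> B" "L2_norm lborel (case_prod \<theta>) \<le> B"
proof -
  obtain B where B: "\<And>n. L2_norm lborel (case_prod (\<theta>s n)) \<le> B"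
    using L2_weakly_converges_bounded[OF weakly] by blast
  moreover have "B \<ge> 0" using B[of 0] L2_norm_nonneg[of lborel "case_prod (\<theta>s 0)"] by linarith
  ultimately show thesis using that L2_weak_limit_norm_le[OF weakly B] by blast
qed

text \<open>The eigenfunction \<open>w j\<close> need not be compactly supported, so the equation
  cannot be tested with it; a test function \<eta> replaces it at a cost uniform in n. Only the
  first coefficient is treated so: one compact factor is enough, and the other converges
  weakly.\<close>

lemma coefficient_product_limit:
  assumes K: "K \<in> borel_measurable borel" "\<And>t. \<bar>K t\<bar> \<le> C"
  shows "(\<lambda>n. LINT t|lborel. K t * cf (\<theta>s n t) j * cf (\<theta>s n t) k)
    \<longlonglongrightarrow> (LINT t|lborel. K t * cf (\<theta> t) j * cf (\<theta> t) k)"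
proof (rule LIMSEQ_approx)
  fix e :: real assume e: "e > 0"
  have C0: "0 \<le> C" using K(2)[of 0] by linarith
  obtain B where B: "B \<ge> 0" "\<And>n. L2_norm lborel (case_prod (\<theta>s n)) \<le> B" "L2_norm lborel (case_prod \<theta>) \<le> B"
    using norm_bound by blast
  \<comment> \<open>The summand 1 keeps the denominator positive when C or B is 0.\<close>
  define r where "r = e / (C * B\<^sup>2 + 1)"
  have CB: "0 < C * B\<^sup>2 + 1" using C0 by (simp add: add_nonneg_pos)
  have r: "r > 0" "C * B\<^sup>2 * r \<le> e"
  proof -
    show "r > 0" using e CB by (simp add: r_def)
    have "C * B\<^sup>2 * e \<le> (C * B\<^sup>2 + 1) * e" using e by (intro mult_right_mono) auto
    then show "C * B\<^sup>2 * r \<le> e" using CB by (simp add: r_def pos_divide_le_eq mult.commute)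
  qed
  obtain \<eta> where \<eta>: "\<eta> \<in> test_functions \<Omega>" "L2_norm M (\<lambda>x. w j x - \<eta> x) < r"
    using approximable_eigenfunction[of j] r(1) L2_norm_minus_commute[of M "w j"] unfolding approximable_def by metis
  note \<eta>L = L2_test_function[OF \<eta>(1)]
  obtain C1 where C1: "\<And>i x. \<bar>dir_deriv \<eta> (axis (i::2) 1) x\<bar> \<le> C1"
    using finite_uniform_bound[of "\<lambda>i. dir_deriv \<eta> (axis (i::2) 1)"]
      test_functions_bounded[OF test_functions_dir_deriv[OF \<eta>(1) axis_Basis]] by metis
  have C10: "0 \<le> C1" using C1[of 1 0] by linarith
  have KL: "(\<lambda>t. K t * a t) \<in> L2 lborel" if "a \<in> L2 lborel" for a
    using L2_bounded_mult[OF that, of K C] K by simp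
  have err: "\<bar>(LINT t|lborel. K t * cf (\<Theta> t) j * cf (\<Theta> t) k) - (LINT t|lborel. K t * L2_inner M (\<Theta> t) \<eta> * cf (\<Theta> t) k)\<bar> \<le> e"
    if \<Theta>: "good T \<Theta>" "L2_norm lborel (case_prod \<Theta>) \<le> B" for \<Theta>
  proof -
    note i1 = L2_mult_integrable[OF KL[OF cf_L2[OF \<Theta>(1), of j]] cf_L2[OF \<Theta>(1), of k]]
    note i2 = L2_mult_integrable[OF KL[OF slice_inner_L2[OF \<Theta>(1) \<eta>L]] cf_L2[OF \<Theta>(1), of k]]
    have "\<bar>(LINT t|lborel. K t * cf (\<Theta> t) j * cf (\<Theta> t) k) - (LINT t|lborel. K t * L2_inner M (\<Theta> t) \<eta> * cf (\<Theta> t) k)\<bar>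
      = \<bar>LINT t|lborel. K t * cf (\<Theta> t) j * cf (\<Theta> t) k - K t * L2_inner M (\<Theta> t) \<eta> * cf (\<Theta> t) k\<bar>"
      by (simp only: Bochner_Integration.integral_diff[OF i1 i2])
    also have "\<dots> \<le> (LINT t|lborel. \<bar>K t * cf (\<Theta> t) j * cf (\<Theta> t) k - K t * L2_inner M (\<Theta> t) \<eta> * cf (\<Theta> t) k\<bar>)"
      by (rule integral_abs_bound)
    also have "\<dots> \<le> (LINT t|lborel. C * r * (L2_norm M (\<Theta> t))\<^sup>2)"
    proof (rule integral_mono')
      show "integrable lborel (\<lambda>t. C * r * (L2_norm M (\<Theta> t))\<^sup>2)"
        using slice_norm(1)[OF \<Theta>(1)] by (intro integrable_mult_right)
      show "\<bar>K t * cf (\<Theta> t) j * cf (\<Theta> t) k - K t * L2_inner M (\<Theta> t) \<eta> * cf (\<Theta> t) k\<bar> \<le> C * r * (L2_norm M (\<Theta> t))\<^sup>2" for t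
      proof -
        note \<Theta>L = goodD(3)[OF \<Theta>(1), of t]
        have "\<bar>L2_inner M (\<Theta> t) (\<lambda>x. w j x - \<eta> x)\<bar> \<le> L2_norm M (\<Theta> t) * r"
          by (rule order_trans[OF L2_Cauchy_Schwarz[OF \<Theta>L L2_diff[OF eigenfunction_L2 \<eta>L]]])
            (intro mult_left_mono less_imp_le[OF \<eta>(2)] L2_norm_nonneg)
        then have 1: "\<bar>cf (\<Theta> t) j - L2_inner M (\<Theta> t) \<eta>\<bar> \<le> L2_norm M (\<Theta> t) * r"
          by (simp add: cf_def L2_inner_diff_right \<Theta>L \<eta>L eigenfunction_L2)
        have "\<bar>K t * cf (\<Theta> t) j * cf (\<Theta> t) k - K t * L2_inner M (\<Theta> t) \<eta> * cf (\<Theta> t) k\<bar>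
          = \<bar>K t\<bar> * \<bar>cf (\<Theta> t) j - L2_inner M (\<Theta> t) \<eta>\<bar> * \<bar>cf (\<Theta> t) k\<bar>"
          by (simp add: abs_mult[symmetric] algebra_simps)
        also have "\<dots> \<le> C * (L2_norm M (\<Theta> t) * r) * L2_norm M (\<Theta> t)"
          using K(2) 1 cf_bound[OF \<Theta>L] C0 r(1) by (intro mult_mono) auto
        finally show ?thesis by (simp add: power2_eq_square mult_ac)
      qed
      show "0 \<le> C * r * (L2_norm M (\<Theta> t))\<^sup>2" for t using C0 r(1) by simp
    qed
    also have "\<dots> = C * r * (L2_norm lborel (case_prod \<Theta>))\<^sup>2"
      by (simp only: integral_mult_right_zero slice_norm(2)[OF \<Theta>(1)])
    also have "\<dots> \<le> C * r * B\<^sup>2"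
      using \<Theta>(2) C0 r(1) by (intro mult_left_mono power_mono) auto
    also have "\<dots> \<le> e" using r(2) by (simp add: mult_ac)
    finally show ?thesis .
  qed
  have "(\<lambda>n. LINT t|lborel. K t * L2_inner M (\<theta>s n t) \<eta> * cf (\<theta>s n t) k)
      \<longlonglongrightarrow> (LINT t|lborel. K t * L2_inner M (\<theta> t) \<eta> * cf (\<theta> t) k)"
  proof (rule time_compactness[OF T _ _ _ _ _ _ _ K, where h="\<lambda>n t. Qform \<eta> (\<theta>s n t)" and V="2 * C1 * B\<^sup>2"])
    show "integrable lborel (\<lambda>t. L2_inner M (\<theta>s n t) \<eta>)" for n by (rule slice_inner_integrable[OF good_s \<eta>L])
    show "L2_inner M (\<theta>s n t) \<eta> = 0" if "t \<notin> {0<..<T}" for n t by (rule slice_inner_outside[OF good_s that])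
    show "integrable lborel (\<lambda>t. Qform \<eta> (\<theta>s n t))" for n by (rule Qform_time_integrable(1)[OF good_s \<eta>(1) C1])
    have "2 * C1 * (L2_norm lborel (case_prod (\<theta>s n)))\<^sup>2 \<le> 2 * C1 * B\<^sup>2" for n
      using B C10 by (intro mult_left_mono power_mono) auto
    then show "(LINT t|lborel. \<bar>Qform \<eta> (\<theta>s n t)\<bar>) \<le> 2 * C1 * B\<^sup>2" for n
      using Qform_time_integrable(2)[OF good_s \<eta>(1) C1] order_trans by blast
    show "(LINT t|lborel. dir_deriv \<xi> 1 t * L2_inner M (\<theta>s n t) \<eta>) + (LINT t|lborel. \<xi> t * Qform \<eta> (\<theta>s n t)) = 0"
      if \<xi>: "\<xi> \<in> test_functions {0<..<T}" for n \<xi>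
      using wform_tensor[OF good_s \<xi> \<eta>(1)] solution[OF tensor_test_function(1)[OF \<xi> \<eta>(1)]] by simp
    show "L2_converges_weakly lborel (\<lambda>n t. L2_inner M (\<theta>s n t) \<eta>) (\<lambda>t. L2_inner M (\<theta> t) \<eta>)"
      by (rule slice_inner_weakly[OF good_s good_l \<eta>L weakly])
    show "L2_converges_weakly lborel (\<lambda>n t. cf (\<theta>s n t) k) (\<lambda>t. cf (\<theta> t) k)"
      unfolding cf_def by (rule slice_inner_weakly[OF good_s good_l eigenfunction_L2 weakly])
  qed
  then show "\<exists>y y0. y \<longlonglongrightarrow> y0
      \<and> (\<forall>n. \<bar>(LINT t|lborel. K t * cf (\<theta>s n t) j * cf (\<theta>s n t) k) - y n\<bar> \<le> e)
      \<and> \<bar>(LINT t|lborel. K t * cf (\<theta> t) j * cf (\<theta> t) k) - y0\<bar> \<le> e"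
    using err[OF good_s B(2)] err[OF good_l B(3)] by blast
qed

lemma Qform_integral_limit:
  assumes \<phi>: "\<phi> \<in> test_functions ({0<..<T} \<times> \<Omega>)"
  shows "(\<lambda>n. LINT t|lborel. Qform (\<lambda>x. \<phi> (t, x)) (\<theta>s n t)) \<longlonglongrightarrow> (LINT t|lborel. Qform (\<lambda>x. \<phi> (t, x)) (\<theta> t))"
proof (rule LIMSEQ_approx)
  fix e :: real assume e: "e > 0"
  obtain C where C: "\<And>t i k x. \<bar>dir_deriv (dir_deriv (\<lambda>x. \<phi> (t, x)) (axis i 1)) (axis k 1) x\<bar> \<le> C"
    using slice_derivative_bounds[OF \<phi>] by metis
  have C0: "0 \<le> C" using C[of 0 1 1 0] by linarith
  obtain B where B: "B \<ge> 0" "\<And>n. L2_norm lborel (case_prod (\<theta>s n)) \<le> B" "L2_norm lborel (case_prod \<theta>) \<le> B"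
    using norm_bound by blast
  \<comment> \<open>The eigenvalues tend to infinity, so N can be taken with 8 C B^2 / lam N \<le>
    e; it depends on the common norm bound B but not on n.\<close>
  obtain N where N: "8 * C * B\<^sup>2 / e \<le> lam N"
    using lam_limit unfolding filterlim_at_top eventually_sequentially by blast
  have small: "8 * C / lam N * B\<^sup>2 \<le> e"
    using N e lam_pos[of N] by (simp add: pos_divide_le_eq mult.commute)
  let ?Q = "\<lambda>\<Theta> t. Qform (\<lambda>x. \<phi> (t, x)) (\<Theta> t)" and ?S = "\<lambda>\<Theta> t. Qsum (\<lambda>x. \<phi> (t, x)) (cf (\<Theta> t)) N"
  have err: "\<bar>(LINT t|lborel. ?Q \<Theta> t) - (LINT t|lborel. ?S \<Theta> t)\<bar> \<le> e"
    if \<Theta>: "good T \<Theta>" "L2_norm lborel (case_prod \<Theta>) \<le> B" for \<Theta>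
  proof -
    have "\<bar>(LINT t|lborel. ?Q \<Theta> t) - (LINT t|lborel. ?S \<Theta> t)\<bar> = \<bar>LINT t|lborel. ?Q \<Theta> t - ?S \<Theta> t\<bar>"
      by (simp only: Bochner_Integration.integral_diff[OF Qform_integrable[OF \<Theta>(1) \<phi>] Qsum_integral(1)[OF \<Theta>(1) \<phi>]])
    also have "\<dots> \<le> (LINT t|lborel. \<bar>?Q \<Theta> t - ?S \<Theta> t\<bar>)" by (rule integral_abs_bound)
    also have "\<dots> \<le> (LINT t|lborel. 8 * C / lam N * (L2_norm M (\<Theta> t))\<^sup>2)"
    proof (rule integral_mono')
      show "integrable lborel (\<lambda>t. 8 * C / lam N * (L2_norm M (\<Theta> t))\<^sup>2)"
        using slice_norm(1)[OF \<Theta>(1)] by (intro integrable_mult_right)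
      show "\<bar>?Q \<Theta> t - ?S \<Theta> t\<bar> \<le> 8 * C / lam N * (L2_norm M (\<Theta> t))\<^sup>2" for t
        by (rule order_trans[OF Qform_tail_bound[OF slice_test_function[OF \<phi>] goodD(3)[OF \<Theta>(1)] C]]) simp
      show "0 \<le> 8 * C / lam N * (L2_norm M (\<Theta> t))\<^sup>2" for t
        using C0 lam_pos[of N] by simp
    qed
    also have "\<dots> = 8 * C / lam N * (L2_norm lborel (case_prod \<Theta>))\<^sup>2"
      by (simp only: integral_mult_right_zero slice_norm(2)[OF \<Theta>(1)])
    also have "\<dots> \<le> 8 * C / lam N * B\<^sup>2"
      using \<Theta>(2) C0 lam_pos[of N] by (intro mult_left_mono power_mono) auto
    finally show ?thesis using small by linarith
  qed
  have "(\<lambda>n. LINT t|lborel. Dmat (\<lambda>x. \<phi> (t, x)) j k / lam k * cf (\<theta>s n t) j * cf (\<theta>s n t) k)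
      \<longlonglongrightarrow> (LINT t|lborel. Dmat (\<lambda>x. \<phi> (t, x)) j k / lam k * cf (\<theta> t) j * cf (\<theta> t) k)" for j k
  proof -
    obtain D where D: "\<And>t. \<bar>Dmat (\<lambda>x. \<phi> (t, x)) j k\<bar> \<le> D" using Dmat_slice_bound[OF \<phi>] by blast
    show ?thesis
    proof (rule coefficient_product_limit)
      show "(\<lambda>t. Dmat (\<lambda>x. \<phi> (t, x)) j k / lam k) \<in> borel_measurable borel"
        using Dmat_borel[OF \<phi>] by simp
      show "\<bar>Dmat (\<lambda>x. \<phi> (t, x)) j k / lam k\<bar> \<le> D / lam k" for t
        using D[of t] lam_pos[of k] by (simp add: abs_divide divide_right_mono)
    qed
  qed
  then have "(\<lambda>n. LINT t|lborel. ?S (\<theta>s n) t) \<longlonglongrightarrow> (LINT t|lborel. ?S \<theta> t)"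
    unfolding Qsum_integral(2)[OF good_s \<phi>] Qsum_integral(2)[OF good_l \<phi>] by (intro tendsto_sum)
  then show "\<exists>y y0. y \<longlonglongrightarrow> y0 \<and> (\<forall>n. \<bar>(LINT t|lborel. ?Q (\<theta>s n) t) - y n\<bar> \<le> e)
      \<and> \<bar>(LINT t|lborel. ?Q \<theta> t) - y0\<bar> \<le> e"
    using err[OF good_s B(2)] err[OF good_l B(3)] by blast
qed

lemma wform_limit:
  assumes \<phi>: "\<phi> \<in> test_functions ({0<..<T} \<times> \<Omega>)"
  shows "wform \<theta> \<phi> = 0"
proof -
  have "dir_deriv \<phi> (1, 0) \<in> L2 lborel"
    by (rule test_function_L2_lborel[OF test_functions_dir_deriv[OF \<phi> time_Basis]])
  then have "(\<lambda>n. L2_inner lborel (case_prod (\<theta>s n)) (dir_deriv \<phi> (1, 0)))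
      \<longlonglongrightarrow> L2_inner lborel (case_prod \<theta>) (dir_deriv \<phi> (1, 0))"
    using weakly by (simp add: L2_converges_weakly_def)
  from tendsto_add[OF this Qform_integral_limit[OF \<phi>]]
  have "(\<lambda>n. wform (\<theta>s n) \<phi>) \<longlonglongrightarrow> wform \<theta> \<phi>" by (simp add: wform_def)
  then show ?thesis by (simp add: solution[OF \<phi>] LIMSEQ_const_iff)
qed

end

text \<open>For almost every t the two slices agree almost everywhere in space; their potentials
  then coincide as functions by \<open>Lambda_inv_cong\<close>, so the inner integrals are
  equal.\<close>

lemma sqg_weak_solution_iff_wform:
  assumes L: "(\<lambda>(t, x). \<Theta> t x) \<in> L2 (cylinder T \<Omega>)" and \<theta>: "good T \<theta>"
    and ae: "AE z in cylinder T \<Omega>. (case z of (t, x) \<Rightarrow> \<Theta> t x) = (case z of (t, x) \<Rightarrow> \<theta> t x)"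
  shows "sqg_weak_solution \<Omega> w \<mu> T \<Theta> \<longleftrightarrow> (\<forall>\<phi>\<in>test_functions ({0<..<T} \<times> \<Omega>). wform \<theta> \<phi> = 0)"
proof -
  let ?I = "{0<..<T} :: real set"
  have Ib: "?I \<in> sets borel" by simp
  have "AE z in lebesgue. z \<in> ?I \<times> \<Omega> \<longrightarrow> case_prod \<Theta> z = case_prod \<theta> z"
    using ae cylinder_borel[of T] unfolding cylinder_def by (subst (asm) AE_restrict_space_iff) auto
  then have "AE z in lborel. z \<in> ?I \<times> \<Omega> \<longrightarrow> case_prod \<Theta> z = case_prod \<theta> z"
    by (simp only: AE_completion_iff)
  then have "AE z in lborel \<Otimes>\<^sub>M lborel. z \<in> ?I \<times> \<Omega> \<longrightarrow> case_prod \<Theta> z = case_prod \<theta> z"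
    unfolding lborel_prod .
  from lborel_pair.AE_pair[OF this]
  have "AE t in lborel. t \<in> ?I \<longrightarrow> (AE x in M. \<Theta> t x = \<theta> t x)"
  proof eventually_elim
    case (elim t)
    show ?case
    proof
      assume "t \<in> ?I"
      then have "AE x in lborel. x \<in> \<Omega> \<longrightarrow> \<Theta> t x = \<theta> t x" using elim by (auto elim: eventually_mono)
      then have "AE x in lebesgue. x \<in> \<Omega> \<longrightarrow> \<Theta> t x = \<theta> t x" by (rule AE_completion)
      then show "AE x in M. \<Theta> t x = \<theta> t x" by (subst AE_restrict_space_iff) auto
    qed
  qed
  then have slices: "AE t in lebesgue_on ?I. AE x in M. \<Theta> t x = \<theta> t x"
    by (subst AE_restrict_space_iff) (auto intro: AE_completion)
  \<comment> \<open>Here f will be an inner integral of the given function, with no measurability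
    assumed; it inherits measurability from g through completeness.\<close>
  have outer: "(LINT t|lebesgue_on ?I. f t) = (LINT t|lborel. g t)"
    if "AE t in lebesgue_on ?I. f t = g t" "g \<in> borel_measurable borel" "\<And>t. t \<notin> ?I \<Longrightarrow> g t = 0" for f g :: "real \<Rightarrow> real"
  proof -
    have gm: "g \<in> borel_measurable (lebesgue_on ?I)" by (rule borel_measurable_lebesgue_onI[OF that(2)])
    have "(LINT t|lebesgue_on ?I. f t) = (LINT t|lebesgue_on ?I. g t)"
      by (rule integral_cong_AE[OF borel_measurable_lebesgue_on_AE[OF Ib gm that(1)] gm that(1)])
    then show ?thesis using integral_lebesgue_on_borel[OF Ib that(2,3)] by simp
  qed
  have "(LINT t|lebesgue_on ?I. LINT x|M. \<Theta> t x * dir_deriv \<phi> (1, 0) (t, x))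
      + (LINT t|lebesgue_on ?I. LINT x|M. (\<Theta> t x *\<^sub>R sqg_velocity \<Omega> w \<mu> (\<Theta> t) x) \<bullet> space_grad \<phi> (t, x)) = wform \<theta> \<phi>"
    if \<phi>: "\<phi> \<in> test_functions (?I \<times> \<Omega>)" for \<phi>
  proof -
    have sm: "smooth \<phi>" by (rule test_functions_smooth[OF \<phi>])
    have d: "dir_deriv \<phi> (1, 0) \<in> test_functions (?I \<times> \<Omega>)" by (rule test_functions_dir_deriv[OF \<phi> time_Basis])
    note dt = slice_test_function[OF d]
    have H: "(\<lambda>z. case_prod \<theta> z * dir_deriv \<phi> (1, 0) z) \<in> borel_measurable borel"
      by (intro borel_measurable_times goodD(2)[OF \<theta>] smooth_borel_measurable test_functions_smooth[OF d])
    have "(LINT t|lebesgue_on ?I. LINT x|M. \<Theta> t x * dir_deriv \<phi> (1, 0) (t, x))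
        = (LINT t|lborel. LINT x|lborel. case_prod \<theta> (t, x) * dir_deriv \<phi> (1, 0) (t, x))"
    proof (rule outer[OF _ integral_borel[OF H]])
      show "AE t in lebesgue_on ?I. (LINT x|M. \<Theta> t x * dir_deriv \<phi> (1, 0) (t, x))
          = (LINT x|lborel. case_prod \<theta> (t, x) * dir_deriv \<phi> (1, 0) (t, x))"
        using slices
      proof eventually_elim
        case (elim t)
        have m: "\<Theta> t \<in> borel_measurable M"
          by (rule borel_measurable_lebesgue_on_AE[OF domain_borel L2_measurable[OF goodD(3)[OF \<theta>]] elim])
        have "L2_inner M (\<Theta> t) (\<lambda>x. dir_deriv \<phi> (1, 0) (t, x)) = L2_inner M (\<theta> t) (\<lambda>x. dir_deriv \<phi> (1, 0) (t, x))"
          by (rule L2_inner_AE_cong[OF m L2_measurable[OF goodD(3)[OF \<theta>]] test_function_measurable[OF dt] elim])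
        also have "\<dots> = L2_inner lborel (\<theta> t) (\<lambda>x. dir_deriv \<phi> (1, 0) (t, x))"
          by (rule L2_inner_lebesgue_on_borel[OF domain_borel goodD(4)[OF \<theta>] smooth_borel_measurable[OF test_functions_smooth[OF dt]] goodD(5)[OF \<theta>]])
        finally show ?case by (simp add: L2_inner_def)
      qed
    qed (simp add: goodD(6)[OF \<theta>])
    also have "\<dots> = L2_inner lborel (case_prod \<theta>) (dir_deriv \<phi> (1, 0))"
      using Fubini_integral[OF L2_mult_integrable[OF goodD(1)[OF \<theta>] test_function_L2_lborel[OF d]]] by (simp add: L2_inner_def)
    finally have 1: "(LINT t|lebesgue_on ?I. LINT x|M. \<Theta> t x * dir_deriv \<phi> (1, 0) (t, x))
      = L2_inner lborel (case_prod \<theta>) (dir_deriv \<phi> (1, 0))" .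
    have 2: "(LINT t|lebesgue_on ?I. LINT x|M. (\<Theta> t x *\<^sub>R sqg_velocity \<Omega> w \<mu> (\<Theta> t) x) \<bullet> space_grad \<phi> (t, x))
      = (LINT t|lborel. Qform (\<lambda>x. \<phi> (t, x)) (\<theta> t))"
    proof (rule outer[OF _ Qform_borel[OF \<theta> \<phi>]])
      show "AE t in lebesgue_on ?I. (LINT x|M. (\<Theta> t x *\<^sub>R sqg_velocity \<Omega> w \<mu> (\<Theta> t) x) \<bullet> space_grad \<phi> (t, x))
          = Qform (\<lambda>x. \<phi> (t, x)) (\<theta> t)"
        using slices
      proof eventually_elim
        case (elim t)
        note \<theta>m = L2_measurable[OF goodD(3)[OF \<theta>, of t]]
        have m: "\<Theta> t \<in> borel_measurable M"
          by (rule borel_measurable_lebesgue_on_AE[OF domain_borel \<theta>m elim])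
        have g: "grad_pot i (\<Theta> t) = grad_pot i (\<theta> t)" for i
          unfolding grad_pot_def Lambda_inv_cong[OF m \<theta>m elim] ..
        have "(LINT x|M. (\<Theta> t x *\<^sub>R sqg_velocity \<Omega> w \<mu> (\<Theta> t) x) \<bullet> space_grad \<phi> (t, x))
          = L2_inner M (\<Theta> t) (tr (\<lambda>x. \<phi> (t, x)) (grad_pot 1 (\<theta> t)) (grad_pot 2 (\<theta> t)))"
          unfolding sqg_integrand[OF sm] g L2_inner_def ..
        also have "\<dots> = Qform (\<lambda>x. \<phi> (t, x)) (\<theta> t)"
          unfolding Qform_def
          by (rule L2_inner_AE_cong[OF m \<theta>m L2_measurable[OF tr_L2[OF slice_test_function[OF \<phi>] grad_pot_L2 grad_pot_L2]] elim])
            (rule goodD(3)[OF \<theta>])+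
        finally show ?case .
      qed
    qed (simp add: goodD(6)[OF \<theta>] Qform_def L2_inner_zero_left)
    show ?thesis unfolding 1 2 wform_def ..
  qed
  then show ?thesis using L by (simp add: sqg_weak_solution_def)
qed

text \<open>An arbitrary square integrable g on all of space-time is cut off to the cylinder; the
  representatives vanish outside, so the pairing does not change.\<close>

lemma weak_convergence_representative:
  assumes c: "L2_converges_weakly (cylinder T \<Omega>) (\<lambda>n (t, x). \<Theta>s n t x) (\<lambda>(t, x). \<Theta> t x)"
    and good_s: "\<And>n. good T (\<theta>s n)" and good_l: "good T \<theta>"
    and ae_s: "\<And>n. AE z in cylinder T \<Omega>. (case z of (t, x) \<Rightarrow> \<Theta>s n t x) = (case z of (t, x) \<Rightarrow> \<theta>s n t x)"
    and ae: "AE z in cylinder T \<Omega>. (case z of (t, x) \<Rightarrow> \<Theta> t x) = (case z of (t, x) \<Rightarrow> \<theta> t x)"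
  shows "L2_converges_weakly lborel (\<lambda>n. case_prod (\<theta>s n)) (case_prod \<theta>)"
  unfolding L2_converges_weakly_def
proof (intro conjI allI ballI)
  let ?C = "{0<..<T} \<times> \<Omega>"
  fix g assume g: "g \<in> L2 (lborel :: (real \<times> (real^2)) measure)"
  define g0 where "g0 z = indicator ?C z * g z" for z
  have gb: "g \<in> borel_measurable borel" using L2_measurable[OF g] by simp
  have g0b: "g0 \<in> borel_measurable borel"
    unfolding g0_def[abs_def] using gb borel_measurable_indicator[OF cylinder_borel] by (intro borel_measurable_times)
  have "(indicator ?C :: _ \<Rightarrow> real) \<in> borel_measurable (lborel :: (real \<times> (real^2)) measure)"
    by (rule borel_measurable_indicator) (use cylinder_borel in simp)
  then have "g0 \<in> L2 lborel"
    unfolding g0_def[abs_def] by (rule L2_bounded_mult[OF g, where C=1]) simp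
  then have g0L: "g0 \<in> L2 (cylinder T \<Omega>)"
    unfolding cylinder_def using L2_lebesgue_on_borel[OF cylinder_borel g0b] by (auto simp: g0_def)
  have eq: "L2_inner (cylinder T \<Omega>) (\<lambda>(t, x). \<Theta> t x) g0 = L2_inner lborel (case_prod \<theta>) g"
    if \<theta>: "good T \<theta>" and ae: "AE z in cylinder T \<Omega>. (case z of (t, x) \<Rightarrow> \<Theta> t x) = (case z of (t, x) \<Rightarrow> \<theta> t x)"
      and L: "(\<lambda>(t, x). \<Theta> t x) \<in> L2 (cylinder T \<Omega>)" for \<theta> \<Theta>
  proof -
    have z: "case_prod \<theta> z = 0" if "z \<notin> ?C" for z using \<theta> that by (cases z) (auto simp: good_def)
    have "L2_inner (cylinder T \<Omega>) (\<lambda>(t, x). \<Theta> t x) g0 = L2_inner (lebesgue_on ?C) (case_prod \<theta>) g0"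
      unfolding cylinder_def[symmetric]
      by (rule L2_inner_AE_cong[OF L2_measurable[OF L] _ L2_measurable[OF g0L] ae])
        (simp add: cylinder_def borel_measurable_lebesgue_onI goodD(2)[OF \<theta>])
    also have "\<dots> = L2_inner lborel (case_prod \<theta>) g0"
      by (rule L2_inner_lebesgue_on_borel[OF cylinder_borel goodD(2)[OF \<theta>] g0b z])
    also have "\<dots> = L2_inner lborel (case_prod \<theta>) g"
    proof -
      have "case_prod \<theta> z * g0 z = case_prod \<theta> z * g z" for z
        using z[of z] by (cases "z \<in> ?C") (simp_all add: g0_def)
      then show ?thesis by (simp only: L2_inner_def)
    qed
    finally show ?thesis .
  qed
  have L: "(\<lambda>(t, x). \<Theta>s n t x) \<in> L2 (cylinder T \<Omega>)" "(\<lambda>(t, x). \<Theta> t x) \<in> L2 (cylinder T \<Omega>)" for n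
    using c by (auto simp: L2_converges_weakly_def)
  have "(\<lambda>n. L2_inner (cylinder T \<Omega>) (\<lambda>(t, x). \<Theta>s n t x) g0) \<longlonglongrightarrow> L2_inner (cylinder T \<Omega>) (\<lambda>(t, x). \<Theta> t x) g0"
    using c g0L by (simp add: L2_converges_weakly_def)
  then show "(\<lambda>n. L2_inner lborel (case_prod (\<theta>s n)) g) \<longlonglongrightarrow> L2_inner lborel (case_prod \<theta>) g"
    by (simp only: eq[OF good_s ae_s L(1)] eq[OF good_l ae L(2)])
qed (intro goodD(1)[OF good_s] goodD(1)[OF good_l])+

end

theorem corollary1p7:
  fixes \<Omega> :: "(real^2) set" and T :: real
    and w :: "nat \<Rightarrow> real^2 \<Rightarrow> real" and \<mu> :: "nat \<Rightarrow> real"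
    and \<theta>s :: "nat \<Rightarrow> real \<Rightarrow> real^2 \<Rightarrow> real" and \<theta> :: "real \<Rightarrow> real^2 \<Rightarrow> real"
  assumes "bounded_smooth_domain \<Omega>" and "T > 0"
    and "dirichlet_eigenbasis \<Omega> w \<mu>"
    and "\<And>n. sqg_weak_solution \<Omega> w \<mu> T (\<theta>s n)"
    and "L2_converges_weakly (cylinder T \<Omega>) (\<lambda>n (t, x). \<theta>s n t x) (\<lambda>(t, x). \<theta> t x)"
  shows "sqg_weak_solution \<Omega> w \<mu> T \<theta>"
proof -
  interpret dirichlet_domain \<Omega> w \<mu>
    using assms(1,3) by unfold_locales (auto simp: bounded_smooth_domain_def)
  have L: "(\<lambda>(t, x). \<theta>s n t x) \<in> L2 (cylinder T \<Omega>)" "(\<lambda>(t, x). \<theta> t x) \<in> L2 (cylinder T \<Omega>)" for n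
    using assms(5) by (auto simp: L2_converges_weakly_def)
  have "\<exists>\<theta>'. good T \<theta>' \<and> (AE z in cylinder T \<Omega>. (case z of (t, x) \<Rightarrow> \<theta>s n t x) = (case z of (t, x) \<Rightarrow> \<theta>' t x))" for n
    using good_representative[OF L(1)[of n]] by blast
  then obtain \<theta>s' where s: "\<And>n. good T (\<theta>s' n)"
    "\<And>n. AE z in cylinder T \<Omega>. (case z of (t, x) \<Rightarrow> \<theta>s n t x) = (case z of (t, x) \<Rightarrow> \<theta>s' n t x)" by metis
  obtain \<theta>' where l: "good T \<theta>'" "AE z in cylinder T \<Omega>. (case z of (t, x) \<Rightarrow> \<theta> t x) = (case z of (t, x) \<Rightarrow> \<theta>' t x)"
    using good_representative[OF L(2)] by blast
  have "wform (\<theta>s' n) \<phi> = 0" if "\<phi> \<in> test_functions ({0<..<T} \<times> \<Omega>)" for n \<phi>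
    using sqg_weak_solution_iff_wform[OF L(1) s] assms(4) that by blast
  then have "wform \<theta>' \<phi> = 0" if "\<phi> \<in> test_functions ({0<..<T} \<times> \<Omega>)" for \<phi>
    using wform_limit[OF assms(2) s(1) l(1) weak_convergence_representative[OF assms(5) s(1) l(1) s(2) l(2)]] that by blast
  then show ?thesis using sqg_weak_solution_iff_wform[OF L(2) l] by blast
qed

end
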